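(* Let $N=(G,+,<)$ be elementarily equivalent to an archimedean ordered abelian group of finite rank, and let $M$ be a reduct (but not necessarily a $0$-reduct) of $N$ that expands $(G,+)$. Suppose that one of the following (equivalent) conditions holds: (1) $M$ is stable, or (2) every unary subset $D\subseteq G$ that is definable in $M$ is also definable in $(G,+)$. Then $M$ is interdefinable with $(G,+)$.
   Context: "Definable" without a specified parameter set means definable with parameters from the structure. For structures $M,N$ with the same universe and a subset $A$ of that universe, $M$ is an $A$-reduct of $N$ (equivalently $N$ is an $A$-expansion of $M$) if every $X\subseteq M^k$ (any $k$) that is $\emptyset$-definable in $M$ is $A$-definable in $N$. When $A$ is the whole universe one says reduct/expansion; when $A=\emptyset$ one says $0$-reduct/$0$-expansion. $M$ and $N$ are interdefinable if each is a reduct of the other. A structure expands $(G,+)$ if it is an expansion of the structure $(G,+)$. An ordered abelian group is an abelian group with a linear order $<$ such that $a<b$ implies $a+c<b+c$ (so it is torsion-free). It is archimedean if for every $a,b\in G$ with $a\neq 0$ there is $n\in\mathbb{Z}$ with $b<na$. The rank of a torsion-free abelian group $A$ is the dimension over $\mathbb{Q}$ of its divisible hull $\mathbb{Q}\otimes_{\mathbb{Z}}A$. *)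

theory Defs
  imports Complex_Main
begin

section \<open>First-order structures and definability\<close>

datatype 'f fo_term = FVar nat | FApp 'f "'f fo_term list"

datatype ('f, 'r) fo_formula =
    FEq "'f fo_term" "'f fo_term"
  | FRel 'r "'f fo_term list"
  | FNot "('f, 'r) fo_formula"
  | FAnd "('f, 'r) fo_formula" "('f, 'r) fo_formula"
  | FEx nat "('f, 'r) fo_formula"

text \<open>
  The universe of a structure is the whole type \<^typ>\<open>'a\<close>. The language is the set of
  function symbols and the set of relation symbols, each listed together with its arity;
  the interpretations matter only at symbols of the language and at arguments of the
  listed arity, which is what well-formedness of formulas enforces.
\<close>

record ('a, 'f, 'r) fo_structure =
  fun_syms :: "('f \<times> nat) set"
  rel_syms :: "('r \<times> nat) set"
  fun_int :: "'f \<Rightarrow> 'a list \<Rightarrow> 'a"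
  rel_int :: "'r \<Rightarrow> 'a list \<Rightarrow> bool"

fun wf_term :: "('a, 'f, 'r) fo_structure \<Rightarrow> 'f fo_term \<Rightarrow> bool" where
  "wf_term M (FVar i) \<longleftrightarrow> True"
| "wf_term M (FApp f ts) \<longleftrightarrow> (f, length ts) \<in> fun_syms M \<and> (\<forall>t\<in>set ts. wf_term M t)"

fun wf_formula :: "('a, 'f, 'r) fo_structure \<Rightarrow> ('f, 'r) fo_formula \<Rightarrow> bool" where
  "wf_formula M (FEq s t) \<longleftrightarrow> wf_term M s \<and> wf_term M t"
| "wf_formula M (FRel r ts) \<longleftrightarrow> (r, length ts) \<in> rel_syms M \<and> (\<forall>t\<in>set ts. wf_term M t)"
| "wf_formula M (FNot p) \<longleftrightarrow> wf_formula M p"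
| "wf_formula M (FAnd p q) \<longleftrightarrow> wf_formula M p \<and> wf_formula M q"
| "wf_formula M (FEx i p) \<longleftrightarrow> wf_formula M p"

fun term_vars :: "'f fo_term \<Rightarrow> nat set" where
  "term_vars (FVar i) = {i}"
| "term_vars (FApp f ts) = (\<Union>t\<in>set ts. term_vars t)"

fun free_vars :: "('f, 'r) fo_formula \<Rightarrow> nat set" where
  "free_vars (FEq s t) = term_vars s \<union> term_vars t"
| "free_vars (FRel r ts) = (\<Union>t\<in>set ts. term_vars t)"
| "free_vars (FNot p) = free_vars p"
| "free_vars (FAnd p q) = free_vars p \<union> free_vars q"
| "free_vars (FEx i p) = free_vars p - {i}"

fun term_val :: "('a, 'f, 'r) fo_structure \<Rightarrow> (nat \<Rightarrow> 'a) \<Rightarrow> 'f fo_term \<Rightarrow> 'a" where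
  "term_val M v (FVar i) = v i"
| "term_val M v (FApp f ts) = fun_int M f (map (term_val M v) ts)"

fun satisfies :: "('a, 'f, 'r) fo_structure \<Rightarrow> (nat \<Rightarrow> 'a) \<Rightarrow> ('f, 'r) fo_formula \<Rightarrow> bool" where
  "satisfies M v (FEq s t) \<longleftrightarrow> term_val M v s = term_val M v t"
| "satisfies M v (FRel r ts) \<longleftrightarrow> rel_int M r (map (term_val M v) ts)"
| "satisfies M v (FNot p) \<longleftrightarrow> \<not> satisfies M v p"
| "satisfies M v (FAnd p q) \<longleftrightarrow> satisfies M v p \<and> satisfies M v q"
| "satisfies M v (FEx i p) \<longleftrightarrow> (\<exists>a. satisfies M (v(i := a)) p)"

definition elementarily_equivalent ::
    "('a, 'f, 'r) fo_structure \<Rightarrow> ('b, 'f, 'r) fo_structure \<Rightarrow> bool" where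
  "elementarily_equivalent M N \<longleftrightarrow>
     fun_syms M = fun_syms N \<and> rel_syms M = rel_syms N \<and>
     (\<forall>p. wf_formula M p \<and> free_vars p = {} \<longrightarrow>
        ((\<forall>v. satisfies M v p) \<longleftrightarrow> (\<forall>v. satisfies N v p)))"

text \<open>
  Subsets of the k-th cartesian power are sets of lists of length k. In the formula,
  variables 0, ..., k-1 stand for the coordinates and the variables from k on for the
  parameters \<open>cs\<close>, which are taken from \<open>A\<close>.
\<close>

definition definable_over ::
    "('a, 'f, 'r) fo_structure \<Rightarrow> 'a set \<Rightarrow> nat \<Rightarrow> 'a list set \<Rightarrow> bool" where
  "definable_over M A k X \<longleftrightarrow>
     (\<exists>p cs. wf_formula M p \<and> set cs \<subseteq> A \<and> free_vars p \<subseteq> {..<k + length cs} \<and>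
        X = {xs. length xs = k \<and> satisfies M (\<lambda>i. (xs @ cs) ! i) p})"

abbreviation definable :: "('a, 'f, 'r) fo_structure \<Rightarrow> nat \<Rightarrow> 'a list set \<Rightarrow> bool" where
  "definable M k X \<equiv> definable_over M UNIV k X"

definition unary_definable :: "('a, 'f, 'r) fo_structure \<Rightarrow> 'a set \<Rightarrow> bool" where
  "unary_definable M D \<longleftrightarrow> definable M 1 {[x] | x. x \<in> D}"

definition reduct_over ::
    "'a set \<Rightarrow> ('a, 'f, 'r) fo_structure \<Rightarrow> ('a, 'g, 's) fo_structure \<Rightarrow> bool" where
  "reduct_over A M N \<longleftrightarrow> (\<forall>k X. definable_over M {} k X \<longrightarrow> definable_over N A k X)"

abbreviation reduct :: "('a, 'f, 'r) fo_structure \<Rightarrow> ('a, 'g, 's) fo_structure \<Rightarrow> bool" where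
  "reduct M N \<equiv> reduct_over UNIV M N"

abbreviation expansion :: "('a, 'f, 'r) fo_structure \<Rightarrow> ('a, 'g, 's) fo_structure \<Rightarrow> bool" where
  "expansion M N \<equiv> reduct N M"

definition interdefinable ::
    "('a, 'f, 'r) fo_structure \<Rightarrow> ('a, 'g, 's) fo_structure \<Rightarrow> bool" where
  "interdefinable M N \<longleftrightarrow> reduct M N \<and> reduct N M"

text \<open>
  Stability: no formula p(x;y), with x of length m and y of length n, orders arbitrarily
  long finite sequences of tuples of M. By compactness this says that no formula orders
  an infinite sequence of tuples in some model of the theory of M.
\<close>

definition has_order_of_length ::
    "('a, 'f, 'r) fo_structure \<Rightarrow> ('f, 'r) fo_formula \<Rightarrow> nat \<Rightarrow> nat \<Rightarrow> nat \<Rightarrow> bool" where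
  "has_order_of_length M p m n k \<longleftrightarrow>
     (\<exists>a b. (\<forall>i<k. length (a i) = m \<and> length (b i) = n) \<and>
        (\<forall>i<k. \<forall>j<k. satisfies M (\<lambda>l. (a i @ b j) ! l) p \<longleftrightarrow> i \<le> j))"

definition stable :: "('a, 'f, 'r) fo_structure \<Rightarrow> bool" where
  "stable M \<longleftrightarrow>
     (\<forall>p m n. wf_formula M p \<and> free_vars p \<subseteq> {..<m + n} \<longrightarrow>
        (\<exists>k. \<not> has_order_of_length M p m n k))"


section \<open>The structures (G,+) and (G,+,<)\<close>

datatype group_symbol = PlusSym
datatype order_symbol = LessSym

definition group_structure :: "('a::plus, group_symbol, order_symbol) fo_structure" where
  "group_structure =
     \<lparr>fun_syms = {(PlusSym, 2)}, rel_syms = {},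
      fun_int = (\<lambda>_ xs. xs ! 0 + xs ! 1), rel_int = (\<lambda>_ _. False)\<rparr>"

definition ordered_group_structure :: "('a::{plus,ord}, group_symbol, order_symbol) fo_structure" where
  "ordered_group_structure =
     \<lparr>fun_syms = {(PlusSym, 2)}, rel_syms = {(LessSym, 2)},
      fun_int = (\<lambda>_ xs. xs ! 0 + xs ! 1), rel_int = (\<lambda>_ xs. xs ! 0 < xs ! 1)\<rparr>"


section \<open>Integer multiples and the archimedean property\<close>

definition zmul :: "int \<Rightarrow> 'a::ab_group_add \<Rightarrow> 'a" where
  "zmul n a = ((+) a ^^ nat n) 0 - ((+) a ^^ nat (- n)) 0"

lemma zmul_nonneg: "zmul (int n) a = ((+) a ^^ n) 0"
  by (simp add: zmul_def)

lemma zmul_0_left [simp]: "zmul 0 a = 0"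
  by (simp add: zmul_def)

lemma zmul_Suc: "zmul (n + 1) a = a + zmul n a"
proof (cases "n \<ge> 0")
  case True
  then show ?thesis by (simp add: zmul_def nat_add_distrib)
next
  case False
  then have "nat (- n) = Suc (nat (- (n + 1)))" by simp
  moreover have "nat n = 0" "nat (n + 1) = 0" using False by simp_all
  ultimately show ?thesis by (simp add: zmul_def)
qed

lemma zmul_pred: "zmul (n - 1) a = zmul n a - a"
  using zmul_Suc [of "n - 1" a] by (simp add: algebra_simps)

lemma zmul_1_left [simp]: "zmul 1 a = a"
  using zmul_Suc [of 0 a] by simp

lemma zmul_add_left: "zmul (m + n) a = zmul m a + zmul n a"
proof (induction m rule: int_induct [where k = 0])
  case (step1 i)
  have "zmul (i + 1 + n) a = zmul ((i + n) + 1) a" by (simp add: algebra_simps)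
  then show ?case using step1 by (simp only: zmul_Suc) (simp add: algebra_simps)
next
  case (step2 i)
  have "zmul (i - 1 + n) a = zmul ((i + n) - 1) a" by (simp add: algebra_simps)
  then show ?case using step2 by (simp only: zmul_pred) (simp add: algebra_simps)
qed simp

lemma zmul_add_right: "zmul m (a + b) = zmul m a + zmul m b"
  by (induction m rule: int_induct [where k = 0])
     (simp_all add: zmul_Suc zmul_pred algebra_simps)

lemma zmul_zmul: "zmul m (zmul n a) = zmul (m * n) a"
proof (induction m rule: int_induct [where k = 0])
  case (step1 i)
  have "zmul ((i + 1) * n) a = zmul (n + i * n) a" by (simp add: algebra_simps)
  then show ?case using step1 by (simp add: zmul_add_left add.commute)
next
  case (step2 i)
  have "zmul (i * n) a = zmul ((i - 1) * n + n) a" by (simp add: algebra_simps)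
  then show ?case using step2 by (simp only: zmul_pred zmul_add_left) simp
qed simp

lemma module_zmul: "module (zmul :: int \<Rightarrow> 'a::ab_group_add \<Rightarrow> 'a)"
  by unfold_locales (simp_all add: zmul_add_left zmul_add_right zmul_zmul)

lemma zmul_0_right [simp]: "zmul n 0 = 0"
  by (rule module.scale_zero_right [OF module_zmul])

lemma zmul_minus_right: "zmul n (- a) = - zmul n a"
  by (rule module.scale_minus_right [OF module_zmul])

definition archimedean_group :: "'a::linordered_ab_group_add itself \<Rightarrow> bool" where
  "archimedean_group _ \<longleftrightarrow> (\<forall>a b :: 'a. a \<noteq> 0 \<longrightarrow> (\<exists>n::int. b < zmul n a))"


section \<open>The divisible hull and finite rank\<close>

text \<open>
  The tensor product of an abelian group A with the rationals, realised as the
  localisation of A at the nonzero integers: the pair (a, m) stands for the fraction a/m.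
  The factor k makes the relation transitive when A has torsion; it can be dropped when A is
  torsion-free.
\<close>

definition hull_rel :: "'a::ab_group_add \<times> int \<Rightarrow> 'a \<times> int \<Rightarrow> bool" where
  "hull_rel x y \<longleftrightarrow> snd x \<noteq> 0 \<and> snd y \<noteq> 0 \<and>
     (\<exists>k. k \<noteq> 0 \<and> zmul (k * snd y) (fst x) = zmul (k * snd x) (fst y))"

lemma hull_relI:
  "\<lbrakk>m \<noteq> 0; n \<noteq> 0; k \<noteq> 0; zmul (k * n) a = zmul (k * m) b\<rbrakk> \<Longrightarrow> hull_rel (a, m) (b, n)"
  by (auto simp: hull_rel_def)

lemma hull_rel_refl: "snd x \<noteq> 0 \<Longrightarrow> hull_rel x x"
  unfolding hull_rel_def by (intro conjI exI [of _ 1]) simp_all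

lemma part_equivp_hull_rel: "part_equivp (hull_rel :: 'a::ab_group_add \<times> int \<Rightarrow> _)"
proof (rule part_equivpI)
  show "\<exists>x :: 'a \<times> int. hull_rel x x"
    by (rule exI [of _ "(0, 1)"]) (simp add: hull_rel_refl)
  show "symp (hull_rel :: 'a \<times> int \<Rightarrow> _)"
    by (rule sympI) (metis hull_rel_def)
  show "transp (hull_rel :: 'a \<times> int \<Rightarrow> _)"
  proof (rule transpI, unfold split_paired_all)
    fix a b c :: 'a and m n p :: int
    assume "hull_rel (a, m) (b, n)" "hull_rel (b, n) (c, p)"
    then obtain k l where nz: "m \<noteq> 0" "n \<noteq> 0" "p \<noteq> 0" "k \<noteq> 0" "l \<noteq> 0"
      and k: "zmul (k * n) a = zmul (k * m) b" and l: "zmul (l * p) b = zmul (l * n) c"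
      by (auto simp: hull_rel_def)
    have "zmul ((k * l * n) * p) a = zmul (l * p) (zmul (k * n) a)"
      by (simp add: zmul_zmul ac_simps)
    also have "\<dots> = zmul (k * m) (zmul (l * p) b)"
      by (simp add: k zmul_zmul ac_simps)
    also have "\<dots> = zmul ((k * l * n) * m) c"
      by (simp add: l zmul_zmul ac_simps)
    finally show "hull_rel (a, m) (c, p)"
      using nz by (intro hull_relI [of _ _ "k * l * n"]) simp_all
  qed
qed

quotient_type (overloaded) 'a divisible_hull = "'a::ab_group_add \<times> int" / partial: "hull_rel"
  by (rule part_equivp_hull_rel)

lift_definition hull_frac :: "'a::ab_group_add \<Rightarrow> int \<Rightarrow> 'a divisible_hull"
  is "\<lambda>a m. if m = 0 then (0, 1) else (a, m)"
  by (simp add: hull_rel_refl)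

lemma hull_frac_cases [cases type: divisible_hull]:
  obtains a m where "x = hull_frac a m" "m \<noteq> 0"
  by transfer (auto simp: hull_rel_def)

lemma hull_frac_eq_iff:
  "\<lbrakk>m \<noteq> 0; n \<noteq> 0\<rbrakk> \<Longrightarrow> hull_frac a m = hull_frac b n \<longleftrightarrow>
     (\<exists>k. k \<noteq> 0 \<and> zmul (k * n) a = zmul (k * m) b)"
  by transfer (simp add: hull_rel_def)

lemma hull_frac_eqI:
  "\<lbrakk>m \<noteq> 0; n \<noteq> 0; zmul n a = zmul m b\<rbrakk> \<Longrightarrow> hull_frac a m = hull_frac b n"
  by (subst hull_frac_eq_iff) (assumption, assumption, rule exI [of _ 1], simp)

instantiation divisible_hull :: (ab_group_add) ab_group_add
begin

lift_definition zero_divisible_hull :: "'a divisible_hull" is "(0, 1)"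
  by (simp add: hull_rel_refl)

lift_definition plus_divisible_hull :: "'a divisible_hull \<Rightarrow> 'a divisible_hull \<Rightarrow> 'a divisible_hull"
  is "\<lambda>x y. (zmul (snd y) (fst x) + zmul (snd x) (fst y), snd x * snd y)"
proof -
  fix x x' y y' :: "'a \<times> int"
  obtain a m a' m' b n b' n' where [simp]: "x = (a, m)" "x' = (a', m')" "y = (b, n)" "y' = (b', n')"
    by (metis surj_pair)
  assume "hull_rel x x'" "hull_rel y y'"
  then obtain k l where nz: "m \<noteq> 0" "m' \<noteq> 0" "n \<noteq> 0" "n' \<noteq> 0" "k \<noteq> 0" "l \<noteq> 0"
    and k: "zmul (k * m') a = zmul (k * m) a'" and l: "zmul (l * n') b = zmul (l * n) b'"
    by (auto simp: hull_rel_def)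
  have "zmul ((k * l) * (m' * n')) (zmul n a + zmul m b)
      = zmul (l * n' * n) (zmul (k * m') a) + zmul (k * m' * m) (zmul (l * n') b)"
    by (simp add: zmul_zmul zmul_add_right ac_simps)
  also have "\<dots> = zmul ((k * l) * (m * n)) (zmul n' a' + zmul m' b')"
    by (simp add: k l zmul_zmul zmul_add_right ac_simps)
  finally show "?thesis x x' y y'"
    using nz by (auto intro!: hull_relI [of _ _ "k * l"])
qed

lift_definition uminus_divisible_hull :: "'a divisible_hull \<Rightarrow> 'a divisible_hull"
  is "\<lambda>x. (- fst x, snd x)"
  by (auto simp: hull_rel_def zmul_minus_right)

definition minus_divisible_hull :: "'a divisible_hull \<Rightarrow> 'a divisible_hull \<Rightarrow> 'a divisible_hull" where
  "minus_divisible_hull x y = x + - y"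

lemma hull_frac_0: "0 = hull_frac 0 1"
  by transfer (simp add: hull_rel_refl)

lemma hull_frac_add:
  "\<lbrakk>m \<noteq> 0; n \<noteq> 0\<rbrakk> \<Longrightarrow> hull_frac a m + hull_frac b n = hull_frac (zmul n a + zmul m b) (m * n)"
  by transfer (simp add: hull_rel_refl)

lemma hull_frac_uminus: "m \<noteq> 0 \<Longrightarrow> - hull_frac a m = hull_frac (- a) m"
  by transfer (simp add: hull_rel_refl)

instance
proof
  fix x y z :: "'a divisible_hull"
  obtain a m where x: "x = hull_frac a m" "m \<noteq> 0" by (rule hull_frac_cases)
  obtain b n where y: "y = hull_frac b n" "n \<noteq> 0" by (rule hull_frac_cases)
  obtain c p where z: "z = hull_frac c p" "p \<noteq> 0" by (rule hull_frac_cases)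
  show "x + y + z = x + (y + z)"
    using x y z by (simp add: hull_frac_add zmul_add_right zmul_zmul ac_simps)
  show "x + y = y + x"
    using x y by (simp add: hull_frac_add ac_simps)
  show "0 + x = x"
    using x by (simp add: hull_frac_0 hull_frac_add)
  show "- x + x = 0"
    using x by (simp add: hull_frac_0 hull_frac_uminus hull_frac_add zmul_minus_right)
       (rule hull_frac_eqI, simp_all)
  show "x - y = x + - y"
    by (simp add: minus_divisible_hull_def)
qed

end

lift_definition hull_scale :: "rat \<Rightarrow> 'a::ab_group_add divisible_hull \<Rightarrow> 'a divisible_hull"
  is "\<lambda>q x. (zmul (fst (quotient_of q)) (fst x), snd (quotient_of q) * snd x)"
proof -
  fix q :: rat and x y :: "'a \<times> int"
  obtain r s where q: "quotient_of q = (r, s)" by (metis surj_pair)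
  have s: "s \<noteq> 0" using quotient_of_denom_pos [OF q] by simp
  obtain a m b n where [simp]: "x = (a, m)" "y = (b, n)" by (metis surj_pair)
  assume "hull_rel x y"
  then obtain k where nz: "m \<noteq> 0" "n \<noteq> 0" "k \<noteq> 0" and k: "zmul (k * n) a = zmul (k * m) b"
    by (auto simp: hull_rel_def)
  have "zmul (k * (s * n)) (zmul r a) = zmul (s * r) (zmul (k * n) a)"
    by (simp add: zmul_zmul ac_simps)
  also have "\<dots> = zmul (k * (s * m)) (zmul r b)"
    by (simp add: k zmul_zmul ac_simps)
  finally show "?thesis q x y"
    using nz s by (auto simp: q intro!: hull_relI [of _ _ k])
qed

lemma hull_scale_Fract:
  assumes "s \<noteq> 0" "m \<noteq> 0"
  shows "hull_scale (Fract r s) (hull_frac a m) = hull_frac (zmul r a) (s * m)"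
proof -
  obtain r' s' where q: "quotient_of (Fract r s) = (r', s')" by (metis surj_pair)
  have s': "s' \<noteq> 0" using quotient_of_denom_pos [OF q] by simp
  have "r' * s = r * s'"
    using quotient_of_eq [OF q] s' \<open>s \<noteq> 0\<close> by (simp add: eq_rat)
  then have "zmul (s * m) (zmul r' a) = zmul (s' * m) (zmul r a)"
    by (simp add: zmul_zmul ac_simps)
  moreover have "hull_scale (Fract r s) (hull_frac a m) = hull_frac (zmul r' a) (s' * m)"
    using \<open>m \<noteq> 0\<close> s' q by transfer (simp add: hull_rel_refl)
  ultimately show ?thesis
    using s' assms by (simp only:) (rule hull_frac_eqI, simp_all)
qed

lemma vector_space_hull_scale:
  "vector_space (hull_scale :: rat \<Rightarrow> 'a::ab_group_add divisible_hull \<Rightarrow> 'a divisible_hull)"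
proof
  fix q q' :: rat and x y :: "'a divisible_hull"
  obtain a m where x: "x = hull_frac a m" "m \<noteq> 0" by (rule hull_frac_cases)
  obtain b n where y: "y = hull_frac b n" "n \<noteq> 0" by (rule hull_frac_cases)
  obtain r s where q: "q = Fract r s" "s \<noteq> 0" by (cases q) auto
  obtain r' s' where q': "q' = Fract r' s'" "s' \<noteq> 0" by (cases q') auto
  show "hull_scale q (x + y) = hull_scale q x + hull_scale q y"
    using x y q by (simp add: hull_frac_add hull_scale_Fract)
      (rule hull_frac_eqI, simp_all add: zmul_add_right zmul_zmul ac_simps)
  show "hull_scale (q + q') x = hull_scale q x + hull_scale q' x"
    using x q q' by (simp add: hull_frac_add hull_scale_Fract)
      (rule hull_frac_eqI, simp_all add: zmul_add_right zmul_add_left [symmetric] zmul_zmul algebra_simps)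
  show "hull_scale q (hull_scale q' x) = hull_scale (q * q') x"
    using x q q' by (simp add: hull_scale_Fract zmul_zmul ac_simps)
  show "hull_scale 1 x = x"
    using x by (simp add: One_rat_def hull_scale_Fract)
qed

definition finite_rank :: "'a::ab_group_add itself \<Rightarrow> bool" where
  "finite_rank _ \<longleftrightarrow>
     (\<exists>B. finite_dimensional_vector_space
        (hull_scale :: rat \<Rightarrow> 'a divisible_hull \<Rightarrow> 'a divisible_hull) B)"

end

theory Submission
  imports Defs "HOL-Library.Ramsey" "HOL-Library.Infinite_Set" "HOL-Computational_Algebra.Primes"
begin

text \<open>
  An ordered abelian group that is elementarily equivalent to an archimedean one of finite rank
  inherits two first-order properties: for \<open>g > 0\<close> every interval \<open>[a, a + m g)\<close> contains a multiple
  \<open>m y\<close> (\<open>regular_transfer\<close>), and every quotient \<open>G/nG\<close> is finite (\<open>finite_index_transfer\<close>).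
  On a coset of \<open>nG\<close> congruences disappear, so an existential quantifier only has to be eliminated from linear inequalities, or, without the order, from linear
  equations; this is \<open>Comb_ex\<close>. Hence the sets definable in \<open>(G,+,<)\<close> are the Boolean combinations of
  linear inequalities and congruences, and those definable in \<open>(G,+)\<close>, called linear here, are the
  Boolean combinations of linear equations and congruences.

  Both hypotheses enter through unary sets only. If a unary set \<open>U\<close> is a Boolean combination of
  inequalities and is neither finite nor cofinite, then for every \<open>k\<close> some arithmetic progression
  of length \<open>2k + 1\<close> meets \<open>U\<close> exactly in its first \<open>k + 1\<close> terms (\<open>semilinear_order_pattern\<close>), so the relation
  \<open>x + y \<in> U\<close> orders arbitrarily long sequences. This contradicts stability of \<open>M\<close>. It also contradicts
  linearity of \<open>U\<close>, because by Ramsey's theorem a relation made of equations and congruences orders no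
  long sequences (\<open>linear_order_bound\<close>). So under either hypothesis a unary \<open>M\<close>-definable Boolean
  combination of inequalities is finite or cofinite.

  From this tameness it follows that every \<open>M\<close>-definable set is linear (\<open>Def_linear\<close>), by induction on
  the number of variables. On a coset the set \<open>X\<close> is a Boolean combination of inequalities, and its
  fibres over the last coordinate are finite or cofinite. A fibre \<open>S\<close> is cofinite iff \<open>S + S = G\<close>, so
  the base points with cofinite fibre form an \<open>M\<close>-definable set in fewer variables, and all fibres may
  be assumed finite. Then \<open>X\<close> lies in finitely many hyperplanes transversal to the fibres
  (\<open>finite_fibres_hyperplanes\<close>), and on each of them it is a graph over an \<open>M\<close>-definable set in fewer
  variables.

  For the hyperplanes one needs that points of \<open>X\<close> stay close to the walls of the arrangement that
  defines \<open>X\<close>, since a point with room on both sides has an infinite fibre. In a dense group this is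
  clear. In a discrete group with infinite elements a family of points ever further away from the
  walls overspills to a point infinitely far away. In the integers all finite distances occur inside the
  group, and lines in other directions must be used (\<open>bounded_distance\<close>): the difference of two far
  points gives a direction in which \<open>X\<close> contains a half-line, the fact that a line has the same
  status at both of its ends lets this status pass through every wall at infinity, and so it is carried
  over to the direction of the fibres, where it contradicts their finiteness.

  Conversely, linear sets are definable in \<open>(G,+)\<close> and define stable relations, which gives
  interdefinability and the remaining implication between the two conditions.
\<close>


section \<open>Renaming variables in formulas\<close>

fun ren_term :: "(nat \<Rightarrow> nat) \<Rightarrow> 'f fo_term \<Rightarrow> 'f fo_term" where
  "ren_term r (FVar i) = FVar (r i)"
| "ren_term r (FApp f ts) = FApp f (map (ren_term r) ts)"

fun ren_fm :: "(nat \<Rightarrow> nat) \<Rightarrow> ('f, 'r) fo_formula \<Rightarrow> ('f, 'r) fo_formula" where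
  "ren_fm r (FEq s t) = FEq (ren_term r s) (ren_term r t)"
| "ren_fm r (FRel q ts) = FRel q (map (ren_term r) ts)"
| "ren_fm r (FNot p) = FNot (ren_fm r p)"
| "ren_fm r (FAnd p q) = FAnd (ren_fm r p) (ren_fm r q)"
| "ren_fm r (FEx i p) = FEx (r i) (ren_fm r p)"

lemma wf_ren_term [simp]: "wf_term M (ren_term r t) = wf_term M t"
  by (induction t) auto

lemma wf_ren_fm [simp]: "wf_formula M (ren_fm r p) = wf_formula M p"
  by (induction p) auto

lemma term_val_ren: "term_val M v (ren_term r t) = term_val M (\<lambda>i. v (r i)) t"
  by (induction t) (auto intro!: arg_cong [of _ _ "fun_int M _"])

text \<open>
  Injectivity is what makes renaming of bound variables harmless: an update at \<open>r i\<close> touches no other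
  renamed variable.
\<close>

lemma satisfies_ren:
  assumes "inj r"
  shows "satisfies M v (ren_fm r p) = satisfies M (\<lambda>i. v (r i)) p"
proof (induction p arbitrary: v)
  case (FRel q ts)
  then show ?case by (simp add: term_val_ren comp_def)
next
  case (FEx i p)
  have "(\<lambda>j. (v(r i := a)) (r j)) = (\<lambda>j. v (r j))(i := a)" for a
    using assms by (auto simp: fun_eq_iff inj_eq)
  then show ?case using FEx by simp
qed (auto simp: term_val_ren)

lemma free_vars_ren_term: "term_vars (ren_term r t) = r ` term_vars t"
  by (induction t) auto

lemma free_vars_ren:
  assumes "inj r"
  shows "free_vars (ren_fm r p) = r ` free_vars p"
  by (induction p) (use assms in \<open>auto simp: free_vars_ren_term inj_eq\<close>)

lemma term_val_cong: "(\<And>i. i \<in> term_vars t \<Longrightarrow> v i = w i) \<Longrightarrow> term_val M v t = term_val M w t"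
proof (induction t)
  case (FApp f ts)
  have "map (term_val M v) ts = map (term_val M w) ts"
    by (rule map_cong) (use FApp in auto)
  then show ?case by (simp only: term_val.simps)
qed simp

lemma satisfies_cong:
  "(\<And>i. i \<in> free_vars p \<Longrightarrow> v i = w i) \<Longrightarrow> satisfies M v p = satisfies M w p"
proof (induction p arbitrary: v w)
  case (FEq s t)
  then show ?case using term_val_cong [of s v w M] term_val_cong [of t v w M] by auto
next
  case (FRel q ts)
  have "map (term_val M v) ts = map (term_val M w) ts"
    by (rule map_cong) (use FRel in \<open>auto intro!: term_val_cong\<close>)
  then show ?case by (simp only: satisfies.simps)
next
  case (FNot p)
  show ?case using FNot.IH [of v w] FNot.prems by simp
next
  case (FAnd p q)
  show ?case using FAnd.IH(1) [of v w] FAnd.IH(2) [of v w] FAnd.prems by simp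
next
  case (FEx i p)
  have "satisfies M (v(i := a)) p = satisfies M (w(i := a)) p" for a
    by (rule FEx.IH) (use FEx.prems in auto)
  then show ?case by simp
qed

lemma finite_term_vars: "finite (term_vars t)"
  by (induction t) auto

lemma finite_free_vars: "finite (free_vars p)"
  by (induction p) (auto simp: finite_term_vars)

lemma free_vars_bound: obtains k where "free_vars p \<subseteq> {..<k}"
proof -
  obtain k where "\<forall>i\<in>free_vars p. i < k"
    using finite_free_vars [of p] finite_nat_set_iff_bounded by auto
  then show thesis by (intro that [of k]) auto
qed


section \<open>Definable predicates\<close>

text \<open>
  Predicates on infinite assignments replace sets of tuples of a fixed length, so that predicates in
  different numbers of variables can be combined without coercions; the arity survives as this bound
  on the variables that matter.
\<close>

definition depends :: "nat \<Rightarrow> ((nat \<Rightarrow> 'a) \<Rightarrow> 'b) \<Rightarrow> bool" where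
  "depends k P \<longleftrightarrow> (\<forall>v w. (\<forall>i<k. v i = w i) \<longrightarrow> P v = P w)"

lemma dependsD: "depends k P \<Longrightarrow> (\<And>i. i < k \<Longrightarrow> v i = w i) \<Longrightarrow> P v = P w"
  unfolding depends_def by blast

lemma dependsI: "(\<And>v w. (\<And>i. i < k \<Longrightarrow> v i = w i) \<Longrightarrow> P v = P w) \<Longrightarrow> depends k P"
  unfolding depends_def by blast

lemma depends_mono: "depends k P \<Longrightarrow> k \<le> l \<Longrightarrow> depends l P"
  unfolding depends_def by (meson less_le_trans)

definition mix :: "(nat \<Rightarrow> 'a) \<Rightarrow> (nat \<Rightarrow> 'a) \<Rightarrow> nat \<Rightarrow> 'a" where
  "mix v c i = (if even i then v (i div 2) else c (i div 2))"

text \<open>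
  A predicate is definable with parameters. The even variables of the formula are the arguments and
  the odd ones the parameters, so that neither kind is bounded in number and both can be renamed
  independently.
\<close>

definition Def :: "('a, 'f, 'r) fo_structure \<Rightarrow> ((nat \<Rightarrow> 'a) \<Rightarrow> bool) \<Rightarrow> bool" where
  "Def M P \<longleftrightarrow> (\<exists>p c. wf_formula M p \<and> (\<forall>v. P v = satisfies M (mix v c) p))"

lemma DefI:
  assumes "wf_formula M p" "inj r" "\<And>v. P v = satisfies M (\<lambda>i. mix v c (r i)) p"
  shows "Def M P"
  unfolding Def_def using assms(1)
  by (intro exI [of _ "ren_fm r p"] exI [of _ c]) (simp add: satisfies_ren [OF assms(2)] assms(3))

lemma Def_satisfies: "wf_formula M p \<Longrightarrow> Def M (\<lambda>v. satisfies M v p)"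
  by (rule DefI [of M p "\<lambda>i. 2 * i"]) (auto simp: mix_def inj_on_def)

lemma Def_not: "Def M P \<Longrightarrow> Def M (\<lambda>v. \<not> P v)"
proof -
  assume "Def M P"
  then obtain p c where "wf_formula M p" "\<forall>v. P v = satisfies M (mix v c) p"
    unfolding Def_def by blast
  then show ?thesis unfolding Def_def by (intro exI [of _ "FNot p"] exI [of _ c]) simp
qed

lemma Def_and:
  assumes "Def M P" "Def M Q"
  shows "Def M (\<lambda>v. P v \<and> Q v)"
proof -
  from assms obtain p c q d where p: "wf_formula M p" "\<And>v. P v = satisfies M (mix v c) p"
    and q: "wf_formula M q" "\<And>v. Q v = satisfies M (mix v d) q"
    unfolding Def_def by blast
  \<comment> \<open>the parameters of the two formulas are interleaved\<close>
  define r where "r i = (if even i then i else 2 * (2 * (i div 2)) + 1)" for i :: nat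
  define s where "s i = (if even i then i else 2 * (2 * (i div 2) + 1) + 1)" for i :: nat
  have r: "inj r" by (rule injI) (simp add: r_def split: if_splits; presburger)
  have s: "inj s" by (rule injI) (simp add: s_def split: if_splits; presburger)
  have "(\<lambda>i. mix v (mix c d) (r i)) = mix v c" "(\<lambda>i. mix v (mix c d) (s i)) = mix v d" for v
    by (auto simp: mix_def r_def s_def fun_eq_iff elim!: oddE)
  then have "P v \<and> Q v \<longleftrightarrow> satisfies M (mix v (mix c d)) (FAnd (ren_fm r p) (ren_fm s q))" for v
    by (simp add: p(2) q(2) satisfies_ren [OF r] satisfies_ren [OF s])
  then show ?thesis
    unfolding Def_def using p(1) q(1)
    by (intro exI [of _ "FAnd (ren_fm r p) (ren_fm s q)"] exI [of _ "mix c d"]) simp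
qed

lemma Def_ex:
  assumes "Def M P"
  shows "Def M (\<lambda>v. \<exists>x. P (v(i := x)))"
proof -
  from assms obtain p c where p: "wf_formula M p" "\<And>v. P v = satisfies M (mix v c) p"
    unfolding Def_def by blast
  have "mix (v(i := x)) c = (mix v c)(2 * i := x)" for v x
    by (auto simp: mix_def fun_eq_iff)
  then show ?thesis
    unfolding Def_def using p by (intro exI [of _ "FEx (2 * i) p"] exI [of _ c]) simp
qed

lemma Def_or:
  assumes "Def M P" "Def M Q"
  shows "Def M (\<lambda>v. P v \<or> Q v)"
  using Def_not [OF Def_and [OF Def_not [OF assms(1)] Def_not [OF assms(2)]]] by simp

lemma Def_iff:
  assumes "Def M P" "Def M Q"
  shows "Def M (\<lambda>v. P v \<longleftrightarrow> Q v)"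
proof -
  have "(\<lambda>v. P v \<longleftrightarrow> Q v) = (\<lambda>v. (P v \<and> Q v) \<or> (\<not> P v \<and> \<not> Q v))" by auto
  then show ?thesis
    by (simp only:) (intro Def_or Def_and Def_not assms)
qed

lemma Def_all: "Def M P \<Longrightarrow> Def M (\<lambda>v. \<forall>x. P (v(i := x)))"
  using Def_not [OF Def_ex [OF Def_not, of M P i]] by simp

lemma Def_eq: "Def M (\<lambda>v. v i = v j)"
  by (rule DefI [of M "FEq (FVar (2 * i)) (FVar (2 * j))" "\<lambda>i. i"]) (auto simp: mix_def)

lemma Def_eq_const: "Def M (\<lambda>v. v i = b)"
  by (rule DefI [of M "FEq (FVar (2 * i)) (FVar 1)" "\<lambda>i. i" _ "\<lambda>_. b"]) (auto simp: mix_def)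

lemma Def_const: "Def M (\<lambda>_. c)"
proof (cases c)
  case True
  then show ?thesis using Def_eq [of M 0 0] by simp
next
  case False
  then show ?thesis using Def_not [OF Def_eq [of M 0 0]] by simp
qed

lemma Def_ball: "finite I \<Longrightarrow> (\<And>i. i \<in> I \<Longrightarrow> Def M (P i)) \<Longrightarrow> Def M (\<lambda>v. \<forall>i\<in>I. P i v)"
  by (induction I rule: finite_induct) (simp_all add: Def_const Def_and)

lemma Def_rename:
  assumes "Def M P" "inj f"
  shows "Def M (\<lambda>v. P (\<lambda>i. v (f i)))"
proof -
  from assms obtain p c where p: "wf_formula M p" "\<And>v. P v = satisfies M (mix v c) p"
    unfolding Def_def by blast
  define r where "r i = (if even i then 2 * f (i div 2) else i)" for i
  have "inj r"
  proof (rule injI)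
    fix i j assume *: "r i = r j"
    then have "even i = even j" unfolding r_def by presburger
    then show "i = j"
      using * assms(2) unfolding r_def by (auto simp: inj_eq split: if_splits elim!: evenE)
  qed
  moreover have "(\<lambda>i. mix v c (r i)) = mix (\<lambda>i. v (f i)) c" for v
    by (auto simp: mix_def r_def fun_eq_iff)
  ultimately show ?thesis using p by (intro DefI [of M p r _ c]) simp_all
qed

lemma Def_depends:
  assumes "Def M P"
  obtains k where "depends k P"
proof -
  from assms obtain p c where p: "wf_formula M p" "\<And>v. P v = satisfies M (mix v c) p"
    unfolding Def_def by blast
  obtain k where k: "free_vars p \<subseteq> {..<k}" by (rule free_vars_bound)
  have "depends k P"
  proof (rule dependsI)
    fix v w :: "nat \<Rightarrow> 'a" assume *: "\<And>i. i < k \<Longrightarrow> v i = w i"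
    show "P v = P w"
      unfolding p(2)
    proof (rule satisfies_cong)
      fix i assume "i \<in> free_vars p"
      then have "i div 2 < k" using k by auto
      then show "mix v c i = mix w c i" using * by (simp add: mix_def)
    qed
  qed
  then show thesis by (rule that)
qed

text \<open>
  A block of quantifiers over consecutive variables, in the form needed to substitute into all
  arguments of a predicate at once.
\<close>

lemma Def_ex_block:
  assumes "Def M P"
  shows "Def M (\<lambda>v. \<exists>w. (\<forall>i. \<not> (n \<le> i \<and> i < n + k) \<longrightarrow> w i = v i) \<and> P w)"
proof (induction k)
  case 0
  have "(\<lambda>v. \<exists>w. (\<forall>i. \<not> (n \<le> i \<and> i < n + 0) \<longrightarrow> w i = v i) \<and> P w) = P"
    by (auto simp: fun_eq_iff [symmetric])
  then show ?case using assms by simp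
next
  case (Suc k)
  let ?Q = "\<lambda>k v. \<exists>w. (\<forall>i. \<not> (n \<le> i \<and> i < n + k) \<longrightarrow> w i = v i) \<and> P w"
  have "?Q (Suc k) = (\<lambda>v. \<exists>x. ?Q k (v(n + k := x)))"
  proof (intro ext iffI)
    fix v assume "?Q (Suc k) v"
    then obtain w where "\<forall>i. \<not> (n \<le> i \<and> i < n + Suc k) \<longrightarrow> w i = v i" "P w" by blast
    then show "\<exists>x. ?Q k (v(n + k := x))"
      by (intro exI [of _ "w (n + k)"] exI [of _ w]) auto
  next
    fix v assume "\<exists>x. ?Q k (v(n + k := x))"
    then obtain x w where w: "\<forall>i. \<not> (n \<le> i \<and> i < n + k) \<longrightarrow> w i = (v(n + k := x)) i" "P w" by blast
    have "w i = v i" if "\<not> (n \<le> i \<and> i < n + Suc k)" for i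
      using w(1) [rule_format, of i] that by auto
    then show "?Q (Suc k) v" using w(2) by blast
  qed
  then show ?case using Def_ex [OF Suc] by simp
qed

text \<open>
  A function whose graph is definable. The finite dependence makes room for fresh variables in
  substitutions.
\<close>

definition termdef :: "('a, 'f, 'r) fo_structure \<Rightarrow> ((nat \<Rightarrow> 'a) \<Rightarrow> 'a) \<Rightarrow> bool" where
  "termdef M g \<longleftrightarrow> (\<exists>n. depends n g) \<and> (\<forall>j. Def M (\<lambda>v. v j = g v))"

lemma termdef_var: "termdef M (\<lambda>v. v i)"
  unfolding termdef_def by (intro conjI allI Def_eq exI [of _ "Suc i"]) (simp add: depends_def)

lemma termdef_const: "termdef M (\<lambda>_. b)"
  unfolding termdef_def by (intro conjI allI Def_eq_const exI [of _ 0]) (simp add: depends_def)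

text \<open>
  The arguments are first moved to fresh variables beyond everything the functions depend on,
  then identified with the values of the functions, and finally quantified away.
\<close>

lemma Def_subst:
  assumes P: "Def M P" and k: "depends k P" and g: "\<And>i. i < k \<Longrightarrow> termdef M (g i)"
  shows "Def M (\<lambda>v. P (\<lambda>i. g i v))"
proof -
  have "\<forall>i<k. \<exists>n. depends n (g i)" using g by (auto simp: termdef_def)
  then obtain m where m: "\<And>i. i < k \<Longrightarrow> depends (m i) (g i)" by metis
  define n where "n = (\<Sum>i<k. m i)"
  have n: "depends n (g i)" if "i < k" for i
    using depends_mono [OF m [OF that]] member_le_sum [of i "{..<k}" m] that by (simp add: n_def)
  let ?R = "\<lambda>v. P (\<lambda>i. v (n + i)) \<and> (\<forall>i\<in>{..<k}. v (n + i) = g i v)"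
  have "Def M (\<lambda>v. P (\<lambda>i. v (n + i)))"
    by (rule Def_rename [OF P]) (simp add: inj_def)
  moreover have "Def M (\<lambda>v. \<forall>i\<in>{..<k}. v (n + i) = g i v)"
    by (rule Def_ball) (use g in \<open>auto simp: termdef_def\<close>)
  ultimately have "Def M ?R" by (rule Def_and)
  then have "Def M (\<lambda>v. \<exists>w. (\<forall>i. \<not> (n \<le> i \<and> i < n + k) \<longrightarrow> w i = v i) \<and> ?R w)"
    by (rule Def_ex_block)
  moreover have "P (\<lambda>i. g i v) \<longleftrightarrow>
      (\<exists>w. (\<forall>i. \<not> (n \<le> i \<and> i < n + k) \<longrightarrow> w i = v i) \<and> ?R w)" for v
  proof
    assume *: "P (\<lambda>i. g i v)"
    define w where "w j = (if n \<le> j \<and> j < n + k then g (j - n) v else v j)" for j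
    have "g i w = g i v" if "i < k" for i
      by (rule dependsD [OF n [OF that]]) (simp add: w_def)
    moreover have "P (\<lambda>i. w (n + i)) = P (\<lambda>i. g i v)"
      by (rule dependsD [OF k]) (simp add: w_def)
    ultimately show "\<exists>w. (\<forall>i. \<not> (n \<le> i \<and> i < n + k) \<longrightarrow> w i = v i) \<and> ?R w"
      using * by (intro exI [of _ w]) (auto simp: w_def)
  next
    assume "\<exists>w. (\<forall>i. \<not> (n \<le> i \<and> i < n + k) \<longrightarrow> w i = v i) \<and> ?R w"
    then obtain w where w: "\<forall>i. \<not> (n \<le> i \<and> i < n + k) \<longrightarrow> w i = v i" "?R w" by blast
    have "g i w = g i v" if "i < k" for i
      by (rule dependsD [OF n [OF that]]) (use w(1) in auto)
    then have "P (\<lambda>i. w (n + i)) = P (\<lambda>i. g i v)"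
      using w(2) by (intro dependsD [OF k]) auto
    then show "P (\<lambda>i. g i v)" using w(2) by blast
  qed
  ultimately show ?thesis by simp
qed

text \<open>
  The bridge to definable sets of lists. From a predicate back to a formula, the first \<open>k\<close> arguments
  become coordinates and everything else becomes a parameter, with an arbitrary value for the
  arguments that the predicate does not depend on.
\<close>

lemma definable_iff:
  "definable M k X \<longleftrightarrow>
    (\<exists>P. Def M P \<and> depends k P \<and> X = {xs. length xs = k \<and> P (\<lambda>i. xs ! i)})"
proof
  assume "definable M k X"
  then obtain p cs where p: "wf_formula M p" "free_vars p \<subseteq> {..<k + length cs}"
    and X: "X = {xs. length xs = k \<and> satisfies M (\<lambda>i. (xs @ cs) ! i) p}"
    unfolding definable_over_def by blast
  define P where "P v = satisfies M (\<lambda>i. if i < k then v i else cs ! (i - k)) p" for v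
  have "Def M P"
  proof (rule DefI [OF p(1)])
    show "inj (\<lambda>i. if i < k then 2 * i else 2 * i + 1)"
      by (rule injI) (simp split: if_splits; presburger)
    show "P v = satisfies M (\<lambda>i. mix v (\<lambda>i. cs ! (i - k)) (if i < k then 2 * i else 2 * i + 1)) p" for v
      unfolding P_def by (rule satisfies_cong) (auto simp: mix_def)
  qed
  moreover have "depends k P"
    unfolding P_def by (rule dependsI, rule satisfies_cong) auto
  moreover have "X = {xs. length xs = k \<and> P (\<lambda>i. xs ! i)}"
  proof -
    have "(\<lambda>i. (xs @ cs) ! i) = (\<lambda>i. if i < k then xs ! i else cs ! (i - k))" if "length xs = k" for xs :: "'a list"
      using that by (simp add: nth_append fun_eq_iff)
    then show ?thesis unfolding X P_def by (auto simp only:)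
  qed
  ultimately show "\<exists>P. Def M P \<and> depends k P \<and> X = {xs. length xs = k \<and> P (\<lambda>i. xs ! i)}" by blast
next
  assume "\<exists>P. Def M P \<and> depends k P \<and> X = {xs. length xs = k \<and> P (\<lambda>i. xs ! i)}"
  then obtain P where P: "Def M P" "depends k P" and X: "X = {xs. length xs = k \<and> P (\<lambda>i. xs ! i)}"
    by blast
  then obtain p c where p: "wf_formula M p" "\<And>v. P v = satisfies M (mix v c) p"
    unfolding Def_def by blast
  obtain B where B: "free_vars p \<subseteq> {..<B}" by (rule free_vars_bound)
  define r where "r i = (if even i \<and> i div 2 < k then i div 2 else k + i)" for i
  define cs where "cs = map (\<lambda>i. if even i then undefined else c (i div 2)) [0..<B]"
  have r: "inj r"
    by (rule injI) (auto simp: r_def split: if_splits elim!: evenE)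
  have "free_vars (ren_fm r p) \<subseteq> {..<k + length cs}"
    using B by (auto simp: free_vars_ren [OF r] r_def cs_def)
  moreover have "satisfies M (\<lambda>i. (xs @ cs) ! i) (ren_fm r p) = P (\<lambda>i. xs ! i)" if "length xs = k" for xs
  proof -
    define w where "w i = (if i < k then xs ! i else undefined)" for i
    have "satisfies M (\<lambda>i. (xs @ cs) ! i) (ren_fm r p) = satisfies M (mix w c) p"
      unfolding satisfies_ren [OF r]
      by (rule satisfies_cong)
        (use B that in \<open>auto simp: r_def mix_def w_def cs_def nth_append\<close>)
    also have "\<dots> = P (\<lambda>i. xs ! i)"
      unfolding p(2) [symmetric] by (rule dependsD [OF P(2)]) (simp add: w_def)
    finally show ?thesis .
  qed
  ultimately show "definable M k X"
    unfolding definable_over_def X using p(1)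
    by (intro exI [of _ "ren_fm r p"] exI [of _ cs]) auto
qed

text \<open>
  Reducts are defined through parameter-free sets; adding parameters amounts to substituting
  constants, so all definable predicates are inherited.
\<close>

lemma reduct_satisfies:
  assumes "reduct M N" "wf_formula M p"
  shows "Def N (\<lambda>v. satisfies M v p)"
proof -
  obtain n where n: "free_vars p \<subseteq> {..<n}" by (rule free_vars_bound)
  define X where "X = {xs. length xs = n \<and> satisfies M (\<lambda>i. (xs @ []) ! i) p}"
  have "definable_over M {} n X"
    unfolding definable_over_def X_def using assms(2) n by (intro exI [of _ p] exI [of _ "[]"]) simp
  then have "definable N n X" using assms(1) unfolding reduct_over_def by blast
  then obtain P where P: "Def N P" "depends n P" and X: "X = {xs. length xs = n \<and> P (\<lambda>i. xs ! i)}"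
    unfolding definable_iff by blast
  have "satisfies M v p = P v" for v
  proof -
    have "P v = P (\<lambda>i. map v [0..<n] ! i)" by (rule dependsD [OF P(2)]) simp
    also have "\<dots> \<longleftrightarrow> map v [0..<n] \<in> X" by (simp add: X)
    also have "\<dots> \<longleftrightarrow> satisfies M (\<lambda>i. map v [0..<n] ! i) p" by (simp add: X_def)
    also have "\<dots> = satisfies M v p" by (rule satisfies_cong) (use n in auto)
    finally show ?thesis by simp
  qed
  then show ?thesis using P(1) by simp
qed

lemma reductI:
  assumes "\<And>p. wf_formula M p \<Longrightarrow> Def N (\<lambda>v. satisfies M v p)"
  shows "reduct M N"
  unfolding reduct_over_def
proof (intro allI impI)
  fix k X assume "definable_over M {} k X"
  then obtain p where p: "wf_formula M p" "free_vars p \<subseteq> {..<k}"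
    and X: "X = {xs. length xs = k \<and> satisfies M (\<lambda>i. xs ! i) p}"
    unfolding definable_over_def by auto
  have "depends k (\<lambda>v. satisfies M v p)"
    by (rule dependsI, rule satisfies_cong) (use p(2) in auto)
  then show "definable N k X"
    unfolding definable_iff X using assms [OF p(1)] by blast
qed

lemma reduct_Def:
  assumes "reduct M N" "Def M P"
  shows "Def N P"
proof -
  from assms(2) obtain p c where p: "wf_formula M p" "\<And>v. P v = satisfies M (mix v c) p"
    unfolding Def_def by blast
  let ?Q = "\<lambda>v. satisfies M v p"
  have Q: "Def N ?Q" by (rule reduct_satisfies [OF assms(1) p(1)])
  then obtain k where k: "depends k ?Q" by (rule Def_depends)
  have "Def N (\<lambda>v. ?Q (\<lambda>i. mix v c i))"
  proof (rule Def_subst [OF Q k])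
    fix i
    show "termdef N (\<lambda>v. mix v c i)"
      by (cases "even i") (simp_all add: mix_def termdef_var termdef_const)
  qed
  moreover have "P = (\<lambda>v. ?Q (\<lambda>i. mix v c i))" using p(2) by (simp add: fun_eq_iff)
  ultimately show ?thesis by simp
qed


section \<open>Integer multiples in an ordered abelian group\<close>

interpretation zm: module "zmul :: int \<Rightarrow> 'a::ab_group_add \<Rightarrow> 'a"
  by (rule module_zmul)

lemma zmul_pos:
  fixes x :: "'a::linordered_ab_group_add"
  assumes "0 < x" "0 < n"
  shows "0 < zmul n x"
  using assms(2)
proof (induction n rule: int_gr_induct)
  case (step i)
  then show ?case
    using assms(1) by (simp add: zmul_Suc add_pos_pos)
qed (use assms in simp)

lemma zmul_less_iff:
  fixes x y :: "'a::linordered_ab_group_add"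
  assumes "0 < n"
  shows "zmul n x < zmul n y \<longleftrightarrow> x < y"
proof -
  have mono: "zmul n a < zmul n b" if "a < b" for a b :: 'a
  proof -
    have "0 < zmul n (b - a)" using that assms by (intro zmul_pos) auto
    then show ?thesis by (simp add: zm.scale_right_diff_distrib)
  qed
  show ?thesis
    using mono [of x y] mono [of y x] by (cases x y rule: linorder_cases) auto
qed

lemma zmul_eq_iff:
  fixes x y :: "'a::linordered_ab_group_add"
  assumes "0 < n"
  shows "zmul n x = zmul n y \<longleftrightarrow> x = y"
  using zmul_less_iff [OF assms, of x y] zmul_less_iff [OF assms, of y x]
  by (cases x y rule: linorder_cases) auto

lemma zmul_le_iff:
  fixes x y :: "'a::linordered_ab_group_add"
  assumes "0 < n"
  shows "zmul n x \<le> zmul n y \<longleftrightarrow> x \<le> y"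
  using zmul_less_iff [OF assms, of y x] by (auto simp: not_less [symmetric])

lemma zmul_eq_0_iff:
  fixes x :: "'a::linordered_ab_group_add"
  shows "zmul n x = 0 \<longleftrightarrow> n = 0 \<or> x = 0"
proof (cases n "0::int" rule: linorder_cases)
  case less
  then show ?thesis
    using zmul_eq_iff [of "- n" x 0] by (auto simp: zm.scale_minus_left)
next
  case greater
  then show ?thesis using zmul_eq_iff [of n x 0] by auto
qed simp

lemma zmul_less_left:
  fixes g :: "'a::linordered_ab_group_add"
  assumes "0 < g"
  shows "zmul m g < zmul n g \<longleftrightarrow> m < n"
proof -
  have mono: "zmul a g < zmul b g" if "a < b" for a b
  proof -
    have "0 < zmul (b - a) g" using that assms by (intro zmul_pos) auto
    then show ?thesis by (simp add: zm.scale_left_diff_distrib)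
  qed
  show ?thesis
    using mono [of m n] mono [of n m] by (cases m n rule: linorder_cases) auto
qed

lemma zmul_le_left:
  fixes g :: "'a::linordered_ab_group_add"
  assumes "0 < g"
  shows "zmul m g \<le> zmul n g \<longleftrightarrow> m \<le> n"
  using zmul_less_left [OF assms, of n m] by (auto simp: not_less [symmetric])

lemma zmul_eq_left:
  fixes g :: "'a::linordered_ab_group_add"
  assumes "0 < g"
  shows "zmul m g = zmul n g \<longleftrightarrow> m = n"
  using zmul_le_left [OF assms, of n m] zmul_le_left [OF assms, of m n] by (auto intro: antisym)


section \<open>Affine functions\<close>

definition affine_fun :: "nat \<Rightarrow> (nat \<Rightarrow> int) \<Rightarrow> 'a::ab_group_add \<Rightarrow> (nat \<Rightarrow> 'a) \<Rightarrow> 'a" where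
  "affine_fun k a b v = b + (\<Sum>i<k. zmul (a i) (v i))"

text \<open>
  Affine functions of the first \<open>k\<close> variables, with integer coefficients and a constant from the group.
\<close>

definition aff :: "nat \<Rightarrow> ((nat \<Rightarrow> 'a::ab_group_add) \<Rightarrow> 'a) \<Rightarrow> bool" where
  "aff k h \<longleftrightarrow> (\<exists>a b. h = affine_fun k a b)"

lemma aff_affine_fun [simp]: "aff k (affine_fun k a b)"
  by (auto simp: aff_def)

lemma aff_const [simp]: "aff k (\<lambda>_. b)"
  unfolding aff_def by (rule exI [of _ "\<lambda>_. 0"], rule exI [of _ b]) (simp add: affine_fun_def fun_eq_iff)

lemma aff_var: "i < k \<Longrightarrow> aff k (\<lambda>v. v i)"
  unfolding aff_def
  by (rule exI [of _ "\<lambda>j. if j = i then 1 else 0"], rule exI [of _ 0])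
     (simp add: affine_fun_def fun_eq_iff if_distrib [where f = "\<lambda>n. zmul n _"] sum.delta cong: if_cong)

lemma aff_add: "aff k g \<Longrightarrow> aff k h \<Longrightarrow> aff k (\<lambda>v. g v + h v)"
proof -
  assume "aff k g" "aff k h"
  then obtain a b a' b' where "g = affine_fun k a b" "h = affine_fun k a' b'"
    by (auto simp: aff_def)
  then have "(\<lambda>v. g v + h v) = affine_fun k (\<lambda>i. a i + a' i) (b + b')"
    by (simp add: affine_fun_def fun_eq_iff zmul_add_left sum.distrib algebra_simps)
  then show ?thesis by simp
qed

lemma aff_zmul: "aff k h \<Longrightarrow> aff k (\<lambda>v. zmul n (h v))"
proof -
  assume "aff k h"
  then obtain a b where "h = affine_fun k a b" by (auto simp: aff_def)
  then have "(\<lambda>v. zmul n (h v)) = affine_fun k (\<lambda>i. n * a i) (zmul n b)"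
    by (simp add: affine_fun_def fun_eq_iff zm.scale_right_distrib zm.scale_sum_right zmul_zmul)
  then show ?thesis by simp
qed

lemma aff_uminus: "aff k h \<Longrightarrow> aff k (\<lambda>v. - h v)"
  using aff_zmul [of k h "-1"] by simp

lemma aff_diff: "aff k g \<Longrightarrow> aff k h \<Longrightarrow> aff k (\<lambda>v. g v - h v)"
  using aff_add [OF _ aff_uminus, of k g h] by simp

lemma aff_sum: "(\<And>i. i \<in> I \<Longrightarrow> aff k (g i)) \<Longrightarrow> aff k (\<lambda>v. \<Sum>i\<in>I. g i v)"
  by (induction I rule: infinite_finite_induct) (simp_all add: aff_add)

lemma aff_mono:
  assumes "aff k h" "k \<le> l"
  shows "aff l h"
proof -
  from assms(1) obtain a b where h: "h = affine_fun k a b" by (auto simp: aff_def)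
  have "aff l (\<lambda>v. b + (\<Sum>i<k. zmul (a i) (v i)))"
    using assms(2) by (intro aff_add aff_sum aff_zmul aff_var) auto
  then show ?thesis by (simp add: h affine_fun_def [abs_def])
qed

lemma aff_subst:
  assumes "aff k h" "\<And>i. i < k \<Longrightarrow> aff l (g i)"
  shows "aff l (\<lambda>v. h (\<lambda>i. g i v))"
proof -
  from assms(1) obtain a b where h: "h = affine_fun k a b" by (auto simp: aff_def)
  show ?thesis
    unfolding h affine_fun_def using assms(2) by (intro aff_add aff_sum aff_zmul) auto
qed

lemma aff_depends: "aff k h \<Longrightarrow> depends k h"
  by (auto simp: depends_def aff_def affine_fun_def intro!: sum.cong)

lemma aff_split:
  assumes "aff k h"
  obtains n where "\<And>v x. h (v(i := x)) = zmul n x + h (v(i := 0))"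
proof -
  from assms obtain a b where h: "h = affine_fun k a b" by (auto simp: aff_def)
  have *: "(\<Sum>j<k. zmul (a j) ((v(i := x)) j)) =
      (if i < k then zmul (a i) x else 0) + (\<Sum>j\<in>{..<k} - {i}. zmul (a j) (v j))" for v x
  proof (cases "i < k")
    case True
    then have "(\<Sum>j<k. zmul (a j) ((v(i := x)) j)) =
        zmul (a i) x + (\<Sum>j\<in>{..<k} - {i}. zmul (a j) ((v(i := x)) j))"
      by (subst sum.remove [of _ i]) auto
    also have "(\<Sum>j\<in>{..<k} - {i}. zmul (a j) ((v(i := x)) j)) = (\<Sum>j\<in>{..<k} - {i}. zmul (a j) (v j))"
      by (rule sum.cong) auto
    finally show ?thesis using True by simp
  next
    case False
    then show ?thesis by (auto intro!: sum.cong)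
  qed
  show thesis
    by (rule that [of "if i < k then a i else 0"]) (simp add: h affine_fun_def * algebra_simps del: fun_upd_apply)
qed

lemma aff_fun_upd_0: "aff k h \<Longrightarrow> aff k (\<lambda>v. h (v(i := 0)))"
proof -
  assume *: "aff k h"
  have "(\<lambda>v. h (v(i := 0))) = (\<lambda>v. h (\<lambda>j. (if j = i then 0 else v j)))"
    by (auto simp: fun_eq_iff fun_upd_def cong: if_cong)
  moreover have "aff k (\<lambda>v. h (\<lambda>j. (if j = i then 0 else v j)))"
    by (rule aff_subst [OF *, of k "\<lambda>j v. if j = i then 0 else v j"], rename_tac j, case_tac "j = i") (simp_all add: aff_var)
  ultimately show ?thesis by simp
qed


section \<open>Boolean combinations\<close>

text \<open>
  A predicate that is determined by finitely many others is exactly a Boolean combination of them.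
  This semantic form avoids normal forms and makes closure properties immediate.
\<close>

definition determined :: "('v \<Rightarrow> bool) set \<Rightarrow> ('v \<Rightarrow> bool) \<Rightarrow> bool" where
  "determined F P \<longleftrightarrow> (\<forall>v w. (\<forall>A\<in>F. A v = A w) \<longrightarrow> P v = P w)"

lemma determinedD:
  assumes "determined F P" "\<And>A. A \<in> F \<Longrightarrow> A v = A w"
  shows "P v = P w"
  by (rule mp [OF spec [OF spec [OF assms(1) [unfolded determined_def]]]]) (rule ballI, rule assms(2))

lemma determinedI:
  assumes "\<And>v w. (\<And>A. A \<in> F \<Longrightarrow> A v = A w) \<Longrightarrow> P v = P w"
  shows "determined F P"
  unfolding determined_def by (intro allI impI, rule assms, erule bspec)

definition comb :: "('v \<Rightarrow> bool) set \<Rightarrow> ('v \<Rightarrow> bool) \<Rightarrow> bool" where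
  "comb \<A> P \<longleftrightarrow> (\<exists>F. finite F \<and> F \<subseteq> \<A> \<and> determined F P)"

lemma comb_atom: "A \<in> \<A> \<Longrightarrow> comb \<A> A"
  unfolding comb_def by (rule exI [of _ "{A}"]) (auto simp: determined_def)

lemma comb_const: "comb \<A> (\<lambda>_. c)"
  unfolding comb_def by (rule exI [of _ "{}"]) (auto simp: determined_def)

lemma comb_not: "comb \<A> P \<Longrightarrow> comb \<A> (\<lambda>v. \<not> P v)"
  unfolding comb_def determined_def by simp

lemma comb_and:
  assumes "comb \<A> P" "comb \<A> Q"
  shows "comb \<A> (\<lambda>v. P v \<and> Q v)"
proof -
  from assms obtain F G where F: "finite F" "F \<subseteq> \<A>" "determined F P"
    and G: "finite G" "G \<subseteq> \<A>" "determined G Q"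
    unfolding comb_def by blast
  have "determined (F \<union> G) (\<lambda>v. P v \<and> Q v)"
  proof (rule determinedI)
    fix v w assume "\<And>A. A \<in> F \<union> G \<Longrightarrow> A v = A w"
    then show "(P v \<and> Q v) = (P w \<and> Q w)"
      using determinedD [OF F(3), of v w] determinedD [OF G(3), of v w] by simp
  qed
  then show ?thesis
    using F G unfolding comb_def by (intro exI [of _ "F \<union> G"]) simp
qed

lemma comb_or:
  assumes "comb \<A> P" "comb \<A> Q"
  shows "comb \<A> (\<lambda>v. P v \<or> Q v)"
  using comb_not [OF comb_and [OF comb_not [OF assms(1)] comb_not [OF assms(2)]]] by simp

lemma comb_imp:
  assumes "comb \<A> P" "comb \<A> Q"
  shows "comb \<A> (\<lambda>v. P v \<longrightarrow> Q v)"
  unfolding imp_conv_disj by (rule comb_or [OF comb_not [OF assms(1)] assms(2)])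

lemma comb_iff:
  assumes "comb \<A> P" "comb \<A> Q"
  shows "comb \<A> (\<lambda>v. P v \<longleftrightarrow> Q v)"
  unfolding iff_conv_conj_imp by (rule comb_and [OF comb_imp [OF assms] comb_imp [OF assms(2,1)]])

lemma comb_ball: "finite I \<Longrightarrow> (\<And>i. i \<in> I \<Longrightarrow> comb \<A> (P i)) \<Longrightarrow> comb \<A> (\<lambda>v. \<forall>i\<in>I. P i v)"
  by (induction I rule: finite_induct) (simp_all add: comb_const comb_and)

lemma comb_bex: "finite I \<Longrightarrow> (\<And>i. i \<in> I \<Longrightarrow> comb \<A> (P i)) \<Longrightarrow> comb \<A> (\<lambda>v. \<exists>i\<in>I. P i v)"
  by (induction I rule: finite_induct) (simp_all add: comb_const comb_or)

lemma comb_subst: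
  assumes "comb \<A> P" "\<And>A. A \<in> \<A> \<Longrightarrow> comb \<B> (\<lambda>v. A (f v))"
  shows "comb \<B> (\<lambda>v. P (f v))"
proof -
  from assms(1) obtain F where F: "finite F" "F \<subseteq> \<A>" "determined F P"
    unfolding comb_def by blast
  have "\<forall>A\<in>F. \<exists>G. finite G \<and> G \<subseteq> \<B> \<and> determined G (\<lambda>v. A (f v))"
    using assms(2) F(2) unfolding comb_def by blast
  then obtain G where G: "\<forall>A\<in>F. finite (G A) \<and> G A \<subseteq> \<B> \<and> determined (G A) (\<lambda>v. A (f v))"
    by metis
  have "determined (\<Union>(G ` F)) (\<lambda>v. P (f v))"
  proof (rule determinedI)
    fix v w assume *: "\<And>B. B \<in> \<Union>(G ` F) \<Longrightarrow> B v = B w"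
    show "P (f v) = P (f w)"
    proof (rule determinedD [OF F(3)])
      fix A assume "A \<in> F"
      then show "A (f v) = A (f w)"
        using G * by (intro determinedD [of "G A" "\<lambda>v. A (f v)"]) auto
    qed
  qed
  then show ?thesis
    using F G unfolding comb_def by (intro exI [of _ "\<Union>(G ` F)"]) auto
qed

lemma comb_trans: "comb \<A> P \<Longrightarrow> (\<And>A. A \<in> \<A> \<Longrightarrow> comb \<B> A) \<Longrightarrow> comb \<B> P"
  using comb_subst [of \<A> P \<B> "\<lambda>v. v"] by simp

lemma comb_mono: "comb \<A> P \<Longrightarrow> \<A> \<subseteq> \<B> \<Longrightarrow> comb \<B> P"
  by (rule comb_trans) (auto intro: comb_atom)

text \<open>
  The syntactic reading of Boolean combinations: the finitely many truth patterns for which the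
  predicate holds give a disjunctive normal form.
\<close>

lemma comb_induct [consumes 1, case_names atom const neg conj]:
  assumes "comb \<A> P"
    and atom: "\<And>A. A \<in> \<A> \<Longrightarrow> D A"
    and const: "\<And>c. D (\<lambda>_. c)"
    and neg: "\<And>P. D P \<Longrightarrow> D (\<lambda>v. \<not> P v)"
    and conj: "\<And>P Q. D P \<Longrightarrow> D Q \<Longrightarrow> D (\<lambda>v. P v \<and> Q v)"
  shows "D P"
proof -
  have disj: "D (\<lambda>v. Q v \<or> R v)" if "D Q" "D R" for Q R
    using neg [OF conj [OF neg [OF that(1)] neg [OF that(2)]]] by simp
  have ball: "D (\<lambda>v. \<forall>i\<in>I. Q i v)" if "finite I" "\<And>i. i \<in> I \<Longrightarrow> D (Q i)" for I :: "('v \<Rightarrow> bool) set" and Q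
    using that by (induction I rule: finite_induct) (simp_all add: const conj)
  have bex: "D (\<lambda>v. \<exists>i\<in>I. Q i v)" if "finite I" "\<And>i. i \<in> I \<Longrightarrow> D (Q i)" for I :: "('v \<Rightarrow> bool) set set" and Q
    using that by (induction I rule: finite_induct) (simp_all add: const disj)
  from assms(1) obtain F where F: "finite F" "F \<subseteq> \<A>" "determined F P"
    unfolding comb_def by blast
  define I where "I = {{A \<in> F. A w} | w. P w}"
  have "I \<subseteq> Pow F" unfolding I_def by auto
  then have "finite I" using F(1) by (meson finite_Pow_iff finite_subset)
  have "D (\<lambda>v. A v = c)" if "A \<in> F" for A c
    using neg [of A] atom [of A] that F(2) by (cases c) auto
  then have "D (\<lambda>v. \<exists>T\<in>I. \<forall>A\<in>F. A v = (A \<in> T))"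
    using \<open>finite I\<close> F(1) by (intro bex ball) auto
  moreover have "P = (\<lambda>v. \<exists>T\<in>I. \<forall>A\<in>F. A v = (A \<in> T))"
  proof (intro ext iffI)
    fix v
    assume "P v"
    then show "\<exists>T\<in>I. \<forall>A\<in>F. A v = (A \<in> T)"
      unfolding I_def by (intro bexI [of _ "{A \<in> F. A v}"]) auto
  next
    fix v
    assume "\<exists>T\<in>I. \<forall>A\<in>F. A v = (A \<in> T)"
    then obtain T where T: "T \<in> I" "\<forall>A\<in>F. A v = (A \<in> T)" by blast
    then obtain w where w: "P w" "T = {A \<in> F. A w}" unfolding I_def by blast
    have "P v = P w"
    proof (rule determinedD [OF F(3)])
      fix A assume "A \<in> F"
      then show "A v = A w" using T(2) w(2) by blast
    qed
    then show "P v" using w(1) by simp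
  qed
  ultimately show ?thesis by (rule ssubst [rotated])
qed


section \<open>Regular groups\<close>

text \<open>
  The two first-order properties inherited from archimedean groups of finite rank.
\<close>

locale regular_group =
  fixes ty :: "'a::linordered_ab_group_add itself"
  assumes regular: "\<And>m (a::'a) g. 1 \<le> m \<Longrightarrow> 0 < g \<Longrightarrow> \<exists>y. a \<le> zmul m y \<and> zmul m y < a + zmul m g"
    and finite_index: "\<And>n. 1 \<le> n \<Longrightarrow> \<exists>C::'a set. finite C \<and> (\<forall>x. \<exists>c\<in>C. \<exists>y. x = c + zmul n y)"
    and nontrivial: "\<exists>g::'a. 0 < g"
begin

lemma multiple_below: "1 \<le> m \<Longrightarrow> \<exists>y::'a. zmul m y < t"
proof -
  assume m: "1 \<le> m"
  obtain g :: 'a where "0 < g" using nontrivial by blast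
  then show ?thesis using regular [OF m, of g "t - zmul m g"] by auto
qed

lemma multiple_above: "1 \<le> m \<Longrightarrow> \<exists>y::'a. t < zmul m y"
proof -
  assume "1 \<le> m"
  then obtain y :: 'a where "zmul m y < - t" using multiple_below by blast
  then have "t < zmul m (- y)" by (simp add: zmul_minus_right less_minus_iff)
  then show ?thesis by blast
qed

lemma multiple_below_finite:
  assumes "1 \<le> m" "finite T"
  shows "\<exists>y::'a. \<forall>t\<in>T. zmul m y < t"
proof (cases "T = {}")
  case False
  obtain y :: 'a where "zmul m y < Min T" using multiple_below assms by blast
  then show ?thesis using assms(2) False by (intro exI [of _ y]) auto
qed simp

lemma multiple_above_finite:
  assumes "1 \<le> m" "finite T"
  shows "\<exists>y::'a. \<forall>t\<in>T. t < zmul m y"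
proof (cases "T = {}")
  case False
  obtain y :: 'a where "Max T < zmul m y" using multiple_above assms by blast
  then show ?thesis using assms(2) False by (intro exI [of _ y]) auto
qed simp

lemma infinite_UNIV: "infinite (UNIV :: 'a set)"
proof
  assume "finite (UNIV :: 'a set)"
  then obtain y :: 'a where "\<forall>t\<in>UNIV. t < zmul 1 y" using multiple_above_finite [of 1 UNIV] by auto
  then show False by auto
qed

definition dense :: bool where
  "dense \<longleftrightarrow> (\<forall>g::'a. 0 < g \<longrightarrow> (\<exists>h. 0 < h \<and> h < g))"

text \<open>
  In a dense group a positive element can be halved up to rounding down, hence divided by any \<open>2 ^ n\<close>.
\<close>

lemma dense_small:
  assumes "dense" "0 < (g::'a)"
  shows "\<exists>h. 0 < h \<and> zmul (int n) h < g"
proof -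
  have half: "\<exists>h. 0 < h \<and> h + h \<le> g" if g: "0 < g" for g :: 'a
  proof -
    from g assms(1) obtain h where h: "0 < h" "h < g" unfolding dense_def by blast
    have "min h (g - h) + min h (g - h) \<le> h + (g - h)" by (intro add_mono) simp_all
    then show ?thesis using h by (intro exI [of _ "min h (g - h)"]) auto
  qed
  have "\<exists>h. 0 < h \<and> zmul (2 ^ n) h \<le> g" for n
  proof (induction n)
    case (Suc n)
    then obtain h where h: "0 < h" "zmul (2 ^ n) h \<le> g" by blast
    obtain h' where h': "0 < h'" "h' + h' \<le> h" using half [OF h(1)] by blast
    have "(2::int) ^ Suc n = 2 ^ n + 2 ^ n" by simp
    then have "zmul (2 ^ Suc n) h' = zmul (2 ^ n) (h' + h')"
      by (simp only: zmul_add_left zmul_add_right)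
    also have "\<dots> \<le> zmul (2 ^ n) h" using h'(2) by (simp add: zmul_le_iff)
    finally show ?case using h h' by (meson order_trans)
  qed (use assms in auto)
  then obtain h where h: "0 < h" "zmul (2 ^ n) h \<le> g" by blast
  have "zmul (int n) h < zmul (2 ^ n) h"
    using zmul_less_left [OF h(1)] of_nat_less_two_power [of n, where 'a = int] by blast
  then show ?thesis using h by (intro exI [of _ h]) auto
qed

text \<open>
  The least positive element of a discrete group.
\<close>

definition one :: 'a where
  "one = (SOME g. 0 < g \<and> (\<forall>h. 0 < h \<longrightarrow> g \<le> h))"

lemma discrete_one:
  assumes "\<not> dense"
  shows "0 < one" "0 < h \<Longrightarrow> one \<le> h"
proof -
  from assms obtain g :: 'a where "0 < g" "\<forall>h. 0 < h \<longrightarrow> g \<le> h"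
    unfolding dense_def not_all not_imp not_ex de_Morgan_conj not_less
    by (metis not_less)
  then have "0 < one \<and> (\<forall>h. 0 < h \<longrightarrow> one \<le> h)"
    unfolding one_def by (intro someI [of "\<lambda>g. 0 < g \<and> (\<forall>h. 0 < h \<longrightarrow> g \<le> h)"]) blast
  then show "0 < one" "0 < h \<Longrightarrow> one \<le> h" by blast+
qed

lemma discrete_step: "\<not> dense \<Longrightarrow> x < y \<Longrightarrow> x + one \<le> y"
  using discrete_one(2) [of "y - x"] by (simp add: algebra_simps)

lemma discrete_multiple:
  assumes "\<not> dense" "0 \<le> x" "x \<le> zmul (int n) one"
  shows "\<exists>j\<le>n. x = zmul (int j) one"
  using assms(3)
proof (induction n)
  case (Suc n)
  show ?case
  proof (cases "x \<le> zmul (int n) one")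
    case False
    then have "zmul (int n) one + one \<le> x" using discrete_step [OF assms(1)] by simp
    moreover have "zmul (int n) one + one = zmul (int (Suc n)) one"
      using zmul_Suc [of "int n" one] by (simp add: add.commute)
    ultimately show ?thesis using Suc.prems by (intro exI [of _ "Suc n"]) auto
  qed (use Suc.IH le_SucI in blast)
qed (use assms(2) in auto)

lemma discrete_multiple_bounds:
  assumes "\<not> dense" "one \<le> x" "x \<le> zmul n one"
  shows "\<exists>j\<in>{1..n}. x = zmul j one"
proof -
  have "0 < one" by (rule discrete_one [OF assms(1)])
  have "zmul 1 one \<le> zmul n one" using assms by simp
  then have n: "1 \<le> n" by (simp only: zmul_le_left [OF \<open>0 < one\<close>])
  have "0 \<le> x" using assms(2) \<open>0 < one\<close> by simp
  with assms n obtain j where j: "x = zmul (int j) one" "j \<le> nat n"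
    using discrete_multiple [of x "nat n"] by auto
  have "zmul 1 one \<le> zmul (int j) one" using assms j by simp
  then have "1 \<le> int j" by (simp only: zmul_le_left [OF \<open>0 < one\<close>])
  then show ?thesis using j n by (intro bexI [of _ "int j"]) auto
qed

lemma dense_multiple_between:
  assumes "dense" "1 \<le> m" "s < (t::'a)"
  shows "\<exists>x. s < zmul m x \<and> zmul m x < t"
proof -
  obtain h where h: "0 < h" "zmul m h < t - s"
    using dense_small [OF assms(1), of "t - s" "nat m"] assms by auto
  then obtain y where "t - zmul m h \<le> zmul m y" "zmul m y < t"
    using regular [OF assms(2) h(1), of "t - zmul m h"] by auto
  moreover have "s < t - zmul m h" using h(2) by (simp add: algebra_simps)
  ultimately show ?thesis by (intro exI [of _ y]) auto
qed

text \<open>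
  In a discrete group the multiples of \<open>m\<close> have gaps \<open>m\<close>, so if one lies in the interval then
  one lies among the first \<open>m\<close> elements after \<open>s\<close>. This expresses solvability by congruences.
\<close>

lemma discrete_multiple_between:
  assumes "\<not> dense" "1 \<le> m"
  shows "(\<exists>x. s < zmul m x \<and> zmul m x < (t::'a)) \<longleftrightarrow>
    (\<exists>r\<in>{1..m}. (\<exists>x. s + zmul r one = zmul m x) \<and> s + zmul r one < t)"
proof
  assume "\<exists>x. s < zmul m x \<and> zmul m x < t"
  then obtain x where x: "s < zmul m x" "zmul m x < t" by blast
  have one: "0 < one" by (rule discrete_one [OF assms(1)])
  obtain y where y: "s + one \<le> zmul m y" "zmul m y < s + one + zmul m one"
    using regular [OF assms(2) one, of "s + one"] by blast
  have "y \<le> x"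
  proof (rule ccontr)
    assume "\<not> y \<le> x"
    then have "x + one \<le> y" using discrete_step [OF assms(1)] by simp
    then have "zmul m (x + one) \<le> zmul m y" using assms(2) by (simp add: zmul_le_iff)
    moreover have "s + one \<le> zmul m x" using discrete_step [OF assms(1) x(1)] .
    ultimately have "s + one + zmul m one \<le> zmul m y"
      by (simp add: zmul_add_right) (meson add_right_mono order_trans)
    then show False using y by simp
  qed
  then have "zmul m y < t" using x(2) assms(2) by (meson zmul_le_iff le_less_trans zero_less_one less_le_trans)
  have "zmul m y - s \<le> zmul m one"
    using y(2) discrete_step [OF assms(1) y(2)] by (simp add: algebra_simps)
  moreover have "one \<le> zmul m y - s" using y(1) by (simp add: algebra_simps)
  ultimately obtain r where r: "r \<in> {1..m}" "zmul m y - s = zmul r one"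
    using discrete_multiple_bounds [OF assms(1)] by blast
  then have "s + zmul r one = zmul m y" by (simp add: algebra_simps)
  then show "\<exists>r\<in>{1..m}. (\<exists>x. s + zmul r one = zmul m x) \<and> s + zmul r one < t"
    using r(1) \<open>zmul m y < t\<close> by (intro bexI [of _ r]) auto
next
  assume "\<exists>r\<in>{1..m}. (\<exists>x. s + zmul r one = zmul m x) \<and> s + zmul r one < t"
  then obtain r x where r: "r \<in> {1..m}" "s + zmul r one = zmul m x" "s + zmul r one < t" by blast
  have "0 < zmul r one" using r(1) discrete_one(1) [OF assms(1)] by (intro zmul_pos) auto
  then have "s < zmul m x" using r(2) by (metis less_add_same_cancel1)
  then show "\<exists>x. s < zmul m x \<and> zmul m x < t" using r by auto
qed

end


section \<open>Quantifier elimination\<close>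

text \<open>
  Quantifier elimination for the ordered group and for the pure group differ only in what is
  observed of an affine function: its sign, or whether it vanishes. Both observations are coded as
  integer-valued functions, so that one proof serves both.
\<close>

definition sgn3 :: "'a::linordered_ab_group_add \<Rightarrow> int" where
  "sgn3 x = (if x < 0 then - 1 else if x = 0 then 0 else 1)"

definition zt :: "'a::linordered_ab_group_add \<Rightarrow> int" where
  "zt x = (if x = 0 then 0 else 1)"

definition signs :: "('a::linordered_ab_group_add \<Rightarrow> int) set" where
  "signs = {sgn3, zt}"

lemma sgn3_sign [simp]: "sgn3 \<in> signs" and zt_sign [simp]: "zt \<in> signs"
  by (simp_all add: signs_def)

lemma sgn3_simps [simp]:
  "sgn3 x = - 1 \<longleftrightarrow> x < 0" "sgn3 x = 0 \<longleftrightarrow> x = 0" "sgn3 x = 1 \<longleftrightarrow> 0 < x"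
  "sgn3 (- x) = - sgn3 x"
  by (auto simp: sgn3_def)

lemma sign_eq_0: "sg \<in> signs \<Longrightarrow> sg x = 0 \<longleftrightarrow> x = 0"
  by (auto simp: signs_def zt_def split: if_splits)

lemma sign_range: "sg \<in> signs \<Longrightarrow> sg x \<in> {-1, 0, 1}"
  by (auto simp: signs_def zt_def sgn3_def split: if_splits)

lemma sign_zmul: "sg \<in> signs \<Longrightarrow> 0 < q \<Longrightarrow> sg (zmul q x) = sg x"
  using zmul_less_iff [of q x 0] by (auto simp: signs_def zt_def sgn3_def zmul_eq_0_iff)

definition sign_atoms :: "('a::linordered_ab_group_add \<Rightarrow> int) \<Rightarrow> nat \<Rightarrow> ((nat \<Rightarrow> 'a) \<Rightarrow> bool) set" where
  "sign_atoms sg k = {\<lambda>v. sg (h v) = s | h s. aff k h}"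

definition cong_atoms :: "nat \<Rightarrow> ((nat \<Rightarrow> 'a::ab_group_add) \<Rightarrow> bool) set" where
  "cong_atoms k = {\<lambda>v. \<exists>y. h v = zmul n y | h n. aff k h \<and> 1 \<le> n}"

abbreviation Comb :: "('a::linordered_ab_group_add \<Rightarrow> int) \<Rightarrow> nat \<Rightarrow> ((nat \<Rightarrow> 'a) \<Rightarrow> bool) \<Rightarrow> bool" where
  "Comb sg k \<equiv> comb (sign_atoms sg k \<union> cong_atoms k)"

lemma comb_sign: "aff k h \<Longrightarrow> sign_atoms sg k \<subseteq> \<A> \<Longrightarrow> comb \<A> (\<lambda>v. sg (h v) = s)"
  by (rule comb_atom) (auto simp: sign_atoms_def)

lemma Comb_sign: "aff k h \<Longrightarrow> Comb sg k (\<lambda>v. sg (h v) = s)"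
  by (rule comb_sign) auto

lemma Comb_cong: "aff k h \<Longrightarrow> 1 \<le> n \<Longrightarrow> Comb sg k (\<lambda>v. \<exists>y. h v = zmul n y)"
  by (rule comb_atom) (auto simp: cong_atoms_def)

lemma Comb_eq: "sg \<in> signs \<Longrightarrow> aff k f \<Longrightarrow> aff k g \<Longrightarrow> Comb sg k (\<lambda>v. f v = g v)"
  using Comb_sign [of k "\<lambda>v. f v - g v" sg 0] by (simp add: aff_diff sign_eq_0)

lemma Comb_less: "aff k f \<Longrightarrow> aff k g \<Longrightarrow> Comb sgn3 k (\<lambda>v. f v < g v)"
  using Comb_sign [of k "\<lambda>v. f v - g v" sgn3 "-1"] by (simp add: aff_diff)

lemma comb_sign_subst:
  assumes "comb (sign_atoms sg k) P" "\<And>i. i < k \<Longrightarrow> aff l (g i)"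
  shows "comb (sign_atoms sg l) (\<lambda>v. P (\<lambda>i. g i v))"
proof (rule comb_subst [OF assms(1)])
  fix A assume "A \<in> sign_atoms sg k"
  then obtain h s where A: "A = (\<lambda>v. sg (h v) = s)" "aff k h" by (auto simp: sign_atoms_def)
  have "aff l (\<lambda>v. h (\<lambda>i. g i v))" by (rule aff_subst [OF A(2) assms(2)])
  then show "comb (sign_atoms sg l) (\<lambda>v. A (\<lambda>i. g i v))"
    unfolding A(1) by (rule comb_sign) simp
qed

lemma Comb_subst:
  assumes "Comb sg k P" "\<And>i. i < k \<Longrightarrow> aff l (g i)"
  shows "Comb sg l (\<lambda>v. P (\<lambda>i. g i v))"
proof (rule comb_subst [OF assms(1)])
  fix A :: "(nat \<Rightarrow> 'a) \<Rightarrow> bool"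
  assume "A \<in> sign_atoms sg k \<union> cong_atoms k"
  then show "Comb sg l (\<lambda>v. A (\<lambda>i. g i v))"
  proof
    assume "A \<in> sign_atoms sg k"
    then obtain h s where A: "A = (\<lambda>v. sg (h v) = s)" "aff k h" by (auto simp: sign_atoms_def)
    have "aff l (\<lambda>v. h (\<lambda>i. g i v))" by (rule aff_subst [OF A(2) assms(2)])
    then show ?thesis unfolding A(1) by (rule Comb_sign)
  next
    assume "A \<in> cong_atoms k"
    then obtain h n where A: "A = (\<lambda>v. \<exists>y. h v = zmul n y)" "aff k h" "1 \<le> n"
      by (auto simp: cong_atoms_def)
    have "aff l (\<lambda>v. h (\<lambda>i. g i v))" by (rule aff_subst [OF A(2) assms(2)])
    then show ?thesis unfolding A(1) using A(3) by (rule Comb_cong)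
  qed
qed

lemma Comb_mono: "Comb sg k P \<Longrightarrow> k \<le> l \<Longrightarrow> Comb sg l P"
  using Comb_subst [of sg k P l "\<lambda>i v. v i"] by (simp add: aff_var)

text \<open>
  Reduces the elimination of a quantifier to systems that prescribe the sign of each form: the
  predicate is a finite disjunction over the sign patterns that it realises, and conditions without
  the quantified variable move outside.
\<close>

lemma comb_ex_determined:
  assumes sg: "sg \<in> signs" and fin: "finite H" "finite G"
    and G: "\<And>B. B \<in> G \<Longrightarrow> comb \<A> B" "\<And>B v x. B \<in> G \<Longrightarrow> B (v(i := x)) = B v"
    and Q: "\<And>v w. (\<And>h. h \<in> H \<Longrightarrow> sg (h v) = sg (h w)) \<Longrightarrow> (\<And>B. B \<in> G \<Longrightarrow> B v = B w) \<Longrightarrow> Q v = Q w"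
    and core: "\<And>\<sigma>. comb \<A> (\<lambda>v. \<exists>x. \<forall>h\<in>H. sg (h (v(i := x))) = \<sigma> h)"
  shows "comb \<A> (\<lambda>v. \<exists>x. Q (v(i := x)))"
proof -
  define pat where "pat w = ({B \<in> G. B w}, \<lambda>h. if h \<in> H then sg (h w) else 0)" for w
  define I where "I = {pat w | w. Q w}"
  have "I \<subseteq> Pow G \<times> {\<sigma>. \<forall>h. (h \<in> H \<longrightarrow> \<sigma> h \<in> {-1, 0, 1}) \<and> (h \<notin> H \<longrightarrow> \<sigma> h = 0)}"
  proof
    fix p assume "p \<in> I"
    then obtain w where "p = pat w" unfolding I_def by blast
    then show "p \<in> Pow G \<times> {\<sigma>. \<forall>h. (h \<in> H \<longrightarrow> \<sigma> h \<in> {-1, 0, 1}) \<and> (h \<notin> H \<longrightarrow> \<sigma> h = 0)}"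
      using sign_range [OF sg] by (simp add: pat_def subset_iff)
  qed
  moreover have "finite (Pow G \<times> {\<sigma>. \<forall>h. (h \<in> H \<longrightarrow> \<sigma> h \<in> {-1, 0, 1}) \<and> (h \<notin> H \<longrightarrow> \<sigma> h = (0::int))})"
    using fin by (intro finite_cartesian_product finite_set_of_finite_funs) auto
  ultimately have I: "finite I" by (rule finite_subset)
  have "comb \<A> (\<lambda>v. B v = c)" if "B \<in> G" for B c
    using comb_not [OF G(1) [OF that]] G(1) [OF that] by (cases c) simp_all
  then have "comb \<A> (\<lambda>v. \<exists>p\<in>I. (\<forall>B\<in>G. B v = (B \<in> fst p)) \<and> (\<exists>x. \<forall>h\<in>H. sg (h (v(i := x))) = snd p h))"
    by (intro comb_bex I comb_and comb_ball fin core) auto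
  moreover have "(\<lambda>v. \<exists>x. Q (v(i := x))) =
      (\<lambda>v. \<exists>p\<in>I. (\<forall>B\<in>G. B v = (B \<in> fst p)) \<and> (\<exists>x. \<forall>h\<in>H. sg (h (v(i := x))) = snd p h))"
  proof (intro ext iffI)
    fix v assume "\<exists>x. Q (v(i := x))"
    then obtain x where x: "Q (v(i := x))" by blast
    then have "pat (v(i := x)) \<in> I" unfolding I_def by blast
    moreover have "\<forall>B\<in>G. B v = (B \<in> fst (pat (v(i := x))))"
    proof
      fix B assume "B \<in> G"
      then show "B v = (B \<in> fst (pat (v(i := x))))" using G(2) [of B v x] by (simp add: pat_def)
    qed
    moreover have "\<forall>h\<in>H. sg (h (v(i := x))) = snd (pat (v(i := x))) h"
      unfolding pat_def by simp
    ultimately show "\<exists>p\<in>I. (\<forall>B\<in>G. B v = (B \<in> fst p)) \<and> (\<exists>x. \<forall>h\<in>H. sg (h (v(i := x))) = snd p h)"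
      by blast
  next
    fix v assume "\<exists>p\<in>I. (\<forall>B\<in>G. B v = (B \<in> fst p)) \<and> (\<exists>x. \<forall>h\<in>H. sg (h (v(i := x))) = snd p h)"
    then obtain w x where w: "Q w" "\<forall>B\<in>G. B v = (B \<in> fst (pat w))"
      "\<forall>h\<in>H. sg (h (v(i := x))) = snd (pat w) h"
      unfolding I_def by blast
    have "Q (v(i := x)) = Q w"
    proof (rule Q)
      fix h assume "h \<in> H"
      then show "sg (h (v(i := x))) = sg (h w)" using w(3) by (simp add: pat_def)
    next
      fix B assume "B \<in> G"
      then show "B (v(i := x)) = B w"
        using bspec [OF w(2), of B] G(2) [of B v x] by (simp add: pat_def)
    qed
    then show "\<exists>x. Q (v(i := x))" using w(1) by blast
  qed
  ultimately show ?thesis by simp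
qed

context regular_group
begin

lemma Comb_between:
  assumes "1 \<le> m" "aff k f" "aff k g"
  shows "Comb sgn3 k (\<lambda>v. \<exists>x::'a. f v < zmul m x \<and> zmul m x < g v)"
proof (cases dense)
  case True
  have "(\<exists>x::'a. s < zmul m x \<and> zmul m x < t) \<longleftrightarrow> s < t" for s t :: 'a
    using dense_multiple_between [OF True assms(1), of s t] by auto
  then show ?thesis using Comb_less [OF assms(2,3)] by simp
next
  case False
  show ?thesis
    unfolding discrete_multiple_between [OF False assms(1)]
    using assms by (intro comb_bex comb_and Comb_cong Comb_less aff_add aff_const) auto
qed

text \<open>
  A system in which all forms have the same coefficient \<open>m\<close> at \<open>x\<close>. An equation among the conditions
  determines \<open>m x\<close>. Otherwise inequations alone are always solvable, and inequalities are solvable as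
  soon as every lower bound is compatible with every upper bound, since only the largest lower and the
  smallest upper bound matter.
\<close>

lemma Comb_system:
  assumes sg: "sg \<in> signs" and m: "1 \<le> m" and J: "finite J" and s: "\<And>j. j \<in> J \<Longrightarrow> aff k (s j)"
  shows "Comb sg k (\<lambda>v. \<exists>x::'a. \<forall>j\<in>J. sg (zmul m x - s j v) = \<rho> j)"
proof (cases "\<exists>j\<in>J. \<rho> j = 0")
  case True
  then obtain j0 where j0: "j0 \<in> J" "\<rho> j0 = 0" by blast
  have "(\<exists>x. \<forall>j\<in>J. sg (zmul m x - s j v) = \<rho> j) \<longleftrightarrow>
      (\<exists>x. s j0 v = zmul m x) \<and> (\<forall>j\<in>J. sg (s j0 v - s j v) = \<rho> j)" for v
  proof
    assume "\<exists>x. \<forall>j\<in>J. sg (zmul m x - s j v) = \<rho> j"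
    then obtain x where x: "\<forall>j\<in>J. sg (zmul m x - s j v) = \<rho> j" by blast
    then have "s j0 v = zmul m x" using j0 sign_eq_0 [OF sg, of "zmul m x - s j0 v"] by auto
    then show "(\<exists>x. s j0 v = zmul m x) \<and> (\<forall>j\<in>J. sg (s j0 v - s j v) = \<rho> j)"
      using x by auto
  next
    assume *: "(\<exists>x. s j0 v = zmul m x) \<and> (\<forall>j\<in>J. sg (s j0 v - s j v) = \<rho> j)"
    then obtain x where x: "s j0 v = zmul m x" by blast
    show "\<exists>x. \<forall>j\<in>J. sg (zmul m x - s j v) = \<rho> j"
      using * by (intro exI [of _ x]) (simp add: x [symmetric])
  qed
  moreover have "Comb sg k (\<lambda>v. (\<exists>x. s j0 v = zmul m x) \<and> (\<forall>j\<in>J. sg (s j0 v - s j v) = \<rho> j))"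
    using s m J j0(1) by (intro comb_and comb_ball Comb_cong Comb_sign aff_diff) auto
  ultimately show ?thesis by simp
next
  case no0: False
  show ?thesis
  proof (cases "sg = zt \<and> (\<forall>j\<in>J. \<rho> j = 1)")
    case True
    have "\<exists>x. \<forall>j\<in>J. sg (zmul m x - s j v) = \<rho> j" for v
    proof -
      obtain x where "\<forall>t\<in>(\<lambda>j. s j v) ` J. t < zmul m x"
        using multiple_above_finite [OF m, of "(\<lambda>j. s j v) ` J"] J by auto
      then show ?thesis using True by (intro exI [of _ x]) (auto simp: zt_def)
    qed
    then show ?thesis by (simp add: comb_const)
  next
    case noz: False
    show ?thesis
    proof (cases "sg = sgn3 \<and> (\<forall>j\<in>J. \<rho> j \<in> {-1, 1})")
      case True
      define L where "L = {j \<in> J. \<rho> j = 1}"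
      define U where "U = {j \<in> J. \<rho> j = -1}"
      have JLU: "J = L \<union> U" using True by (auto simp: L_def U_def)
      have fin: "finite L" "finite U" using J by (auto simp: L_def U_def)
      have "(\<exists>x. \<forall>j\<in>J. sg (zmul m x - s j v) = \<rho> j) \<longleftrightarrow>
          (\<forall>l\<in>L. \<forall>u\<in>U. \<exists>x. s l v < zmul m x \<and> zmul m x < s u v)" for v
      proof -
        have "(\<exists>x. \<forall>j\<in>J. sg (zmul m x - s j v) = \<rho> j) \<longleftrightarrow>
            (\<exists>x. (\<forall>l\<in>L. s l v < zmul m x) \<and> (\<forall>u\<in>U. zmul m x < s u v))"
          using True unfolding JLU by (auto simp: L_def U_def ball_Un)
        also have "\<dots> \<longleftrightarrow> (\<forall>l\<in>L. \<forall>u\<in>U. \<exists>x. s l v < zmul m x \<and> zmul m x < s u v)"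
        proof
          assume *: "\<forall>l\<in>L. \<forall>u\<in>U. \<exists>x. s l v < zmul m x \<and> zmul m x < s u v"
          consider "L = {}" | "U = {}" | "L \<noteq> {}" "U \<noteq> {}" by blast
          then show "\<exists>x. (\<forall>l\<in>L. s l v < zmul m x) \<and> (\<forall>u\<in>U. zmul m x < s u v)"
          proof cases
            case 1
            then show ?thesis using multiple_below_finite [OF m, of "(\<lambda>j. s j v) ` U"] fin by auto
          next
            case 2
            then show ?thesis using multiple_above_finite [OF m, of "(\<lambda>j. s j v) ` L"] fin by auto
          next
            case 3
            have "Max ((\<lambda>j. s j v) ` L) \<in> (\<lambda>j. s j v) ` L" "Min ((\<lambda>j. s j v) ` U) \<in> (\<lambda>j. s j v) ` U"
              using 3 fin by (auto intro!: Max_in Min_in)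
            then obtain l u where l: "l \<in> L" "Max ((\<lambda>j. s j v) ` L) = s l v"
              and u: "u \<in> U" "Min ((\<lambda>j. s j v) ` U) = s u v" by auto
            have "\<forall>j\<in>L. s j v \<le> s l v" "\<forall>j\<in>U. s u v \<le> s j v"
              using l(2) u(2) fin by (metis Max_ge finite_imageI imageI, metis Min_le finite_imageI imageI)
            moreover obtain x where "s l v < zmul m x" "zmul m x < s u v" using * l(1) u(1) by blast
            ultimately show ?thesis by (intro exI [of _ x]) (meson le_less_trans less_le_trans)
          qed
        qed blast
        finally show ?thesis .
      qed
      moreover have "Comb sg k (\<lambda>v. \<forall>l\<in>L. \<forall>u\<in>U. \<exists>x. s l v < zmul m x \<and> zmul m x < s u v)"
      proof -
        have "Comb sgn3 k (\<lambda>v. \<exists>x. s l v < zmul m x \<and> zmul m x < s u v)" if "l \<in> L" "u \<in> U" for l u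
          using that s m by (intro Comb_between) (auto simp: L_def U_def)
        then show ?thesis using True fin by (simp only: comb_ball)
      qed
      ultimately show ?thesis by simp
    next
      case False
      then obtain j where j: "j \<in> J" "\<And>x. sg x \<noteq> \<rho> j"
      proof (cases "sg = zt")
        case True
        then obtain j where "j \<in> J" "\<rho> j \<noteq> 1" using noz by blast
        moreover have "\<rho> j \<noteq> 0" using no0 \<open>j \<in> J\<close> by blast
        ultimately show ?thesis using True by (intro that [of j]) (auto simp: zt_def)
      next
        case nzt: False
        then have "sg = sgn3" using sg by (simp add: signs_def)
        then obtain j where "j \<in> J" "\<rho> j \<notin> {-1, 1}" using False by blast
        moreover have "\<rho> j \<noteq> 0" using no0 \<open>j \<in> J\<close> by blast
        ultimately show ?thesis using sign_range [OF sg] by (intro that [of j]) (auto, metis)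
      qed
      then have "(\<lambda>v. \<exists>x. \<forall>j\<in>J. sg (zmul m x - s j v) = \<rho> j) = (\<lambda>_. False)" by blast
      then show ?thesis by (simp add: comb_const)
    qed
  qed
qed

end


lemma sign_minus_eq:
  assumes "sg \<in> signs"
  shows "sg (- d) = t \<longleftrightarrow> sg d = (if sg = zt then t else - t)"
proof (cases "sg = zt")
  case False
  then have "sg = sgn3" using assms by (simp add: signs_def)
  then show ?thesis using False by auto
qed (simp add: zt_def)

lemma aff_upd:
  assumes "aff k h" "aff k g"
  shows "aff k (\<lambda>v. h (v(i := g v)))"
proof -
  obtain n where n: "\<And>v x. h (v(i := x)) = zmul n x + h (v(i := 0))"
    using aff_split [OF assms(1), of i] by metis
  have "(\<lambda>v. h (v(i := g v))) = (\<lambda>v. zmul n (g v) + h (v(i := 0)))" by (rule ext, rule n)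
  then show ?thesis using assms by (simp add: aff_add aff_zmul aff_fun_upd_0)
qed

lemma cong_atoms_common_modulus:
  assumes "finite F" "F \<subseteq> cong_atoms k"
  obtains m where "1 \<le> m" "\<And>A. A \<in> F \<Longrightarrow> \<exists>h n. A = (\<lambda>v. \<exists>y. h v = zmul n y) \<and> aff k h \<and> 1 \<le> n \<and> n dvd m"
proof -
  have "\<forall>A\<in>F. \<exists>n. \<exists>h. A = (\<lambda>v. \<exists>y. h v = zmul n y) \<and> aff k h \<and> 1 \<le> n"
    using assms(2) unfolding cong_atoms_def by blast
  then obtain n where n: "\<forall>A\<in>F. \<exists>h. A = (\<lambda>v. \<exists>y. h v = zmul (n A) y) \<and> aff k h \<and> 1 \<le> n A"
    by metis
  show thesis
  proof (rule that)
    have "0 < (\<Prod>A\<in>F. n A)" by (rule prod_pos) (use n in fastforce)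
    then show "1 \<le> (\<Prod>A\<in>F. n A)" by simp
    show "\<exists>h m. A = (\<lambda>v. \<exists>y. h v = zmul m y) \<and> aff k h \<and> 1 \<le> m \<and> m dvd (\<Prod>A\<in>F. n A)" if "A \<in> F" for A
      using bspec [OF n that] dvd_prodI [OF assms(1) that, of n] by blast
  qed
qed

text \<open>
  Congruences are constant along cosets of a common multiple of their moduli.
\<close>

lemma congruence_shift:
  fixes x :: "'b::linordered_ab_group_add"
  assumes "n dvd m"
  shows "(\<exists>y. x + zmul m z = zmul n y) \<longleftrightarrow> (\<exists>y. x = zmul n y)"
proof -
  obtain l where l: "m = n * l" using assms by blast
  have "zmul m z = zmul n (zmul l z)" by (simp add: l zmul_zmul)
  then have "x + zmul m z = zmul n y \<longleftrightarrow> x = zmul n (y - zmul l z)" for y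
    by (auto simp: zm.scale_right_diff_distrib algebra_simps)
  then show ?thesis by (metis add_diff_cancel)
qed

lemma Comb_depends:
  fixes P :: "(nat \<Rightarrow> 'b::linordered_ab_group_add) \<Rightarrow> bool"
  assumes "Comb sg k P"
  shows "depends k P"
proof (rule dependsI)
  fix v w :: "nat \<Rightarrow> 'b" assume vw: "\<And>i. i < k \<Longrightarrow> v i = w i"
  obtain F where F: "finite F" "F \<subseteq> sign_atoms sg k \<union> cong_atoms k" "determined F P"
    using assms unfolding comb_def by blast
  have h: "h v = h w" if "aff k h" for h :: "(nat \<Rightarrow> 'b) \<Rightarrow> 'b"
    by (rule dependsD [OF aff_depends [OF that] vw])
  show "P v = P w"
  proof (rule determinedD [OF F(3)])
    fix A assume "A \<in> F"
    then consider g s where "A = (\<lambda>v. sg (g v) = s)" "aff k g"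
      | g n where "A = (\<lambda>v. \<exists>y. g v = zmul n y)" "aff k g"
      using F(2) unfolding sign_atoms_def cong_atoms_def by blast
    then show "A v = A w"
    proof cases
      case 1
      then show ?thesis using h [OF 1(2)] by simp
    next
      case 2
      then show ?thesis using h [OF 2(2)] by simp
    qed
  qed
qed

context regular_group
begin

text \<open>
  Multiplying each form by a positive integer makes all coefficients of \<open>x\<close> equal to \<open>m\<close> or \<open>- m\<close>
  without changing signs.
\<close>

lemma Comb_conditions:
  assumes sg: "sg \<in> signs" and H: "finite H" "\<And>h. h \<in> H \<Longrightarrow> aff k h"
  shows "Comb sg k (\<lambda>v. \<exists>x::'a. \<forall>h\<in>H. sg (h (v(i := x))) = \<sigma> h)"
proof -
  have "\<exists>n. \<forall>v x. h (v(i := x)) = zmul n x + h (v(i := 0))" if "h \<in> H" for h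
    using aff_split [OF H(2) [OF that], of i] by metis
  then obtain a where a: "\<And>h v x. h \<in> H \<Longrightarrow> h (v(i := x)) = zmul (a h) x + h (v(i := 0))"
    by metis
  define H0 where "H0 = {h \<in> H. a h = 0}"
  define H1 where "H1 = {h \<in> H. a h \<noteq> 0}"
  have H01: "H = H0 \<union> H1" "finite H0" "finite H1" using H(1) by (auto simp: H0_def H1_def)
  define m where "m = (\<Prod>h\<in>H1. \<bar>a h\<bar>)"
  have "0 < m" unfolding m_def by (rule prod_pos) (auto simp: H1_def)
  then have m: "1 \<le> m" by simp
  define q where "q h = m div \<bar>a h\<bar>" for h
  have qa: "q h * \<bar>a h\<bar> = m" if "h \<in> H1" for h
    using dvd_prodI [of H1 h "\<lambda>h. \<bar>a h\<bar>"] H01(3) that by (simp add: q_def m_def)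
  have q: "0 < q h" if "h \<in> H1" for h
  proof -
    have "0 < q h * \<bar>a h\<bar>" using qa [OF that] \<open>0 < m\<close> by simp
    then show ?thesis using that by (simp add: H1_def zero_less_mult_iff)
  qed
  define s where "s h v = - zmul (sgn (a h) * q h) (h (v(i := 0)))" for h v
  \<comment> \<open>a negative coefficient reverses the sign, but not the zero test\<close>
  define \<rho> where "\<rho> h = (if 0 < a h \<or> sg = zt then \<sigma> h else - \<sigma> h)" for h
  have conv: "sg (h (v(i := x))) = \<sigma> h \<longleftrightarrow> sg (zmul m x - s h v) = \<rho> h" if h: "h \<in> H1" for h v x
  proof -
    have h': "h \<in> H" "a h \<noteq> 0" using h by (auto simp: H1_def)
    have "sg (h (v(i := x))) = sg (zmul (q h) (h (v(i := x))))"
      using sign_zmul [OF sg q [OF h]] by simp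
    also have "zmul (q h) (h (v(i := x))) = zmul (q h * a h) x + zmul (q h) (h (v(i := 0)))"
      unfolding a [OF h'(1), of v x] by (simp add: zmul_add_right zmul_zmul)
    finally have eq: "sg (h (v(i := x))) = sg (zmul (q h * a h) x + zmul (q h) (h (v(i := 0))))" .
    show ?thesis
    proof (cases "0 < a h")
      case True
      then have "q h * a h = m" using qa [OF h] by simp
      then show ?thesis using eq True by (simp add: s_def \<rho>_def)
    next
      case False
      then have neg: "a h < 0" using h' by simp
      then have "q h * a h = - m" using qa [OF h] by simp
      then have "zmul (q h * a h) x + zmul (q h) (h (v(i := 0))) = - (zmul m x - s h v)"
        using neg by (simp add: s_def)
      then have "sg (h (v(i := x))) = sg (- (zmul m x - s h v))" using eq by simp
      then show ?thesis
        using neg by (simp add: \<rho>_def sign_minus_eq [OF sg, of "zmul m x - s h v"] del: minus_diff_eq)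
    qed
  qed
  have "(\<exists>x. \<forall>h\<in>H. sg (h (v(i := x))) = \<sigma> h) \<longleftrightarrow>
      (\<forall>h\<in>H0. sg (h (v(i := 0))) = \<sigma> h) \<and> (\<exists>x. \<forall>h\<in>H1. sg (zmul m x - s h v) = \<rho> h)" for v
  proof -
    have h0: "sg (h (v(i := x))) = sg (h (v(i := 0)))" if "h \<in> H0" for h x
      using a [of h v x] that by (simp add: H0_def)
    have "(\<forall>h\<in>H0. sg (h (v(i := x))) = \<sigma> h) \<longleftrightarrow> (\<forall>h\<in>H0. sg (h (v(i := 0))) = \<sigma> h)" for x
      by (intro ball_cong refl) (subst h0, assumption, rule refl)
    moreover have "(\<forall>h\<in>H1. sg (h (v(i := x))) = \<sigma> h) \<longleftrightarrow> (\<forall>h\<in>H1. sg (zmul m x - s h v) = \<rho> h)" for x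
      by (intro ball_cong refl conv)
    ultimately show ?thesis unfolding H01(1) ball_Un by (simp only:) blast
  qed
  moreover have "Comb sg k (\<lambda>v. (\<forall>h\<in>H0. sg (h (v(i := 0))) = \<sigma> h) \<and>
      (\<exists>x. \<forall>h\<in>H1. sg (zmul m x - s h v) = \<rho> h))"
  proof (intro comb_and comb_ball Comb_system sg m H01)
    fix h assume "h \<in> H0"
    then show "Comb sg k (\<lambda>v. sg (h (v(i := 0))) = \<sigma> h)"
      using H(2) by (intro Comb_sign aff_fun_upd_0) (auto simp: H0_def)
  next
    fix h assume "h \<in> H1"
    then show "aff k (s h)"
      unfolding s_def [abs_def] using H(2)
      by (intro aff_uminus aff_zmul aff_fun_upd_0) (auto simp: H1_def)
  qed
  ultimately show ?thesis by simp
qed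

text \<open>
  Quantifier elimination. On each of the finitely many cosets of \<open>mG\<close>, with \<open>m\<close> a common modulus,
  the congruences no longer involve the quantified variable, and only a sign system is left.
\<close>

theorem Comb_ex:
  assumes sg: "sg \<in> signs" and P: "Comb sg k P"
  shows "Comb sg k (\<lambda>v. \<exists>x::'a. P (v(i := x)))"
proof (cases "i < k")
  case i: True
  from P obtain F where F: "finite F" "F \<subseteq> sign_atoms sg k \<union> cong_atoms k" "determined F P"
    unfolding comb_def by blast
  obtain m where m: "1 \<le> m" "\<And>A. A \<in> F \<inter> cong_atoms k \<Longrightarrow>
      \<exists>h n. A = (\<lambda>v. \<exists>y. h v = zmul n y) \<and> aff k h \<and> 1 \<le> n \<and> n dvd m"
    using cong_atoms_common_modulus [of "F \<inter> cong_atoms k" k] F(1) by auto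
  obtain C where C: "finite C" "\<And>x::'a. \<exists>c\<in>C. \<exists>y. x = c + zmul m y"
    using finite_index [OF m(1)] by blast
  have "\<forall>A\<in>F \<inter> sign_atoms sg k. \<exists>h. \<exists>s. A = (\<lambda>v. sg (h v) = s) \<and> aff k h"
    unfolding sign_atoms_def by blast
  then obtain h where h: "\<And>A. A \<in> F \<inter> sign_atoms sg k \<Longrightarrow> \<exists>s. A = (\<lambda>v. sg (h A v) = s) \<and> aff k (h A)"
    by metis
  \<comment> \<open>quantify over the coset and over the position in it separately\<close>
  have split: "(\<exists>x. P (v(i := x))) \<longleftrightarrow> (\<exists>c\<in>C. \<exists>z. P (v(i := c + zmul m z)))" for v
    using C(2) by metis
  have "Comb sg k (\<lambda>v. \<exists>z. P (v(i := c + zmul m z)))" for c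
  proof -
    define up where "up v = v(i := c + zmul m (v i))" for v
    define H where "H = (\<lambda>A v. h A (up v)) ` (F \<inter> sign_atoms sg k)"
    define G where "G = (\<lambda>A v. A (v(i := c))) ` (F \<inter> cong_atoms k)"
    have aff_up: "aff k (\<lambda>v. g (up v))" if "aff k g" for g
      unfolding up_def by (rule aff_upd [OF that aff_add [OF aff_const aff_zmul [OF aff_var [OF i]]]])
    have up_cong: "A (up v) = A (v(i := c))" if A0: "A \<in> F \<inter> cong_atoms k" for A v
    proof -
      obtain g n where A: "A = (\<lambda>v. \<exists>y. g v = zmul n y)" "aff k g" "n dvd m"
        using m(2) [OF A0] by blast
      obtain a where a: "\<And>v x. g (v(i := x)) = zmul a x + g (v(i := 0))"
        using aff_split [OF A(2), of i] by metis
      have gup: "g (up v) = g (v(i := c)) + zmul m (zmul a (v i))"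
        unfolding up_def a [of v "c + zmul m (v i)"] a [of v c]
        by (simp add: zmul_add_right zmul_zmul mult.commute)
      show ?thesis unfolding A(1) gup by (rule congruence_shift [OF A(3)])
    qed
    have "Comb sg k (\<lambda>v. \<exists>z. (\<lambda>v. P (up v)) (v(i := z)))"
    proof (rule comb_ex_determined [OF sg, of H G])
      show "finite H" "finite G" using F(1) by (auto simp: H_def G_def)
    next
      fix B assume "B \<in> G"
      then obtain A where A: "A \<in> F \<inter> cong_atoms k" "B = (\<lambda>v. A (v(i := c)))" by (auto simp: G_def)
      obtain g n where g: "A = (\<lambda>v. \<exists>y. g v = zmul n y)" "aff k g" "1 \<le> n"
        using m(2) [OF A(1)] by blast
      show "Comb sg k B" unfolding A(2) g(1) by (rule Comb_cong [OF aff_upd [OF g(2) aff_const] g(3)])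
      show "B (v(i := x)) = B v" for v x by (simp add: A(2))
    next
      fix v w
      assume vw: "\<And>h. h \<in> H \<Longrightarrow> sg (h v) = sg (h w)" "\<And>B. B \<in> G \<Longrightarrow> B v = B w"
      show "P (up v) = P (up w)"
      proof (rule determinedD [OF F(3)])
        fix A assume "A \<in> F"
        then consider "A \<in> F \<inter> sign_atoms sg k" | "A \<in> F \<inter> cong_atoms k" using F(2) by blast
        then show "A (up v) = A (up w)"
        proof cases
          case 1
          obtain s where "A = (\<lambda>v. sg (h A v) = s)" using h [OF 1] by blast
          moreover have "sg (h A (up v)) = sg (h A (up w))"
            using vw(1) [of "\<lambda>v. h A (up v)"] 1 by (auto simp: H_def)
          ultimately show ?thesis by metis
        next
          case 2
          then have "A (v(i := c)) = A (w(i := c))"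
            using vw(2) [of "\<lambda>v. A (v(i := c))"] by (auto simp: G_def)
          then show ?thesis using up_cong [OF 2] by simp
        qed
      qed
    next
      fix \<sigma>
      show "Comb sg k (\<lambda>v. \<exists>x. \<forall>h\<in>H. sg (h (v(i := x))) = \<sigma> h)"
      proof (rule Comb_conditions [OF sg])
        show "finite H" using F(1) by (auto simp: H_def)
        fix g assume "g \<in> H"
        then show "aff k g" using h aff_up by (auto simp: H_def)
      qed
    qed
    then show ?thesis by (simp add: up_def)
  qed
  then show ?thesis unfolding split by (intro comb_bex C)
next
  case False
  have "P (v(i := x)) = P v" for v x
    by (rule dependsD [OF Comb_depends [OF P]]) (use False in auto)
  then show ?thesis using P by simp
qed

lemma Comb_ex_block:
  assumes sg: "sg \<in> signs" and P: "Comb sg k P"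
  shows "Comb sg k (\<lambda>v. \<exists>w::nat \<Rightarrow> 'a. (\<forall>i\<ge>n. w i = v i) \<and> P w)"
proof (induction n)
  case 0
  have "(\<lambda>v. \<exists>w. (\<forall>i\<ge>0. w i = v i) \<and> P w) = P" by (auto simp: fun_eq_iff [symmetric])
  then show ?case using P by simp
next
  case (Suc n)
  have "(\<lambda>v. \<exists>w. (\<forall>i\<ge>Suc n. w i = v i) \<and> P w) =
      (\<lambda>v. \<exists>x. (\<lambda>v. \<exists>w. (\<forall>i\<ge>n. w i = v i) \<and> P w) (v(n := x)))"
  proof (intro ext iffI)
    fix v assume "\<exists>w. (\<forall>i\<ge>Suc n. w i = v i) \<and> P w"
    then obtain w where "\<forall>i\<ge>Suc n. w i = v i" "P w" by blast
    then show "\<exists>x. \<exists>w. (\<forall>i\<ge>n. w i = (v(n := x)) i) \<and> P w"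
      by (intro exI [of _ "w n"] exI [of _ w]) auto
  next
    fix v assume "\<exists>x. \<exists>w. (\<forall>i\<ge>n. w i = (v(n := x)) i) \<and> P w"
    then obtain x w where w: "\<forall>i\<ge>n. w i = (v(n := x)) i" "P w" by blast
    have "w i = v i" if "i \<ge> Suc n" for i using w(1) that by auto
    then show "\<exists>w. (\<forall>i\<ge>Suc n. w i = v i) \<and> P w" using w(2) by blast
  qed
  then show ?case using Comb_ex [OF sg Suc] by simp
qed

lemma aff_term_val:
  assumes "fun_syms N = {(PlusSym, 2)}" "fun_int N = (\<lambda>_ xs. xs ! 0 + xs ! 1)"
    and "wf_term N t" "term_vars t \<subseteq> {..<k}"
  shows "aff k (\<lambda>v :: nat \<Rightarrow> 'a. term_val N v t)"
  using assms(3,4)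
proof (induction t)
  case (FVar i)
  then show ?case by (simp add: aff_var)
next
  case (FApp f ts)
  then have "length ts = 2" using assms(1) by simp
  then obtain s t where ts: "ts = [s, t]" by (auto simp: numeral_2_eq_2 length_Suc_conv)
  have "aff k (\<lambda>v. term_val N v s)" "aff k (\<lambda>v. term_val N v t)"
    using FApp ts by auto
  then show ?case by (simp add: assms(2) ts aff_add)
qed

lemma Comb_satisfies:
  fixes N :: "('a, group_symbol, 's) fo_structure"
  assumes "fun_syms N = {(PlusSym, 2)}" "fun_int N = (\<lambda>_ xs. xs ! 0 + xs ! 1)"
    and rel: "\<And>r n. (r, n) \<in> rel_syms N \<Longrightarrow> sg = sgn3 \<and> n = 2 \<and> rel_int N r = (\<lambda>xs. xs ! 0 < xs ! 1)"
    and sg: "sg \<in> signs" and "wf_formula N p"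
  shows "\<exists>k. Comb sg k (\<lambda>v. satisfies N v p)"
  using assms(5)
proof (induction p)
  case (FEq s t)
  obtain k where "free_vars (FEq s t :: (group_symbol, 's) fo_formula) \<subseteq> {..<k}" by (rule free_vars_bound)
  then have "Comb sg k (\<lambda>v. term_val N v s = term_val N v t)"
    using FEq by (intro Comb_eq sg aff_term_val assms(1,2)) auto
  then show ?case by auto
next
  case (FRel r ts)
  then have r: "sg = sgn3" "length ts = 2" "rel_int N r = (\<lambda>xs. xs ! 0 < xs ! 1)"
    using rel [of r "length ts"] by auto
  then obtain s t where ts: "ts = [s, t]" by (auto simp: numeral_2_eq_2 length_Suc_conv)
  obtain k where "free_vars (FRel r ts) \<subseteq> {..<k}" by (rule free_vars_bound)
  then have "Comb sg k (\<lambda>v. term_val N v s < term_val N v t)"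
    unfolding r(1) using FRel ts by (intro Comb_less aff_term_val assms(1,2)) auto
  then show ?case by (auto simp: r ts)
next
  case (FNot p)
  then show ?case by (auto intro: comb_not)
next
  case (FAnd p q)
  then obtain k l where "Comb sg k (\<lambda>v. satisfies N v p)" "Comb sg l (\<lambda>v. satisfies N v q)" by auto
  then have "Comb sg (max k l) (\<lambda>v. satisfies N v p \<and> satisfies N v q)"
    by (intro comb_and Comb_mono [of _ k _ "max k l"] Comb_mono [of _ l _ "max k l"]) auto
  then show ?case by auto
next
  case (FEx i p)
  then obtain k where "Comb sg k (\<lambda>v. satisfies N v p)" by auto
  then have "Comb sg k (\<lambda>v. \<exists>x. satisfies N (v(i := x)) p)" by (rule Comb_ex [OF sg])
  then show ?case by auto
qed

lemma Def_Comb: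
  fixes N :: "('a, group_symbol, 's) fo_structure"
  assumes "fun_syms N = {(PlusSym, 2)}" "fun_int N = (\<lambda>_ xs. xs ! 0 + xs ! 1)"
    and rel: "\<And>r n. (r, n) \<in> rel_syms N \<Longrightarrow> sg = sgn3 \<and> n = 2 \<and> rel_int N r = (\<lambda>xs. xs ! 0 < xs ! 1)"
    and sg: "sg \<in> signs" and "Def N P"
  shows "\<exists>k. Comb sg k P"
proof -
  from assms(5) obtain p c where p: "wf_formula N p" "\<And>v. P v = satisfies N (mix v c) p"
    unfolding Def_def by blast
  obtain k where "Comb sg k (\<lambda>v. satisfies N v p)"
    using Comb_satisfies [OF assms(1-4) p(1)] by blast
  then have "Comb sg k (\<lambda>v. satisfies N (\<lambda>i. mix v c i) p)"
  proof (rule Comb_subst)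
    fix i assume "i < k"
    then show "aff k (\<lambda>v. mix v c i)" by (cases "even i") (auto simp: mix_def intro: aff_var)
  qed
  moreover have "P = (\<lambda>v. satisfies N (\<lambda>i. mix v c i) p)" using p(2) by (simp add: fun_eq_iff)
  ultimately show ?thesis by auto
qed

lemma Def_ordered_Comb:
  "Def (ordered_group_structure :: ('a, group_symbol, order_symbol) fo_structure) P \<Longrightarrow> \<exists>k. Comb sgn3 k P"
  by (rule Def_Comb [where N = ordered_group_structure]) (auto simp: ordered_group_structure_def)

lemma Def_group_Comb:
  "Def (group_structure :: ('a, group_symbol, order_symbol) fo_structure) P \<Longrightarrow> \<exists>k. Comb zt k P"
  by (rule Def_Comb [where N = group_structure]) (auto simp: group_structure_def)

end


section \<open>Order patterns in unary semilinear sets\<close>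

text \<open>
  Initial segments with end point in the divisible hull.
\<close>

definition cut :: "'a::linordered_ab_group_add set \<Rightarrow> bool" where
  "cut L \<longleftrightarrow> (\<exists>m b. 1 \<le> m \<and> (L = {x. zmul m x < b} \<or> L = {x. zmul m x \<le> b}))"

lemma cut_down: "cut L \<Longrightarrow> y \<in> L \<Longrightarrow> x \<le> y \<Longrightarrow> x \<in> L"
proof -
  assume "cut L" "y \<in> L" "x \<le> y"
  then obtain m b where m: "1 \<le> m" and L: "L = {x. zmul m x < b} \<or> L = {x. zmul m x \<le> b}"
    unfolding cut_def by blast
  have "zmul m x \<le> zmul m y" using m \<open>x \<le> y\<close> by (simp add: zmul_le_iff)
  then show ?thesis using L \<open>y \<in> L\<close> by auto
qed

context regular_group
begin

lemma discrete_cut: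
  assumes "\<not> dense" "cut (L :: 'a set)"
  obtains l where "L = {..l}"
proof -
  from assms(2) obtain m b where m: "1 \<le> m" and "L = {x. zmul m x < b} \<or> L = {x. zmul m x \<le> b}"
    unfolding cut_def by blast
  moreover have "u \<le> b \<longleftrightarrow> u < b + one" for u
    using discrete_one(1) [OF assms(1)] discrete_step [OF assms(1), of b u]
    by (metis less_add_same_cancel1 le_less_trans not_le)
  then have "{x. zmul m x \<le> b} = {x. zmul m x < b + one}" by simp
  ultimately obtain c where L: "L = {x. zmul m x < c}" by metis
  obtain y where y: "c - zmul m one \<le> zmul m y" "zmul m y < c"
    using regular [OF m discrete_one(1) [OF assms(1)], of "c - zmul m one"] by auto
  have "x \<in> L \<longleftrightarrow> x \<le> y" for x
  proof
    assume x: "x \<in> L"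
    show "x \<le> y"
    proof (rule ccontr)
      assume "\<not> x \<le> y"
      then have "zmul m (y + one) \<le> zmul m x"
        using m discrete_step [OF assms(1), of y x] by (simp add: zmul_le_iff)
      then have "c \<le> zmul m x" using y(1) by (simp add: zmul_add_right algebra_simps)
      then show False using x by (simp add: L)
    qed
  next
    assume "x \<le> y"
    then have "zmul m x \<le> zmul m y" using m by (simp add: zmul_le_iff)
    then show "x \<in> L" using y(2) by (simp add: L)
  qed
  then show thesis by (intro that [of y]) auto
qed

text \<open>
  At a cut where the set \<open>V\<close> switches from almost nothing to everything, a short enough
  progression across the cut sees the switch once. In a dense group the step is chosen so small that
  the progression stays clear of the finitely many exceptional points; in a discrete group the step is
  chosen larger than all finite distances of exceptional points from the cut.
\<close>

lemma order_pattern_at_cut: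
  fixes V L L' :: "'a set"
  assumes L: "cut L" and fin: "finite (V \<inter> L)" and L': "\<And>x y. y \<in> L' \<Longrightarrow> x \<le> y \<Longrightarrow> x \<in> L'"
    and inf: "infinite (L' - L)" and V: "L' - L \<subseteq> V"
  shows "\<exists>a g. \<forall>i. \<bar>i\<bar> \<le> int k \<longrightarrow> (a + zmul i g \<in> V \<longleftrightarrow> 1 \<le> i)"
proof (cases dense)
  case True
  from L obtain m b where m: "1 \<le> m" and Lm: "L = {x. zmul m x < b} \<or> L = {x. zmul m x \<le> b}"
    unfolding cut_def by blast
  have below: "x \<in> L" if "zmul m x < b" for x using Lm that by auto
  have above: "x \<notin> L" if "b < zmul m x" for x using Lm that by auto
  have "\<exists>y\<in>L' - L. b < zmul m y"
  proof (rule ccontr)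
    assume "\<not> (\<exists>y\<in>L' - L. b < zmul m y)"
    then have *: "zmul m y = b" if "y \<in> L' - L" for y
      using that below by (meson DiffD2 linorder_cases)
    obtain y where y: "y \<in> L' - L" using inf by (metis ex_in_conv finite.emptyI)
    have "L' - L \<subseteq> {y}"
    proof
      fix x assume "x \<in> L' - L"
      then show "x \<in> {y}" using * [of x] * [OF y] m zmul_eq_iff [of m x y] by auto
    qed
    then show False using inf finite_subset by blast
  qed
  then obtain y0 where y0: "y0 \<in> L'" "y0 \<notin> L" "b < zmul m y0" by blast
  \<comment> \<open>\<open>D\<close> collects the \<open>m\<close>-fold distances from the cut that the progression must not exceed\<close>
  define D where "D = insert (zmul m y0 - b) ((\<lambda>f. b - zmul m f) ` {f \<in> V \<inter> L. zmul m f < b})"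
  have "finite {f \<in> V \<inter> L. zmul m f < b}" by (rule finite_subset [OF _ fin]) auto
  then have D: "finite D" "D \<noteq> {}" unfolding D_def by (simp_all del: Int_iff)
  have "0 < Min D" using y0(3) D by (auto simp: D_def)
  then obtain g where g: "0 < g" "zmul (int (nat (m * (2 * int k + 2)))) g < Min D"
    using dense_small [OF True] by blast
  have g2: "zmul (m * (2 * int k + 2)) g < Min D"
    using g(2) m by simp
  obtain a where a: "b - zmul m g \<le> zmul m a" "zmul m a < b"
    using regular [OF m g(1), of "b - zmul m g"] by auto
  have p: "zmul m (a + zmul i (g + g)) = zmul m a + zmul (2 * i * m) g" for i
  proof -
    have "zmul m (zmul i (g + g)) = zmul (m * i + m * i) g"
      by (simp only: zmul_add_right zmul_add_left zmul_zmul)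
    then show ?thesis by (simp add: zmul_add_right algebra_simps)
  qed
  \<comment> \<open>the step is \<open>g + g\<close> because \<open>a + g\<close> may be the end point of the cut itself\<close>
  have "a + zmul i (g + g) \<in> V \<longleftrightarrow> 1 \<le> i" if i: "\<bar>i\<bar> \<le> int k" for i
  proof (cases "1 \<le> i")
    case True
    have "1 * m \<le> i * m" by (rule mult_right_mono) (use True m in auto)
    then have "m < 2 * i * m" using m by simp
    then have "zmul m g < zmul (2 * i * m) g" by (simp only: zmul_less_left [OF g(1)])
    then have "b < zmul m (a + zmul i (g + g))"
      unfolding p using add_le_less_mono [OF a(1)] by fastforce
    then have "a + zmul i (g + g) \<notin> L" by (rule above)
    have "i * m \<le> int k * m" by (rule mult_right_mono) (use i m in auto)
    moreover have "2 * i * m = 2 * (i * m)" "m * (2 * int k + 2) = 2 * (int k * m) + 2 * m"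
      by (simp_all add: algebra_simps)
    ultimately have "2 * i * m \<le> m * (2 * int k + 2)" using m by linarith
    then have "zmul (2 * i * m) g \<le> zmul (m * (2 * int k + 2)) g" by (simp only: zmul_le_left [OF g(1)])
    also have "\<dots> < Min D" by (rule g2)
    also have "\<dots> \<le> zmul m y0 - b" by (rule Min_le [OF D(1)]) (simp add: D_def)
    finally have "zmul m (a + zmul i (g + g)) < b + (zmul m y0 - b)"
      unfolding p using a(2) by (intro add_strict_mono)
    then have "zmul m (a + zmul i (g + g)) < zmul m y0" by simp
    then have "a + zmul i (g + g) \<le> y0" using m zmul_less_iff [of m "a + zmul i (g + g)" y0] by simp
    then show ?thesis using L' [OF y0(1)] \<open>a + zmul i (g + g) \<notin> L\<close> V True by blast
  next
    case False
    have "i * m \<le> 0 * m" by (rule mult_right_mono) (use False m in auto)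
    then have "zmul (2 * i * m) g \<le> zmul 0 g" by (simp only: zmul_le_left [OF g(1)])
    then have less: "zmul m (a + zmul i (g + g)) < b"
      unfolding p using add_less_le_mono [OF a(2)] by fastforce
    have "a + zmul i (g + g) \<notin> V"
    proof
      assume "a + zmul i (g + g) \<in> V"
      then have "b - zmul m (a + zmul i (g + g)) \<in> D"
        using below less unfolding D_def by blast
      then have "Min D \<le> b - zmul m (a + zmul i (g + g))" by (rule Min_le [OF D(1)])
      also have "\<dots> = (b - zmul m a) - zmul (2 * i * m) g" unfolding p by simp
      also have "\<dots> \<le> zmul m g - zmul (2 * i * m) g"
        using a(1) by (intro diff_right_mono) (simp add: algebra_simps)
      also have "\<dots> = zmul (m - 2 * i * m) g" by (simp add: zm.scale_left_diff_distrib)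
      also have "\<dots> \<le> zmul (m * (2 * int k + 2)) g"
      proof -
        have "- i * m \<le> int k * m" by (rule mult_right_mono) (use i m in auto)
        moreover have "2 * i * m = - (2 * (- i * m))" "m * (2 * int k + 2) = 2 * (int k * m) + 2 * m"
          by (simp_all add: algebra_simps)
        ultimately have "m - 2 * i * m \<le> m * (2 * int k + 2)" using m by linarith
        then show ?thesis by (simp only: zmul_le_left [OF g(1)])
      qed
      finally show False using g2 by simp
    qed
    then show ?thesis using False by simp
  qed
  then show ?thesis by blast
next
  case False
  obtain l where l: "L = {..l}" using discrete_cut [OF False L] .
  have one: "0 < one" by (rule discrete_one [OF False])
  have "inj (\<lambda>n. l - zmul (int n) one)"
    by (rule injI) (simp add: zmul_eq_left [OF one])
  then have "finite ((\<lambda>n. l - zmul (int n) one) -` (V \<inter> L))"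
    by (intro finite_vimageI fin)
  then obtain j where j: "\<forall>n\<in>(\<lambda>n. l - zmul (int n) one) -` (V \<inter> L). n < j"
    using finite_nat_set_iff_bounded by blast
  have low: "l - zmul (int n) one \<notin> V" if "j \<le> n" for n
  proof
    assume "l - zmul (int n) one \<in> V"
    moreover have "l - zmul (int n) one \<in> L"
      using zmul_le_left [OF one, of 0 "int n"] by (simp add: l)
    ultimately have "n < j" using j by (metis IntI vimageI)
    then show False using that by simp
  qed
  have high: "l + zmul (int n) one \<in> V" if "0 < n" for n
  proof -
    have pos: "0 < zmul (int n) one" using that one by (intro zmul_pos) auto
    have "l + zmul (int n) one \<in> L'"
    proof (rule ccontr)
      assume *: "l + zmul (int n) one \<notin> L'"
      have "L' - L \<subseteq> (\<lambda>j. l + zmul (int j) one) ` {..n}"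
      proof
        fix x assume x: "x \<in> L' - L"
        then have "\<not> l + zmul (int n) one \<le> x" using L' * by blast
        then have "0 \<le> x - l" "x - l \<le> zmul (int n) one" using x by (auto simp: l algebra_simps)
        then obtain j where "j \<le> n" "x - l = zmul (int j) one" using discrete_multiple [OF False] by blast
        then show "x \<in> (\<lambda>j. l + zmul (int j) one) ` {..n}"
          by (intro image_eqI [of _ _ j]) (auto simp: algebra_simps)
      qed
      then show False using inf finite_subset by blast
    qed
    moreover have "l + zmul (int n) one \<notin> L" using pos by (simp add: l)
    ultimately show ?thesis using V by blast
  qed
  have "(l - zmul (int j) one) + zmul i (zmul (int j + 1) one) \<in> V \<longleftrightarrow> 1 \<le> i" for i
  proof -
    have eq: "(l - zmul (int j) one) + zmul i (zmul (int j + 1) one) = l + zmul (i * (int j + 1) - int j) one"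
      by (simp add: zmul_zmul zm.scale_left_diff_distrib)
    show ?thesis
    proof (cases "1 \<le> i")
      case True
      have "int j + 1 \<le> i * (int j + 1)" using mult_right_mono [of 1 i "int j + 1"] True by simp
      then have "0 < i * (int j + 1) - int j" by linarith
      then obtain n where n: "i * (int j + 1) - int j = int n" "0 < n"
        by (metis zero_less_imp_eq_int)
      show ?thesis unfolding eq n(1) using True high [OF n(2)] by simp
    next
      case False
      have "i * (int j + 1) \<le> 0" using mult_right_mono [of i 0 "int j + 1"] False by simp
      then have "int j \<le> - (i * (int j + 1) - int j)" by linarith
      moreover define n where "n = nat (- (i * (int j + 1) - int j))"
      ultimately have n: "- (i * (int j + 1) - int j) = int n" "j \<le> n" by linarith+
      then have n': "i * (int j + 1) - int j = - int n" by linarith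
      show ?thesis unfolding eq n' using False low [OF n(2)] by (simp add: zm.scale_minus_left)
    qed
  qed
  then show ?thesis by blast
qed

text \<open>
  The finitely many cuts form a chain. A minimal cut \<open>L'\<close> for which \<open>U \<inter> L'\<close> and \<open>L' - U\<close> are
  both infinite has a predecessor \<open>L\<close> without this property, and membership in \<open>U\<close> is constant on
  \<open>L' - L\<close>. So \<open>U\<close> or its complement switches at \<open>L\<close>.
\<close>

lemma order_pattern:
  fixes U :: "'a set"
  assumes fin: "finite \<L>" and cuts: "\<And>L. L \<in> \<L> \<Longrightarrow> cut L"
    and det: "\<And>x y. (\<And>L. L \<in> \<L> \<Longrightarrow> x \<in> L \<longleftrightarrow> y \<in> L) \<Longrightarrow> x \<in> U \<longleftrightarrow> y \<in> U"
    and inf: "infinite U" "infinite (- U)"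
  shows "\<exists>a g. \<forall>i. \<bar>i\<bar> \<le> int k \<longrightarrow> (a + zmul i g \<in> U \<longleftrightarrow> i \<le> 0)"
proof -
  define \<M> where "\<M> = insert {} (insert UNIV \<L>)"
  have down: "x \<in> L" if "L \<in> \<M>" "y \<in> L" "x \<le> y" for x y L
    using that cut_down [OF cuts] by (auto simp: \<M>_def)
  have chain: "L \<subseteq> L' \<or> L' \<subseteq> L" if "L \<in> \<M>" "L' \<in> \<M>" for L L'
  proof (rule ccontr)
    assume "\<not> (L \<subseteq> L' \<or> L' \<subseteq> L)"
    then obtain x y where "x \<in> L" "x \<notin> L'" "y \<in> L'" "y \<notin> L" by blast
    then show False using down [OF that(1), of x y] down [OF that(2), of y x] by (metis linear)
  qed
  define bad where "bad L \<longleftrightarrow> infinite (U \<inter> L) \<and> infinite (L - U)" for L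
  have "bad UNIV" using inf by (simp add: bad_def Compl_eq_Diff_UNIV)
  then have "{L \<in> \<M>. bad L} \<noteq> {}" by (auto simp: \<M>_def)
  moreover have "finite {L \<in> \<M>. bad L}" using fin by (simp add: \<M>_def)
  ultimately obtain L' where L': "L' \<in> \<M>" "bad L'" "\<And>L. L \<in> \<M> \<Longrightarrow> bad L \<Longrightarrow> L \<subseteq> L' \<Longrightarrow> L = L'"
    using finite_has_minimal [of "{L \<in> \<M>. bad L}"] by auto
  define \<P> where "\<P> = {L \<in> \<M>. L \<subset> L'}"
  have "{} \<in> \<P>" using L'(2) by (auto simp: \<P>_def \<M>_def bad_def)
  moreover have "finite \<P>" using fin by (simp add: \<P>_def \<M>_def)
  ultimately obtain L where L: "L \<in> \<P>" "\<And>K. K \<in> \<P> \<Longrightarrow> L \<subseteq> K \<Longrightarrow> L = K"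
    using finite_has_maximal [of \<P>] by blast
  have LM: "L \<in> \<M>" "L \<subset> L'" using L(1) by (auto simp: \<P>_def)
  have mono: "x \<in> U \<longleftrightarrow> y \<in> U" if "x \<in> L' - L" "y \<in> L' - L" for x y
  proof (rule det)
    fix K assume "K \<in> \<L>"
    then have K: "K \<in> \<M>" by (simp add: \<M>_def)
    show "x \<in> K \<longleftrightarrow> y \<in> K"
    proof (cases "K \<subset> L'")
      case True
      then have "K \<subseteq> L" using chain [OF K LM(1)] L(2) [of K] K by (auto simp: \<P>_def)
      then show ?thesis using that by blast
    next
      case False
      then have "L' \<subseteq> K" using chain [OF K L'(1)] by blast
      then show ?thesis using that by blast
    qed
  qed
  have good: "\<not> bad L" using L'(3) [OF LM(1)] LM(2) by blast
  have main: "\<exists>a g. \<forall>i. \<bar>i\<bar> \<le> int l \<longrightarrow> (a + zmul i g \<in> V \<longleftrightarrow> 1 \<le> i)"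
    if V: "L' - L \<subseteq> V" and VL: "finite (V \<inter> L) \<or> finite (L - V)"
      and bad: "infinite (V \<inter> L')" "infinite (L' - V)" for V l
  proof (rule order_pattern_at_cut)
    have "L' - V \<subseteq> L - V" using V by blast
    then have infLV: "infinite (L - V)" using bad(2) finite_subset by blast
    then show fVL: "finite (V \<inter> L)" using VL by blast
    have "L \<noteq> {}" using infLV by auto
    then show "cut L" using LM cuts by (auto simp: \<M>_def)
    show "x \<in> L'" if "y \<in> L'" "x \<le> y" for x y using down [OF L'(1)] that by blast
    have "V \<inter> L' \<subseteq> (V \<inter> L) \<union> (L' - L)" by blast
    then show "infinite (L' - L)" using bad(1) fVL by (meson finite_Un finite_subset)
  qed (rule V)
  show ?thesis
  proof (cases "L' - L \<subseteq> U")
    case True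
    have "\<exists>a g. \<forall>i. \<bar>i\<bar> \<le> int (Suc k) \<longrightarrow> (a + zmul i g \<in> U \<longleftrightarrow> 1 \<le> i)"
      using True good L'(2) by (intro main) (auto simp: bad_def)
    then obtain a g where ag: "\<And>i. \<bar>i\<bar> \<le> int (Suc k) \<Longrightarrow> a + zmul i g \<in> U \<longleftrightarrow> 1 \<le> i" by blast
    \<comment> \<open>the progression is read backwards, starting one step later\<close>
    have "(a + g) + zmul i (- g) \<in> U \<longleftrightarrow> i \<le> 0" if "\<bar>i\<bar> \<le> int k" for i
    proof -
      have "(a + g) + zmul i (- g) = a + zmul (1 - i) g"
        by (simp add: zmul_minus_right zm.scale_left_diff_distrib)
      then show ?thesis unfolding \<open>(a + g) + zmul i (- g) = a + zmul (1 - i) g\<close> using ag [of "1 - i"] that by simp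
    qed
    then show ?thesis by blast
  next
    case False
    then have sub: "L' - L \<subseteq> - U" using mono by blast
    have "- U \<inter> L = L - U" "L - - U = U \<inter> L" "- U \<inter> L' = L' - U" "L' - - U = U \<inter> L'" by auto
    then have "\<exists>a g. \<forall>i. \<bar>i\<bar> \<le> int k \<longrightarrow> (a + zmul i g \<in> - U \<longleftrightarrow> 1 \<le> i)"
      using sub good L'(2) by (intro main) (auto simp: bad_def)
    then obtain a g where ag: "\<And>i. \<bar>i\<bar> \<le> int k \<Longrightarrow> a + zmul i g \<in> - U \<longleftrightarrow> 1 \<le> i" by blast
    have "a + zmul i g \<in> U \<longleftrightarrow> i \<le> 0" if "\<bar>i\<bar> \<le> int k" for i
      using ag [OF that] by auto
    then show ?thesis by blast
  qed
qed

lemma comb_cuts_affine: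
  assumes "aff 1 h"
  shows "comb {\<lambda>x. x \<in> L | L. cut L} (\<lambda>x::'a. sgn3 (h (\<lambda>_. x)) = s)"
proof -
  let ?C = "{\<lambda>x. x \<in> L | L. cut L} :: ('a \<Rightarrow> bool) set"
  obtain a b where h: "h = affine_fun 1 a b" using assms by (auto simp: aff_def)
  have hx: "h (\<lambda>_. x) = b + zmul (a 0) x" for x by (simp add: h affine_fun_def)
  have c1: "comb ?C (\<lambda>x. zmul m x < c)" if "1 \<le> m" for m c
    using that by (intro comb_atom) (auto simp: cut_def intro!: exI [of _ "{x. zmul m x < c}"])
  have c2: "comb ?C (\<lambda>x. zmul m x \<le> c)" if "1 \<le> m" for m c
    using that by (intro comb_atom) (auto simp: cut_def intro!: exI [of _ "{x. zmul m x \<le> c}"])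
  have "comb ?C (\<lambda>x. b + zmul (a 0) x < 0) \<and> comb ?C (\<lambda>x. 0 < b + zmul (a 0) x)"
  proof (cases "a 0" "0::int" rule: linorder_cases)
    case less
    have "(\<lambda>x. b + zmul (a 0) x < 0) = (\<lambda>x. \<not> zmul (- a 0) x \<le> b)"
      "(\<lambda>x. 0 < b + zmul (a 0) x) = (\<lambda>x. zmul (- a 0) x < b)"
      unfolding fun_eq_iff
      using less_diff_eq [of b 0 "zmul (a 0) x" for x] diff_less_eq [of 0 "zmul (a 0) x" b for x]
      by (auto simp: zm.scale_minus_left not_le)
    then show ?thesis
      using less comb_not [OF c2 [of "- a 0" b]] c1 [of "- a 0" b] by simp
  next
    case equal
    then show ?thesis by (simp add: comb_const)
  next
    case greater
    have "b + zmul (a 0) x < 0 \<longleftrightarrow> zmul (a 0) x < - b" "0 < b + zmul (a 0) x \<longleftrightarrow> \<not> zmul (a 0) x \<le> - b" for x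
      using less_diff_eq [of "zmul (a 0) x" 0 b] diff_less_eq [of 0 b "zmul (a 0) x"]
      by (auto simp: add.commute not_le)
    then show ?thesis using greater by (simp add: comb_not c1 c2)
  qed
  then have c: "comb ?C (\<lambda>x. h (\<lambda>_. x) < 0)" "comb ?C (\<lambda>x. 0 < h (\<lambda>_. x))" by (simp_all add: hx)
  have "sgn3 y = s \<longleftrightarrow> (s = - 1 \<and> y < 0) \<or> (s = 0 \<and> \<not> y < 0 \<and> \<not> 0 < y) \<or> (s = 1 \<and> 0 < y)" for y :: 'a
    by (auto simp: sgn3_def)
  then show ?thesis by (simp only:) (intro comb_or comb_and comb_not comb_const c)
qed

lemma semilinear_order_pattern:
  assumes P: "comb (sign_atoms sgn3 1) P"
    and inf: "infinite {x::'a. P (\<lambda>_. x)}" "infinite {x::'a. \<not> P (\<lambda>_. x)}"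
  shows "\<exists>a g. \<forall>i. \<bar>i\<bar> \<le> int k \<longrightarrow> (P (\<lambda>_. a + zmul i g) \<longleftrightarrow> i \<le> 0)"
proof -
  have "comb {\<lambda>x. x \<in> L | L. cut L} (\<lambda>x::'a. P (\<lambda>_. x))"
    by (rule comb_subst [OF P]) (auto simp: sign_atoms_def intro: comb_cuts_affine)
  then obtain F where F: "finite F" "F \<subseteq> {\<lambda>x. x \<in> L | L. cut L}" "determined F (\<lambda>x::'a. P (\<lambda>_. x))"
    unfolding comb_def by blast
  have "\<exists>a g. \<forall>i. \<bar>i\<bar> \<le> int k \<longrightarrow> (a + zmul i g \<in> {x. P (\<lambda>_. x)} \<longleftrightarrow> i \<le> 0)"
  proof (rule order_pattern)
    show "finite (Collect ` F)" using F(1) by simp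
    show "cut L" if "L \<in> Collect ` F" for L using that F(2) by auto
    show "infinite {x::'a. P (\<lambda>_. x)}" "infinite (- {x::'a. P (\<lambda>_. x)})"
      using inf by (simp_all add: Collect_neg_eq)
    fix x y assume xy: "\<And>L. L \<in> Collect ` F \<Longrightarrow> x \<in> L \<longleftrightarrow> y \<in> L"
    have "P (\<lambda>_. x) = P (\<lambda>_. y)"
    proof (rule determinedD [OF F(3)])
      fix A assume "A \<in> F"
      then show "A x = A y" using xy [of "Collect A"] by simp
    qed
    then show "x \<in> {x. P (\<lambda>_. x)} \<longleftrightarrow> y \<in> {x. P (\<lambda>_. x)}" by simp
  qed
  then show ?thesis by simp
qed

end


section \<open>Linear relations have no long orders\<close>

text \<open>
  Relations of the form \<open>f i = g j\<close>, described without the functions.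
\<close>

definition difunctional :: "('i \<Rightarrow> 'j \<Rightarrow> bool) \<Rightarrow> bool" where
  "difunctional E \<longleftrightarrow> (\<forall>i j i' j'. E i j \<and> E i' j \<and> E i j' \<longrightarrow> E i' j')"

lemma difunctionalD: "difunctional E \<Longrightarrow> E i j \<Longrightarrow> E i' j \<Longrightarrow> E i j' \<Longrightarrow> E i' j'"
  unfolding difunctional_def by blast

text \<open>
  By Ramsey's theorem a long ordered sequence has four indices \<open>p < q < r < s\<close> on which each
  relation depends only on the order of the indices. For a difunctional relation its values on
  increasing and on decreasing pairs then agree, so the combination cannot tell \<open>(q, r)\<close> from \<open>(r, q)\<close>.
\<close>

lemma difunctional_order_bound:
  fixes R :: "'i \<Rightarrow> 'j \<Rightarrow> bool" and E :: "'e \<Rightarrow> 'i \<Rightarrow> 'j \<Rightarrow> bool"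
  assumes fin: "finite F"
    and dif: "\<And>e. e \<in> F \<Longrightarrow> difunctional (E e)"
    and det: "\<And>x y x' y'. (\<And>e. e \<in> F \<Longrightarrow> E e x y \<longleftrightarrow> E e x' y') \<Longrightarrow> R x y \<longleftrightarrow> R x' y'"
  shows "\<exists>k::nat. \<not> (\<exists>x y. \<forall>i<k. \<forall>j<k. R (x i) (y j) \<longleftrightarrow> i \<le> j)"
proof -
  let ?C = "Pow F \<times> Pow F"
  have "finite ?C" using fin by simp
  then obtain \<phi> where \<phi>: "bij_betw \<phi> ?C {0..<card ?C}" using ex_bij_betw_finite_nat by blast
  obtain N :: nat where N: "partn_lst {..<N} (replicate (card ?C) 4) 2" using ramsey_full by blast
  show ?thesis
  proof (rule exI [of _ N], rule notI, elim exE)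
    fix x y assume xy: "\<forall>i<N. \<forall>j<N. R (x i) (y j) \<longleftrightarrow> i \<le> j"
    \<comment> \<open>the colour of a pair records all relations in both orders\<close>
    define col where "col i j = ({e \<in> F. E e (x i) (y j)}, {e \<in> F. E e (x j) (y i)})" for i j
    define f where "f S = \<phi> (col (Min S) (Max S))" for S
    have "col i j \<in> ?C" for i j by (auto simp: col_def)
    then have "f \<in> nsets {..<N} 2 \<rightarrow> {..<card ?C}"
      using \<phi> unfolding f_def by (auto simp: bij_betw_def)
    from partn_lstE [OF N this] obtain c H where H: "H \<in> nsets {..<N} 4" "f ` nsets H 2 \<subseteq> {c}"
      by (auto simp del: replicate.simps) (metis nth_replicate)
    obtain p q r s where pqrs: "H = {p, q, r, s}" "p < q" "q < r" "r < s" "s < N"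
      using H(1) unfolding ordered_nsets_4_eq by (auto simp: lessThan_def)
    have f: "f {i, j} = c" if "i \<in> H" "j \<in> H" "i < j" for i j
    proof -
      have "{i, j} \<in> nsets H 2" using that by simp
      then show ?thesis using H(2) by blast
    qed
    have fcol: "f {i, j} = \<phi> (col i j)" if "i < j" for i j
      using that by (simp add: f_def)
    have same: "col i j = col p q" if "i \<in> H" "j \<in> H" "i < j" for i j
    proof (rule inj_onD [OF bij_betw_imp_inj_on [OF \<phi>]])
      show "\<phi> (col i j) = \<phi> (col p q)"
        using f [OF that] f [of p q] fcol [OF that(3)] fcol [OF pqrs(2)] pqrs by simp
    qed fact+
    have up: "E e (x i) (y j) \<longleftrightarrow> E e (x p) (y q)" and down: "E e (x j) (y i) \<longleftrightarrow> E e (x q) (y p)"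
      if "i \<in> H" "j \<in> H" "i < j" "e \<in> F" for i j e
      using same [OF that(1-3)] that(4) unfolding col_def by auto
    have mem: "p \<in> H" "q \<in> H" "r \<in> H" "s \<in> H" using pqrs by auto
    have lt: "p < r" "p < s" "q < s" using pqrs by auto
    note lt = lt pqrs(2-4)
    have "E e (x q) (y r) \<longleftrightarrow> E e (x r) (y q)" if e: "e \<in> F" for e
    proof
      assume "E e (x q) (y r)"
      then have "E e (x p) (y q)" using up [OF mem(2,3) lt(5) e] by simp
      then have "E e (x p) (y s)" "E e (x r) (y s)" "E e (x p) (y q)"
        using up [OF mem(1,4) lt(2) e] up [OF mem(3,4) lt(6) e] by simp_all
      then show "E e (x r) (y q)" by (rule difunctionalD [OF dif [OF e]])
    next
      assume "E e (x r) (y q)"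
      then have "E e (x q) (y p)" using down [OF mem(2,3) lt(5) e] by simp
      then have "E e (x s) (y p)" "E e (x q) (y p)" "E e (x s) (y r)"
        using down [OF mem(1,4) lt(2) e] down [OF mem(3,4) lt(6) e] by simp_all
      then show "E e (x q) (y r)" by (rule difunctionalD [OF dif [OF e]])
    qed
    then have "R (x q) (y r) \<longleftrightarrow> R (x r) (y q)" by (rule det)
    then show False using xy pqrs by auto
  qed
qed

lemma aff_plus:
  assumes "aff k h"
  shows "h (\<lambda>i. v i + w i) = h v + h w - h (\<lambda>_. 0)"
proof -
  from assms obtain a b where h: "h = affine_fun k a b" by (auto simp: aff_def)
  show ?thesis
    by (simp add: h affine_fun_def zmul_add_right sum.distrib)
qed

text \<open>
  An equation or congruence in two groups of variables separates into a part for each group, hence is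
  difunctional or the negation of a difunctional relation.
\<close>

lemma linear_order_bound:
  fixes P :: "(nat \<Rightarrow> 'a::linordered_ab_group_add) \<Rightarrow> bool"
  assumes P: "Comb zt k P"
  shows "\<exists>l::nat. \<not> (\<exists>x y. \<forall>i<l. \<forall>j<l. P (\<lambda>n. if n < m then x i n else y j (n - m)) \<longleftrightarrow> i \<le> j)"
proof -
  obtain F where F: "finite F" "F \<subseteq> sign_atoms zt k \<union> cong_atoms k" "determined F P"
    using P unfolding comb_def by blast
  define glue where "glue x y n = (if n < m then x n else y (n - m))" for x y :: "nat \<Rightarrow> 'a" and n
  have split: "\<exists>f g. \<forall>x y. h (glue x y) = f x + g y" if "aff k h" for h
  proof -
    have "h (glue x y) = h (glue x (\<lambda>_. 0)) + (h (glue (\<lambda>_. 0) y) - h (\<lambda>_. 0))" for x y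
    proof -
      have "glue x y = (\<lambda>i. glue x (\<lambda>_. 0) i + glue (\<lambda>_. 0) y i)" by (auto simp: glue_def)
      then have "h (glue x y) = h (\<lambda>i. glue x (\<lambda>_. 0) i + glue (\<lambda>_. 0) y i)" by (rule arg_cong)
      also have "\<dots> = h (glue x (\<lambda>_. 0)) + h (glue (\<lambda>_. 0) y) - h (\<lambda>_. 0)"
        by (rule aff_plus [OF that])
      finally show ?thesis by simp
    qed
    then show ?thesis
      by (intro exI [of _ "\<lambda>x. h (glue x (\<lambda>_. 0))"] exI [of _ "\<lambda>y. h (glue (\<lambda>_. 0) y) - h (\<lambda>_. 0)"] allI)
  qed
  have dif: "\<exists>E. difunctional E \<and> (\<forall>x y x' y'. (E x y \<longleftrightarrow> E x' y') \<longrightarrow> (A (glue x y) \<longleftrightarrow> A (glue x' y')))"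
    if "A \<in> F" for A
  proof -
    from that F(2) consider h s where "A = (\<lambda>v. zt (h v) = s)" "aff k h"
      | h n where "A = (\<lambda>v. \<exists>y. h v = zmul n y)" "aff k h"
      unfolding sign_atoms_def cong_atoms_def by blast
    then show ?thesis
    proof cases
      case 1
      obtain f g where fg: "\<And>x y. h (glue x y) = f x + g y" using split [OF 1(2)] by blast
      have "difunctional (\<lambda>x y. f x + g y = 0)"
        unfolding difunctional_def by (metis add_left_cancel add_right_cancel)
      then show ?thesis
        by (intro exI [of _ "\<lambda>x y. f x + g y = 0"]) (auto simp: 1(1) fg zt_def)
    next
      case 2
      obtain f g where fg: "\<And>x y. h (glue x y) = f x + g y" using split [OF 2(2)] by blast
      have "difunctional (\<lambda>x y. \<exists>z. f x + g y = zmul n z)"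
        unfolding difunctional_def
      proof (intro allI impI, elim conjE exE)
        fix x y x' y' z1 z2 z3
        assume "f x + g y = zmul n z1" "f x' + g y = zmul n z2" "f x + g y' = zmul n z3"
        moreover have "f x' + g y' = (f x' + g y) + (f x + g y') - (f x + g y)" by simp
        ultimately have "f x' + g y' = zmul n (z2 + z3 - z1)"
          by (simp only: zm.scale_right_distrib zm.scale_right_diff_distrib)
        then show "\<exists>z. f x' + g y' = zmul n z" by blast
      qed
      then show ?thesis
        by (intro exI [of _ "\<lambda>x y. \<exists>z. f x + g y = zmul n z"]) (auto simp: 2(1) fg)
    qed
  qed
  then have "\<forall>A\<in>F. \<exists>E. difunctional E \<and> (\<forall>x y x' y'. (E x y \<longleftrightarrow> E x' y') \<longrightarrow> (A (glue x y) \<longleftrightarrow> A (glue x' y')))"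
    by blast
  then obtain E where E: "\<forall>A\<in>F. difunctional (E A) \<and>
      (\<forall>x y x' y'. (E A x y \<longleftrightarrow> E A x' y') \<longrightarrow> (A (glue x y) \<longleftrightarrow> A (glue x' y')))"
    by (rule bchoice [THEN exE])
  have "\<exists>l::nat. \<not> (\<exists>x y. \<forall>i<l. \<forall>j<l. P (glue (x i) (y j)) \<longleftrightarrow> i \<le> j)"
  proof (rule difunctional_order_bound [OF F(1), of E])
    show "difunctional (E e)" if "e \<in> F" for e using E that by blast
    fix x y x' y' assume *: "\<And>e. e \<in> F \<Longrightarrow> E e x y \<longleftrightarrow> E e x' y'"
    show "P (glue x y) \<longleftrightarrow> P (glue x' y')"
    proof (rule determinedD [OF F(3)])
      fix A assume A: "A \<in> F"
      show "A (glue x y) \<longleftrightarrow> A (glue x' y')" using bspec [OF E A] * [OF A] by blast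
    qed
  qed
  then show ?thesis by (simp add: glue_def [abs_def])
qed


section \<open>Semilinear sets of integer points with tame lines\<close>

lemma sgn_dominant:
  fixes b c s :: int
  assumes "\<bar>c\<bar> < s" "b \<noteq> 0"
  shows "sgn (c + s * b) = sgn b"
proof (cases "0 < b")
  case True
  have "s * 1 \<le> s * b" by (rule mult_left_mono) (use True assms in auto)
  then show ?thesis using True assms(1) by (simp add: sgn_if)
next
  case False
  have "s * 1 \<le> s * (- b)" by (rule mult_left_mono) (use False assms in auto)
  then have "c + s * b < 0" using assms by simp
  then show ?thesis using False assms by (simp add: sgn_if)
qed

text \<open>
  Absolute values are natural numbers, so a decreasing sequence of them is eventually constant, and
  every integer sequence has a subsequence of constant sign with growing absolute values.
\<close>

lemma monotone_subsequence:
  fixes x :: "nat \<Rightarrow> int"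
  shows "\<exists>r :: nat \<Rightarrow> nat. strict_mono r \<and> (\<forall>i j. i \<le> j \<longrightarrow> sgn (x (r i)) = sgn (x (r j)) \<and> \<bar>x (r i)\<bar> \<le> \<bar>x (r j)\<bar>)"
proof -
  have "\<exists>m\<in>UNIV. infinite {n \<in> UNIV. sgn (x n) = sgn (x m)}"
  proof (rule pigeonhole_infinite)
    have "range (\<lambda>n. sgn (x n)) \<subseteq> {-1, 0, 1}" by (auto simp: sgn_if)
    then show "finite (range (\<lambda>n. sgn (x n)))" by (rule finite_subset) simp
  qed auto
  then obtain c where c: "infinite {n. sgn (x n) = c}" by auto
  define p where "p = enumerate {n. sgn (x n) = c}"
  have p: "strict_mono p" "\<And>n. sgn (x (p n)) = c"
    using strict_mono_enumerate [OF c] enumerate_in_set [OF c] by (auto simp: p_def)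
  obtain q :: "nat \<Rightarrow> nat" where q: "strict_mono q" "monoseq (\<lambda>n. nat \<bar>x (p (q n))\<bar>)"
    using seq_monosub [of "\<lambda>n. nat \<bar>x (p n)\<bar>"] by auto
  have "\<exists>k. \<forall>i j. k \<le> i \<and> i \<le> j \<longrightarrow> nat \<bar>x (p (q i))\<bar> \<le> nat \<bar>x (p (q j))\<bar>"
  proof (cases "\<forall>m. \<forall>n\<ge>m. nat \<bar>x (p (q m))\<bar> \<le> nat \<bar>x (p (q n))\<bar>")
    case False
    then have dec: "\<And>m n. m \<le> n \<Longrightarrow> nat \<bar>x (p (q n))\<bar> \<le> nat \<bar>x (p (q m))\<bar>"
      using q(2) unfolding monoseq_def by blast
    define v where "v = (LEAST v. \<exists>n. nat \<bar>x (p (q n))\<bar> = v)"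
    have "\<exists>n. nat \<bar>x (p (q n))\<bar> = v" unfolding v_def by (rule LeastI_ex) blast
    then obtain k where k: "nat \<bar>x (p (q k))\<bar> = v" by blast
    have v: "v \<le> nat \<bar>x (p (q n))\<bar>" for n unfolding v_def by (rule Least_le) blast
    have "nat \<bar>x (p (q i))\<bar> \<le> nat \<bar>x (p (q j))\<bar>" if "k \<le> i" for i j
      using dec [OF that] v [of j] k by simp
    then show ?thesis by blast
  qed blast
  then obtain k where k: "\<And>i j. k \<le> i \<Longrightarrow> i \<le> j \<Longrightarrow> nat \<bar>x (p (q i))\<bar> \<le> nat \<bar>x (p (q j))\<bar>"
    by blast
  have "strict_mono (\<lambda>n. p (q (n + k)))"
    using p(1) q(1) by (simp add: strict_mono_def)
  moreover have "\<bar>x (p (q (i + k)))\<bar> \<le> \<bar>x (p (q (j + k)))\<bar>" if "i \<le> j" for i j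
    using k [of "i + k" "j + k"] that by simp
  ultimately show ?thesis using p(2) by (intro exI [of _ "\<lambda>n. p (q (n + k))"]) simp
qed

lemma monotone_subsequence_finite:
  fixes x :: "'e \<Rightarrow> nat \<Rightarrow> int"
  assumes "finite F"
  shows "\<exists>r :: nat \<Rightarrow> nat. strict_mono r \<and> (\<forall>e\<in>F. \<forall>i j. i \<le> j \<longrightarrow>
    sgn (x e (r i)) = sgn (x e (r j)) \<and> \<bar>x e (r i)\<bar> \<le> \<bar>x e (r j)\<bar>)"
  using assms
proof (induction F rule: finite_induct)
  case empty
  show ?case by (intro exI [of _ id]) (simp add: strict_mono_def)
next
  case (insert e F)
  then obtain r :: "nat \<Rightarrow> nat" where r: "strict_mono r" "\<And>d i j. d \<in> F \<Longrightarrow> i \<le> j \<Longrightarrow>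
    sgn (x d (r i)) = sgn (x d (r j)) \<and> \<bar>x d (r i)\<bar> \<le> \<bar>x d (r j)\<bar>" by blast
  obtain s :: "nat \<Rightarrow> nat" where s: "strict_mono s" "\<And>i j. i \<le> j \<Longrightarrow>
    sgn (x e (r (s i))) = sgn (x e (r (s j))) \<and> \<bar>x e (r (s i))\<bar> \<le> \<bar>x e (r (s j))\<bar>"
    using monotone_subsequence [of "\<lambda>n. x e (r n)"] by blast
  have "strict_mono (\<lambda>n. r (s n))" using r(1) s(1) by (simp add: strict_mono_def)
  moreover have "s i \<le> s j" if "i \<le> j" for i j using s(1) that by (simp add: strict_mono_less_eq)
  ultimately show ?case using r(2) s(2) by (intro exI [of _ "\<lambda>n. r (s n)"]) blast
qed

text \<open>
  The case of the integers, stated for abstract affine forms \<open>h e\<close> with linear parts \<open>lin e\<close>; the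
  vector \<open>d\<close> is the direction of the fibres.
\<close>

locale tame_lines =
  fixes F :: "'e set" and h lin :: "'e \<Rightarrow> (nat \<Rightarrow> int) \<Rightarrow> int" and W :: "(nat \<Rightarrow> int) \<Rightarrow> bool" and d :: "nat \<Rightarrow> int"
  assumes finite_forms: "finite F"
    and line: "\<And>e z u t. h e (\<lambda>i. z i + t * u i) = h e z + t * lin e u"
    and linear: "\<And>e p q u w. lin e (\<lambda>i. p * u i + q * w i) = p * lin e u + q * lin e w"
    and det: "\<And>f g. (\<And>e. e \<in> F \<Longrightarrow> sgn (h e f) = sgn (h e g)) \<Longrightarrow> W f \<longleftrightarrow> W g"
    and tame: "\<And>z u. finite {t. W (\<lambda>i. z i + t * u i)} \<or> finite {t. \<not> W (\<lambda>i. z i + t * u i)}"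
    and vertical: "\<And>z. finite {t. W (\<lambda>i. z i + t * d i)}"
begin

text \<open>
  The sign of \<open>h e\<close> at \<open>z + T w + s u\<close> when \<open>T\<close> is large and \<open>s\<close> is much larger still.
\<close>

definition lex_sign :: "(nat \<Rightarrow> int) \<Rightarrow> (nat \<Rightarrow> int) \<Rightarrow> (nat \<Rightarrow> int) \<Rightarrow> 'e \<Rightarrow> int" where
  "lex_sign z u w e =
    (if lin e u \<noteq> 0 then sgn (lin e u) else if lin e w \<noteq> 0 then sgn (lin e w) else sgn (h e z))"

text \<open>
  Membership in \<open>W\<close> at infinity in the direction \<open>u\<close>, slightly displaced towards \<open>w\<close>.
\<close>

definition germ :: "(nat \<Rightarrow> int) \<Rightarrow> (nat \<Rightarrow> int) \<Rightarrow> (nat \<Rightarrow> int) \<Rightarrow> bool" where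
  "germ z u w \<longleftrightarrow> (\<exists>f. W f \<and> (\<forall>e\<in>F. sgn (h e f) = lex_sign z u w e))"

lemma germ_iff: "(\<And>e. e \<in> F \<Longrightarrow> sgn (h e f) = lex_sign z u w e) \<Longrightarrow> W f \<longleftrightarrow> germ z u w"
  unfolding germ_def using det by metis

lemma germ_cong:
  assumes "\<And>e. e \<in> F \<Longrightarrow> lex_sign z u w e = lex_sign z' u' w' e"
  shows "germ z u w = germ z' u' w'"
  unfolding germ_def using assms by simp

lemma germ_reached:
  "\<exists>T0. \<forall>T\<ge>T0. \<exists>s0. \<forall>s\<ge>s0. W (\<lambda>i. (z i + T * w i) + s * u i) = germ z u w"
proof -
  define T0 where "T0 = 1 + (\<Sum>e\<in>F. \<bar>h e z\<bar>)"
  have "\<exists>s0. \<forall>s\<ge>s0. W (\<lambda>i. (z i + T * w i) + s * u i) = germ z u w" if T: "T \<ge> T0" for T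
  proof -
    define c where "c e = h e z + T * lin e w" for e
    have c: "h e (\<lambda>i. z i + T * w i) = c e" for e by (simp add: c_def line)
    define s0 where "s0 = 1 + (\<Sum>e\<in>F. \<bar>c e\<bar>)"
    have "W (\<lambda>i. (z i + T * w i) + s * u i) = germ z u w" if s: "s \<ge> s0" for s
    proof (rule germ_iff)
      fix e assume e: "e \<in> F"
      have "\<bar>h e z\<bar> \<le> (\<Sum>e\<in>F. \<bar>h e z\<bar>)" "\<bar>c e\<bar> \<le> (\<Sum>e\<in>F. \<bar>c e\<bar>)"
        using e finite_forms by (auto intro!: member_le_sum)
      then have "\<bar>h e z\<bar> < T" "\<bar>c e\<bar> < s" using T s by (auto simp: T0_def s0_def)
      then have "sgn (c e) = (if lin e w \<noteq> 0 then sgn (lin e w) else sgn (h e z))"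
        "lin e u \<noteq> 0 \<Longrightarrow> sgn (c e + s * lin e u) = sgn (lin e u)"
        using sgn_dominant by (auto simp: c_def)
      then show "sgn (h e (\<lambda>i. (z i + T * w i) + s * u i)) = lex_sign z u w e"
        by (simp add: line [of e "\<lambda>i. z i + T * w i"] c lex_sign_def)
    qed
    then show ?thesis by blast
  qed
  then show ?thesis by blast
qed

lemma infinite_int_up: "infinite {t::int. a \<le> t}"
proof
  assume "finite {t::int. a \<le> t}"
  then have "finite ((\<lambda>n. a + int n) ` UNIV)" by (rule finite_subset [rotated]) auto
  then show False by (simp add: finite_image_iff inj_def)
qed

lemma infinite_int_down: "infinite {t::int. t \<le> a}"
proof
  assume "finite {t::int. t \<le> a}"
  then have "finite (uminus ` {t::int. t \<le> a})" by simp
  moreover have "uminus ` {t::int. t \<le> a} = {t. - a \<le> t}"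
  proof (intro equalityI subsetI)
    fix t assume "t \<in> {t. - a \<le> t}"
    then show "t \<in> uminus ` {t. t \<le> a}" by (intro image_eqI [of _ _ "- t"]) auto
  qed auto
  ultimately show False using infinite_int_up by simp
qed

text \<open>
  The two ends of a line in direction \<open>u\<close> have the same status, since the line is finite or cofinite.
\<close>

lemma germ_line: "germ z u w = germ z (\<lambda>i. - u i) w"
proof -
  obtain T1 where T1: "\<forall>T\<ge>T1. \<exists>s0. \<forall>s\<ge>s0. W (\<lambda>i. (z i + T * w i) + s * u i) = germ z u w"
    using germ_reached by blast
  obtain T2 where T2: "\<forall>T\<ge>T2. \<exists>s0. \<forall>s\<ge>s0. W (\<lambda>i. (z i + T * w i) + s * (- u i)) = germ z (\<lambda>i. - u i) w"
    using germ_reached [of z w "\<lambda>i. - u i"] by blast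
  define T where "T = max T1 T2"
  define X where "X t = W (\<lambda>i. (z i + T * w i) + t * u i)" for t
  obtain s1 where s1: "\<And>s. s \<ge> s1 \<Longrightarrow> X s = germ z u w" using T1 unfolding T_def X_def by fastforce
  obtain s2 where s2': "\<And>s. s \<ge> s2 \<Longrightarrow> W (\<lambda>i. (z i + T * w i) + s * (- u i)) = germ z (\<lambda>i. - u i) w"
    using T2 unfolding T_def by fastforce
  have s2: "X s = germ z (\<lambda>i. - u i) w" if "s \<le> - s2" for s
    using s2' [of "- s"] that unfolding X_def by simp
  have "finite {t. X t} \<or> finite {t. \<not> X t}" unfolding X_def by (rule tame)
  moreover have "{t. s1 \<le> t} \<subseteq> {t. X t = germ z u w}" using s1 by auto
  moreover have "{t. t \<le> - s2} \<subseteq> {t. X t = germ z (\<lambda>i. - u i) w}" using s2 by auto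
  ultimately show ?thesis
    using infinite_int_up [of s1] infinite_int_down [of "- s2"]
    by (cases "germ z u w"; cases "germ z (\<lambda>i. - u i) w") (auto dest: finite_subset)
qed

lemma lin_simps [simp]: "lin e (\<lambda>_. 0) = 0" "lin e (\<lambda>i. - u i) = - lin e u"
  using linear [of e 0 _ 0] linear [of e "- 1" u 0 u] by auto

text \<open>
  Membership at infinity does not change across the direction \<open>u\<close>. For large \<open>N\<close> the displaced
  direction is the same as the undisplaced direction \<open>N u + w\<close>. Reversing the lines in this direction and
  then those in direction \<open>u\<close> replaces \<open>w\<close> by \<open>- w\<close>.
\<close>

lemma germ_side: "germ z u (\<lambda>i. - w i) = germ z u w"
proof -
  define N where "N = 1 + (\<Sum>e\<in>F. \<bar>lin e w\<bar>)"
  define v where "v = (\<lambda>i. N * u i + 1 * w i)"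
  have lin_v: "lin e v = lin e w + N * lin e u" for e
    unfolding v_def by (subst linear) simp
  have sgn_v: "sgn (lin e v) = (if lin e u \<noteq> 0 then sgn (lin e u) else sgn (lin e w))" if "e \<in> F" for e
  proof -
    have "\<bar>lin e w\<bar> \<le> (\<Sum>e\<in>F. \<bar>lin e w\<bar>)" using that finite_forms by (auto intro!: member_le_sum)
    then have "\<bar>lin e w\<bar> < N" by (simp add: N_def)
    then show ?thesis using sgn_dominant unfolding lin_v by simp
  qed
  have zero: "lin e v = 0 \<longleftrightarrow> lin e u = 0 \<and> lin e w = 0" if "e \<in> F" for e
    using sgn_v [OF that] by (metis sgn_eq_0_iff)
  have "germ z u w = germ z v (\<lambda>_. 0)"
    by (rule germ_cong) (simp add: lex_sign_def sgn_v zero)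
  also have "\<dots> = germ z (\<lambda>i. - v i) (\<lambda>_. 0)" by (rule germ_line)
  also have "\<dots> = germ z (\<lambda>i. - u i) (\<lambda>i. - w i)"
    by (rule germ_cong) (simp add: lex_sign_def sgn_v zero sgn_minus)
  also have "\<dots> = germ z u (\<lambda>i. - w i)" by (rule germ_line [symmetric])
  finally show ?thesis by simp
qed

lemma germ_vertical: "\<not> germ z d u"
proof
  assume "germ z d u"
  then obtain T s0 where "\<forall>s\<ge>s0. W (\<lambda>i. (z i + T * u i) + s * d i)"
    using germ_reached [of z u d] by auto
  then have "{s. s0 \<le> s} \<subseteq> {s. W (\<lambda>i. (z i + T * u i) + s * d i)}" by auto
  then show False using vertical [of "\<lambda>i. z i + T * u i"] infinite_int_up finite_subset by blast
qed

text \<open>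
  Turn \<open>u\<close> towards \<open>d\<close>. Only forms with opposite signs at \<open>u\<close> and \<open>d\<close> are crossed, and at the first
  of these walls the status passes to the other side. After finitely many walls the directions \<open>u\<close>
  and \<open>d\<close> may be exchanged, and the status in direction \<open>d\<close> is known.
\<close>

lemma germ_horizontal: "\<not> germ z u d"
proof (induction "card {e \<in> F. lin e u * lin e d < 0}" arbitrary: u rule: less_induct)
  case less
  show ?case
  proof (cases "{e \<in> F. lin e u * lin e d < 0} = {}")
    case True
    have "germ z u d = germ z d u"
    proof (rule germ_cong)
      fix e assume "e \<in> F"
      then have "0 \<le> lin e u * lin e d" using True by fastforce
      then show "lex_sign z u d e = lex_sign z d u e"
        by (auto simp: lex_sign_def sgn_if zero_le_mult_iff)
    qed
    then show ?thesis using germ_vertical by simp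
  next
    case False
    define C where "C = {e \<in> F. lin e u * lin e d < 0}"
    define ratio where "ratio e = real_of_int \<bar>lin e u\<bar> / real_of_int \<bar>lin e d\<bar>" for e
    have C: "finite C" "C \<noteq> {}" using finite_forms False by (auto simp: C_def)
    define e0 where "e0 = arg_min_on ratio C"
    have e0: "e0 \<in> C" "\<And>e. e \<in> C \<Longrightarrow> ratio e0 \<le> ratio e"
      unfolding e0_def using C arg_min_if_finite [OF C, of ratio] by (auto simp: not_less)
    define p where "p = \<bar>lin e0 d\<bar>"
    define q where "q = \<bar>lin e0 u\<bar>"
    have nz0: "lin e0 u \<noteq> 0" "lin e0 d \<noteq> 0" using e0(1) by (auto simp: C_def)
    then have pq: "0 < p" "0 < q" by (auto simp: p_def q_def)
    have cross: "q * \<bar>lin e d\<bar> \<le> p * \<bar>lin e u\<bar>" if "e \<in> C" for e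
    proof -
      have "lin e d \<noteq> 0" using that by (auto simp: C_def)
      then have "real_of_int (q * \<bar>lin e d\<bar>) \<le> real_of_int (p * \<bar>lin e u\<bar>)"
        using e0(2) [OF that] nz0 by (simp add: ratio_def p_def q_def field_simps)
      then show ?thesis by (simp only: of_int_le_iff)
    qed
    \<comment> \<open>the direction of the first wall, which is that of \<open>e0\<close>\<close>
    define v where "v = (\<lambda>i. p * u i + q * d i)"
    have lin_v: "lin e v = p * lin e u + q * lin e d" for e
      unfolding v_def by (rule linear)
    have lin_v0: "lin e0 v = 0"
      using e0(1) by (auto simp: lin_v p_def q_def C_def abs_if mult_less_0_iff)
    have "germ z u d = germ z v (\<lambda>i. - d i)"
    proof (rule germ_cong)
      fix e assume e: "e \<in> F"
      consider "e \<in> C" | "0 \<le> lin e u * lin e d" using e by (force simp: C_def)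
      then show "lex_sign z u d e = lex_sign z v (\<lambda>i. - d i) e"
      proof cases
        case 1
        then consider "lin e u < 0" "0 < lin e d" | "0 < lin e u" "lin e d < 0"
          by (auto simp: C_def mult_less_0_iff)
        then show ?thesis
        proof cases
          case 1
          then have "lin e v \<le> 0" using cross [OF \<open>e \<in> C\<close>] by (simp add: lin_v)
          then show ?thesis using 1 by (auto simp: lex_sign_def)
        next
          case 2
          then have "0 \<le> lin e v" using cross [OF \<open>e \<in> C\<close>] by (simp add: lin_v)
          then show ?thesis using 2 by (auto simp: lex_sign_def)
        qed
      next
        case 2
        then consider "lin e u = 0" | "lin e d = 0" | "0 < lin e u" "0 < lin e d" | "lin e u < 0" "lin e d < 0"
          by (cases "lin e u" "0::int" rule: linorder_cases; cases "lin e d" "0::int" rule: linorder_cases)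
            (auto simp: zero_le_mult_iff)
        then show ?thesis
        proof cases
          case 1
          then show ?thesis using pq by (auto simp: lex_sign_def lin_v sgn_mult)
        next
          case 2
          then show ?thesis using pq by (auto simp: lex_sign_def lin_v sgn_mult)
        next
          case 3
          then have "0 < lin e v" unfolding lin_v using pq by (intro add_pos_pos mult_pos_pos)
          then show ?thesis using 3 by (simp add: lex_sign_def)
        next
          case 4
          then have "lin e v < 0" unfolding lin_v using pq by (intro add_neg_neg mult_pos_neg)
          then show ?thesis using 4 by (simp add: lex_sign_def)
        qed
      qed
    qed
    also have "\<dots> = germ z v d" by (rule germ_side)
    also have "\<not> germ z v d"
    proof (rule less.hyps)
      have "{e \<in> F. lin e v * lin e d < 0} \<subset> C"
      proof
        show "{e \<in> F. lin e v * lin e d < 0} \<subseteq> C"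
        proof
          fix e assume "e \<in> {e \<in> F. lin e v * lin e d < 0}"
          then have e: "e \<in> F" "lin e v * lin e d < 0" by auto
          have "lin e v * lin e d = p * (lin e u * lin e d) + q * (lin e d * lin e d)"
            by (simp add: lin_v algebra_simps)
          moreover have "0 \<le> q * (lin e d * lin e d)" using pq by simp
          ultimately have "p * (lin e u * lin e d) < 0" using e(2) by linarith
          then show "e \<in> C" using e(1) pq by (simp add: C_def mult_less_0_iff)
        qed
        show "{e \<in> F. lin e v * lin e d < 0} \<noteq> C" using e0(1) lin_v0 by auto
      qed
      then show "card {e \<in> F. lin e v * lin e d < 0} < card {e \<in> F. lin e u * lin e d < 0}"
        using C(1) unfolding C_def by (rule psubset_card_mono [rotated])
    qed
    finally show ?thesis .
  qed
qed

text \<open>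
  Points of \<open>W\<close> that are further and further away from all walls transversal to \<open>d\<close> have a subsequence
  along which all forms keep their signs and grow. The difference \<open>u\<close> of two of them then points into
  the cell of the first one, so that \<open>W\<close> contains the end of the half-line in direction \<open>u\<close>.
\<close>

theorem bounded_distance: "\<exists>B. \<forall>f. W f \<longrightarrow> (\<exists>e\<in>F. lin e d \<noteq> 0 \<and> \<bar>h e f\<bar> \<le> B)"
proof (rule ccontr)
  assume "\<not> ?thesis"
  then have "\<forall>B. \<exists>f. W f \<and> (\<forall>e\<in>F. lin e d \<noteq> 0 \<longrightarrow> B < \<bar>h e f\<bar>)" by (meson not_less)
  then have "\<forall>n. \<exists>f. W f \<and> (\<forall>e\<in>F. lin e d \<noteq> 0 \<longrightarrow> int n < \<bar>h e f\<bar>)" by blast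
  then obtain f where f: "\<And>n. W (f n)" "\<And>n e. e \<in> F \<Longrightarrow> lin e d \<noteq> 0 \<Longrightarrow> int n < \<bar>h e (f n)\<bar>"
    by metis
  obtain r :: "nat \<Rightarrow> nat" where r: "strict_mono r" "\<And>e i j. e \<in> F \<Longrightarrow> i \<le> j \<Longrightarrow>
      sgn (h e (f (r i))) = sgn (h e (f (r j))) \<and> \<bar>h e (f (r i))\<bar> \<le> \<bar>h e (f (r j))\<bar>"
    using monotone_subsequence_finite [OF finite_forms, of "\<lambda>e n. h e (f n)"] by blast
  define z where "z = f (r 0)"
  \<comment> \<open>the second point is so far out that all transversal forms have grown strictly\<close>
  define k where "k = nat (\<Sum>e\<in>F. \<bar>h e z\<bar>)"
  define y where "y = f (r k)"
  define u where "u = (\<lambda>i. y i - z i)"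
  have lin_u: "lin e u = h e y - h e z" for e
    using line [of e z 1 u] by (simp add: u_def)
  have "lex_sign z u d e = sgn (h e z)" if e: "e \<in> F" for e
  proof -
    have mono: "sgn (h e z) = sgn (h e y)" "\<bar>h e z\<bar> \<le> \<bar>h e y\<bar>"
      using r(2) [OF e, of 0 k] by (auto simp: z_def y_def)
    have "lin e u \<noteq> 0" if "lin e d \<noteq> 0"
    proof -
      have "\<bar>h e z\<bar> \<le> int k"
        using e finite_forms by (auto simp: k_def sum_nonneg intro!: member_le_sum)
      also have "int k \<le> int (r k)" using r(1) by (simp add: seq_suble)
      also have "\<dots> < \<bar>h e y\<bar>" unfolding y_def by (rule f(2) [OF e that])
      finally show ?thesis by (auto simp: lin_u)
    qed
    moreover have "sgn (lin e u) = sgn (h e z)" if "lin e u \<noteq> 0"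
      using mono that unfolding lin_u by (auto simp: sgn_if split: if_splits)
    ultimately show ?thesis by (auto simp: lex_sign_def)
  qed
  then have "W z = germ z u d" by (intro germ_iff) simp
  then show False using f(1) germ_horizontal by (simp add: z_def)
qed

end


section \<open>Expansions of the group\<close>

text \<open>
  Expansions of \<open>(G,+)\<close>, where affine functions may be substituted into definable predicates.
\<close>

locale group_expansion =
  fixes M :: "('a::linordered_ab_group_add, 'f, 'r) fo_structure"
  assumes Def_add: "Def M (\<lambda>v. v 0 + v 1 = v 2)"
begin

lemma termdef_add:
  assumes "termdef M f" "termdef M g"
  shows "termdef M (\<lambda>v. f v + g v)"
proof -
  from assms obtain m n where mn: "depends m f" "depends n g" unfolding termdef_def by blast
  have "depends (max m n) (\<lambda>v. f v + g v)"
  proof (rule dependsI)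
    fix v w :: "nat \<Rightarrow> 'a" assume "\<And>i. i < max m n \<Longrightarrow> v i = w i"
    then show "f v + g v = f w + g w"
      using dependsD [OF mn(1), of v w] dependsD [OF mn(2), of v w] by simp
  qed
  moreover have "Def M (\<lambda>v. v j = f v + g v)" for j
  proof -
    let ?t = "\<lambda>i::nat. if i = 0 then f else if i = 1 then g else (\<lambda>v. v j)"
    have "Def M (\<lambda>v. (\<lambda>v. v 0 + v 1 = v 2) (\<lambda>i. ?t i v))"
    proof (rule Def_subst [OF Def_add])
      show "depends 3 (\<lambda>v::nat \<Rightarrow> 'a. v 0 + v 1 = v 2)" by (simp add: depends_def)
    qed (use assms termdef_var in auto)
    then show ?thesis by (simp add: eq_commute)
  qed
  ultimately show ?thesis unfolding termdef_def by blast
qed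

lemma termdef_uminus:
  assumes "termdef M f"
  shows "termdef M (\<lambda>v. - f v)"
proof -
  from assms obtain m where m: "depends m f" unfolding termdef_def by blast
  have "depends m (\<lambda>v. - f v)"
    using dependsD [OF m] by (intro dependsI) (metis (full_types))
  moreover have "Def M (\<lambda>v. v j = - f v)" for j
  proof -
    let ?t = "\<lambda>i::nat. if i = 0 then f else if i = 1 then (\<lambda>v. v j) else (\<lambda>v. 0)"
    have "Def M (\<lambda>v. (\<lambda>v. v 0 + v 1 = v 2) (\<lambda>i. ?t i v))"
    proof (rule Def_subst [OF Def_add])
      show "depends 3 (\<lambda>v::nat \<Rightarrow> 'a. v 0 + v 1 = v 2)" by (simp add: depends_def)
    qed (use assms termdef_var termdef_const in auto)
    moreover have "x + y = 0 \<longleftrightarrow> y = - x" for x y :: 'a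
      by (metis add.commute eq_neg_iff_add_eq_0)
    ultimately show ?thesis by simp
  qed
  ultimately show ?thesis unfolding termdef_def by blast
qed

lemma termdef_zmul:
  assumes "termdef M f"
  shows "termdef M (\<lambda>v. zmul n (f v))"
proof -
  have nat: "termdef M (\<lambda>v. zmul (int n) (f v))" for n
  proof (induction n)
    case (Suc n)
    have "zmul (int (Suc n)) x = x + zmul (int n) x" for x :: 'a
      using zmul_Suc [of "int n" x] by (simp add: add.commute)
    then show ?case using termdef_add [OF assms Suc] by simp
  qed (simp add: termdef_const)
  show ?thesis
  proof (cases "0 \<le> n")
    case True
    then show ?thesis using nat [of "nat n"] by simp
  next
    case False
    then have "zmul n x = - zmul (int (nat (- n))) x" for x :: 'a
      by (simp add: zm.scale_minus_left)
    then show ?thesis using termdef_uminus [OF nat [of "nat (- n)"]] by simp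
  qed
qed

lemma termdef_aff:
  assumes "aff k h"
  shows "termdef M h"
proof -
  from assms obtain a b where h: "h = affine_fun k a b" by (auto simp: aff_def)
  have "termdef M (\<lambda>v. b + (\<Sum>i<l. zmul (a i) (v i)))" for l
  proof (induction l)
    case (Suc l)
    have "termdef M (\<lambda>v. (b + (\<Sum>i<l. zmul (a i) (v i))) + zmul (a l) (v l))"
      by (rule termdef_add [OF Suc termdef_zmul [OF termdef_var]])
    then show ?case by (simp add: add.assoc)
  qed (simp add: termdef_const)
  then show ?thesis by (simp add: h affine_fun_def [abs_def])
qed

lemma Def_aff_subst:
  assumes "Def M P" "\<And>i. aff (l i) (g i)"
  shows "Def M (\<lambda>v. P (\<lambda>i. g i v))"
proof -
  obtain k where "depends k P" using Def_depends [OF assms(1)] .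
  then show ?thesis by (rule Def_subst [OF assms(1)]) (rule termdef_aff [OF assms(2)])
qed

lemma Def_aff_eq:
  assumes "aff k f" "aff k g"
  shows "Def M (\<lambda>v. f v = g v)"
proof -
  have "Def M (\<lambda>v. (\<lambda>v. v 0 = v 1) (\<lambda>i. (if i = (0::nat) then f else g) v))"
    by (rule Def_aff_subst [OF Def_eq, of "\<lambda>_. k"]) (use assms in auto)
  then show ?thesis by simp
qed

lemma Def_Comb_zt:
  assumes "Comb zt k P"
  shows "Def M P"
  using assms
proof (induction rule: comb_induct)
  case (atom A)
  then consider h s where "A = (\<lambda>v. zt (h v) = s)" "aff k h"
    | h n where "A = (\<lambda>v. \<exists>y. h v = zmul n y)" "aff k h"
    unfolding sign_atoms_def cong_atoms_def by blast
  then show ?case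
  proof cases
    case 1
    have D: "Def M (\<lambda>v. h v = 0)" by (rule Def_aff_eq [OF 1(2) aff_const])
    show ?thesis
    proof (cases "s = 0 \<or> s = 1")
      case True
      then show ?thesis using D Def_not [OF D] by (auto simp: 1(1) zt_def)
    next
      case False
      then have "A = (\<lambda>_. False)" by (auto simp: 1(1) zt_def fun_eq_iff)
      then show ?thesis by (simp add: Def_const)
    qed
  next
    case 2
    have "aff (Suc k) h" "aff (Suc k) (\<lambda>v. zmul n (v k))"
      using aff_mono [OF 2(2)] by (auto intro: aff_zmul aff_var)
    then have "Def M (\<lambda>v. \<exists>y. h (v(k := y)) = zmul n ((v(k := y)) k))"
      by (rule Def_ex [OF Def_aff_eq])
    moreover have "h (v(k := y)) = h v" for v y
      by (rule dependsD [OF aff_depends [OF 2(2)]]) auto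
    ultimately show ?thesis by (simp add: 2(1))
  qed
qed (auto intro: Def_const Def_not Def_and)

end


section \<open>Splitting along cosets\<close>

lemma Comb_restrict:
  fixes P :: "(nat \<Rightarrow> 'a::linordered_ab_group_add) \<Rightarrow> bool"
  assumes "Comb sg l P" "depends k P"
  shows "Comb sg k P"
proof -
  have "Comb sg k (\<lambda>v. P (\<lambda>i. (if i < k then (\<lambda>v. v i) else (\<lambda>_. 0)) v))"
    by (rule Comb_subst [OF assms(1)]) (simp add: aff_var)
  moreover have "P (\<lambda>i. (if i < k then (\<lambda>v. v i) else (\<lambda>_. 0)) v) = P v" for v
    by (rule dependsD [OF assms(2)]) simp
  ultimately show ?thesis by simp
qed

text \<open>
  Rescaling by a common modulus turns each congruence into a constant.
\<close>

lemma coset_split: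
  fixes P :: "(nat \<Rightarrow> 'a::linordered_ab_group_add) \<Rightarrow> bool"
  assumes "Comb sg k P"
  obtains m where "1 \<le> m" "\<And>c. comb (sign_atoms sg k) (\<lambda>v. P (\<lambda>i. c i + zmul m (v i)))"
proof -
  obtain F where F: "finite F" "F \<subseteq> sign_atoms sg k \<union> cong_atoms k" "determined F P"
    using assms unfolding comb_def by blast
  obtain m where m: "1 \<le> m" "\<And>A. A \<in> F \<inter> cong_atoms k \<Longrightarrow>
      \<exists>h n. A = (\<lambda>v. \<exists>y. h v = zmul n y) \<and> aff k h \<and> 1 \<le> n \<and> n dvd m"
    using cong_atoms_common_modulus [of "F \<inter> cong_atoms k" k] F(1) by auto
  have "comb F P" unfolding comb_def using F by blast
  have "comb (sign_atoms sg k) (\<lambda>v. P (\<lambda>i. c i + zmul m (v i)))" for c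
  proof (rule comb_subst [OF \<open>comb F P\<close>])
    fix A assume "A \<in> F"
    then consider "A \<in> sign_atoms sg k" | "A \<in> F \<inter> cong_atoms k" using F(2) by blast
    then show "comb (sign_atoms sg k) (\<lambda>v. A (\<lambda>i. c i + zmul m (v i)))"
    proof cases
      case 1
      have "comb (sign_atoms sg k) (\<lambda>v. A (\<lambda>i. (\<lambda>v. c i + zmul m (v i)) v))"
        by (rule comb_sign_subst [OF comb_atom [OF 1]]) (intro aff_add aff_const aff_zmul aff_var)
      then show ?thesis .
    next
      case 2
      obtain h n where A: "A = (\<lambda>v. \<exists>y. h v = zmul n y)" "aff k h" "n dvd m" using m(2) [OF 2] by blast
      obtain a b where h: "h = affine_fun k a b" using A(2) by (auto simp: aff_def)
      have hv: "h (\<lambda>i. c i + zmul m (v i)) = h c + zmul m (\<Sum>i<k. zmul (a i) (v i))" for v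
        by (simp add: h affine_fun_def zmul_add_right sum.distrib zm.scale_sum_right zmul_zmul mult.commute)
      have "(\<lambda>v. A (\<lambda>i. c i + zmul m (v i))) = (\<lambda>_. \<exists>y. h c = zmul n y)"
        unfolding A(1) hv by (rule ext) (rule congruence_shift [OF A(3)])
      then show ?thesis by (simp only: comb_const)
    qed
  qed
  then show thesis using that m(1) by blast
qed

context regular_group
begin

text \<open>
  The arguments of the pieces are recovered by the conditions \<open>v i = c i + m z i\<close>, with \<open>c i\<close> from a finite
  set of representatives, and the \<open>z i\<close> are eliminated.
\<close>

lemma coset_join:
  fixes P :: "(nat \<Rightarrow> 'a) \<Rightarrow> bool"
  assumes sg: "sg \<in> signs" and m: "1 \<le> m" and P: "depends k P"
    and pieces: "\<And>c. Comb sg k (\<lambda>v. P (\<lambda>i. c i + zmul m (v i)))"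
  shows "Comb sg k P"
proof -
  obtain C where C: "finite C" "\<And>x::'a. \<exists>c\<in>C. \<exists>y. x = c + zmul m y"
    using finite_index [OF m] by blast
  define D where "D = {c :: nat \<Rightarrow> 'a. \<forall>i. (i \<in> {..<k} \<longrightarrow> c i \<in> C) \<and> (i \<notin> {..<k} \<longrightarrow> c i = 0)}"
  have "finite D" unfolding D_def by (rule finite_set_of_finite_funs) (use C in auto)
  define T where "T c v \<longleftrightarrow> (\<exists>w. (\<forall>i\<ge>k. w i = v i) \<and>
      (\<forall>i\<in>{..<k}. w (k + i) = c i + zmul m (w i)) \<and> P (\<lambda>i. c i + zmul m (w i)))" for c and v :: "nat \<Rightarrow> 'a"
  have "Comb sg (k + k) (T c)" for c
    unfolding T_def [abs_def]
  proof (intro Comb_ex_block sg comb_and comb_ball)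
    show "Comb sg (k + k) (\<lambda>v. P (\<lambda>i. c i + zmul m (v i)))"
      by (rule Comb_mono [OF pieces]) simp
    show "Comb sg (k + k) (\<lambda>v. v (k + i) = c i + zmul m (v i))" if "i \<in> {..<k}" for i
      using that by (intro Comb_eq sg aff_add aff_const aff_zmul aff_var) auto
  qed simp
  then have "Comb sg k (\<lambda>v. T c (\<lambda>i. (if i < k then (\<lambda>_. 0) else (\<lambda>v. v (i - k))) v))" for c
    by (rule Comb_subst) (auto intro: aff_var)
  then have "Comb sg k (\<lambda>v. \<exists>c\<in>D. T c (\<lambda>i. (if i < k then (\<lambda>_. 0) else (\<lambda>v. v (i - k))) v))"
    by (rule comb_bex [OF \<open>finite D\<close>])
  moreover have "(\<exists>c\<in>D. T c (\<lambda>i. (if i < k then (\<lambda>_. 0) else (\<lambda>v. v (i - k))) v)) = P v" for v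
  proof
    assume "\<exists>c\<in>D. T c (\<lambda>i. (if i < k then (\<lambda>_. 0) else (\<lambda>v. v (i - k))) v)"
    then obtain c where "T c (\<lambda>i. (if i < k then (\<lambda>_. 0) else (\<lambda>v. v (i - k))) v)" by blast
    then obtain w where w: "\<forall>i\<ge>k. w i = (if i < k then (\<lambda>_. 0) else (\<lambda>v. v (i - k))) v"
      "\<forall>i\<in>{..<k}. w (k + i) = c i + zmul m (w i)" "P (\<lambda>i. c i + zmul m (w i))"
      unfolding T_def by blast
    have "P v = P (\<lambda>i. c i + zmul m (w i))"
    proof (rule dependsD [OF P])
      fix i assume "i < k"
      then show "v i = c i + zmul m (w i)"
        using spec [OF w(1), of "k + i"] bspec [OF w(2), of i] by simp
    qed
    then show "P v" using w(3) by simp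
  next
    assume "P v"
    have "\<forall>x. \<exists>c y. c \<in> C \<and> x = c + zmul m y" using C(2) by blast
    then obtain c y where cy: "\<And>x. c x \<in> C \<and> x = c x + zmul m (y x)" by metis
    define c' where "c' i = (if i < k then c (v i) else 0)" for i
    define w where "w i = (if i < k then y (v i) else v (i - k))" for i
    have "P (\<lambda>i. c' i + zmul m (w i)) = P v"
    proof (rule dependsD [OF P])
      fix i assume "i < k"
      then show "c' i + zmul m (w i) = v i" using cy [of "v i"] by (simp add: c'_def w_def)
    qed
    moreover have "\<forall>i\<in>{..<k}. w (k + i) = c' i + zmul m (w i)"
    proof
      fix i assume "i \<in> {..<k}"
      then show "w (k + i) = c' i + zmul m (w i)" using cy [of "v i"] by (simp add: c'_def w_def)
    qed
    ultimately have "T c' (\<lambda>i. (if i < k then (\<lambda>_. 0) else (\<lambda>v. v (i - k))) v)"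
      unfolding T_def using \<open>P v\<close> by (intro exI [of _ w]) (simp add: w_def)
    moreover have "c' \<in> D" using cy by (simp add: D_def c'_def)
    ultimately show "\<exists>c\<in>D. T c (\<lambda>i. (if i < k then (\<lambda>_. 0) else (\<lambda>v. v (i - k))) v)" by blast
  qed
  ultimately show ?thesis by simp
qed


section \<open>Overspill\<close>

text \<open>
  Infinitely large, in a discrete group.
\<close>

definition unbounded :: "'a \<Rightarrow> bool" where
  "unbounded x \<longleftrightarrow> (\<forall>n::nat. zmul (int n) one < x)"

lemma unbounded_quotient:
  assumes "\<not> dense" "1 \<le> m" "unbounded x"
  obtains y where "unbounded y" "zmul m y < x"
proof -
  have one: "0 < one" by (rule discrete_one [OF assms(1)])
  obtain y where y: "x - zmul m one \<le> zmul m y" "zmul m y < x"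
    using regular [OF assms(2) one, of "x - zmul m one"] by auto
  have "zmul (int n) one < y" for n
  proof (rule ccontr)
    assume "\<not> zmul (int n) one < y"
    then have "y \<le> zmul (int n) one" by simp
    then have "zmul m y \<le> zmul m (zmul (int n) one)" using assms(2) zmul_le_iff [of m y "zmul (int n) one"] by linarith
    then have "x - zmul m one \<le> zmul (m * int n) one" using y(1) by (simp add: zmul_zmul)
    then have "x \<le> zmul (m * int n + m) one" by (simp add: zmul_add_left algebra_simps)
    moreover have "zmul (int (nat (m * int n + m))) one < x" using assms(3) unfolding unbounded_def by blast
    ultimately show False using assms(2) by simp
  qed
  then show thesis using that y(2) unfolding unbounded_def by blast
qed

lemma unbounded_mono: "unbounded x \<Longrightarrow> x \<le> y \<Longrightarrow> unbounded y"
  unfolding unbounded_def by (meson less_le_trans)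

text \<open>
  The sign can change at \<open>- b / a\<close> only. If this is infinite, the sign is constant up to a smaller
  infinite bound; if not, it is constant beyond a finite one.
\<close>

lemma sgn3_eventually_constant:
  assumes nd: "\<not> dense" and u: "unbounded u" and a: "0 < a"
  shows "\<exists>c n \<sigma>. unbounded c \<and> (\<forall>x. zmul (int n) one \<le> x \<and> x \<le> c \<longrightarrow> sgn3 (b + zmul a x) = \<sigma>)"
proof (cases "unbounded (- b)")
  case True
  then obtain c where c: "unbounded c" "zmul a c < - b" using unbounded_quotient [OF nd, of a] a by auto
  have "sgn3 (b + zmul a x) = -1" if "x \<le> c" for x
  proof -
    have "zmul a x < - b" using that c(2) a zmul_le_iff [of a x c] by simp
    then show ?thesis using less_diff_eq [of "zmul a x" 0 b] by (simp add: add.commute)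
  qed
  then show ?thesis using c(1) by blast
next
  case False
  then obtain n :: nat where n: "- b \<le> zmul (int n) one" unfolding unbounded_def by (auto simp: not_less)
  have one: "0 < one" by (rule discrete_one [OF nd])
  have "sgn3 (b + zmul a x) = 1" if "zmul (int (Suc n)) one \<le> x" for x
  proof -
    have less: "zmul (int n) one < zmul (int (Suc n)) one" by (simp only: zmul_less_left [OF one])
    have "0 \<le> zmul (int n) one" using zmul_le_left [OF one, of 0 "int n"] by simp
    then have "0 < x" using less that by (meson le_less_trans less_le_trans)
    then have "zmul 1 x \<le> zmul a x" using a by (simp only: zmul_le_left)
    then have "- b < zmul a x" using n less that by (metis le_less_trans less_le_trans zmul_1_left)
    then show ?thesis using diff_less_eq [of 0 b "zmul a x"] by (simp add: add.commute)
  qed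
  then show ?thesis using u by blast
qed

text \<open>
  On the multiples of a suitable \<open>m\<close> a definable predicate is constant from some finite element up
  to some infinite one. This property passes to Boolean combinations and holds for the atoms.
\<close>

lemma overspill:
  assumes nd: "\<not> dense" and u: "unbounded u" and P: "Comb sgn3 1 P"
    and all: "\<And>n::nat. P (\<lambda>_. zmul (int n) one)"
  shows "\<exists>x. unbounded x \<and> P (\<lambda>_. x)"
proof -
  have one: "0 < one" by (rule discrete_one [OF nd])
  define const where "const P m c n \<longleftrightarrow> (\<forall>y z. zmul (int n) one \<le> zmul m y \<and> zmul m y \<le> c \<and>
      zmul (int n) one \<le> zmul m z \<and> zmul m z \<le> c \<longrightarrow> P (\<lambda>_. zmul m y) = P (\<lambda>_. zmul m z))"
    for P :: "(nat \<Rightarrow> 'a) \<Rightarrow> bool" and m c n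
  have "\<exists>m c n. 1 \<le> m \<and> unbounded c \<and> const P m c n"
    using P
  proof (induction rule: comb_induct)
    case (atom A)
    then consider h s where "A = (\<lambda>v. sgn3 (h v) = s)" "aff 1 h"
      | h m where "A = (\<lambda>v. \<exists>y. h v = zmul m y)" "aff 1 h" "1 \<le> m"
      unfolding sign_atoms_def cong_atoms_def by blast
    then show ?case
    proof cases
      case 1
      obtain a b where h: "h = affine_fun 1 a b" using 1(2) by (auto simp: aff_def)
      have hx: "h (\<lambda>_. x) = b + zmul (a 0) x" for x by (simp add: h affine_fun_def)
      have "\<exists>c n \<sigma>. unbounded c \<and> (\<forall>x. zmul (int n) one \<le> x \<and> x \<le> c \<longrightarrow> sgn3 (b + zmul (a 0) x) = \<sigma>)"
      proof (cases "a 0" "0::int" rule: linorder_cases)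
        case less
        then obtain c n \<sigma> where c: "unbounded c"
          "\<And>x. zmul (int n) one \<le> x \<and> x \<le> c \<Longrightarrow> sgn3 (- b + zmul (- a 0) x) = \<sigma>"
          using sgn3_eventually_constant [OF nd u, of "- a 0" "- b"] by auto
        have "sgn3 (b + zmul (a 0) x) = - \<sigma>" if "zmul (int n) one \<le> x \<and> x \<le> c" for x
        proof -
          have "b + zmul (a 0) x = - (- b + zmul (- a 0) x)" by (simp add: zm.scale_minus_left)
          then show ?thesis using c(2) [OF that] by (simp only: sgn3_simps)
        qed
        then show ?thesis using c(1) by blast
      next
        case equal
        then show ?thesis using u by auto
      next
        case greater
        then show ?thesis using sgn3_eventually_constant [OF nd u] by blast
      qed
      then obtain c n \<sigma> where "unbounded c"
        "\<And>x. zmul (int n) one \<le> x \<and> x \<le> c \<Longrightarrow> sgn3 (b + zmul (a 0) x) = \<sigma>" by blast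
      then have "unbounded c" "const A 1 c n" unfolding const_def by (simp_all add: 1(1) hx)
      then show ?thesis by (intro exI [of _ 1]) auto
    next
      case 2
      obtain a b where h: "h = affine_fun 1 a b" using 2(2) by (auto simp: aff_def)
      have hx: "h (\<lambda>_. zmul m x) = b + zmul m (zmul (a 0) x)" for x
        by (simp add: h affine_fun_def zmul_zmul mult.commute)
      have "const A m u 0" unfolding const_def 2(1) by (simp add: hx congruence_shift)
      then show ?thesis using u 2(3) by blast
    qed
  next
    case (const x)
    then show ?case using u unfolding const_def by (intro exI [of _ 1]) auto
  next
    case (neg Q)
    then show ?case unfolding const_def by simp
  next
    case (conj Q R)
    then obtain m c n m' c' n' where 1: "1 \<le> m" "unbounded c" "const Q m c n"
      and 2: "1 \<le> m'" "unbounded c'" "const R m' c' n'" by blast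
    have max: "zmul (int n) one \<le> zmul (int (max n n')) one" "zmul (int n') one \<le> zmul (int (max n n')) one"
      by (simp_all only: zmul_le_left [OF one] of_nat_le_iff max.cobounded1 max.cobounded2)
    have "const (\<lambda>v. Q v \<and> R v) (m * m') (min c c') (max n n')"
      unfolding const_def
    proof (intro allI impI)
      fix y z
      assume *: "zmul (int (max n n')) one \<le> zmul (m * m') y \<and> zmul (m * m') y \<le> min c c' \<and>
        zmul (int (max n n')) one \<le> zmul (m * m') z \<and> zmul (m * m') z \<le> min c c'"
      have r: "zmul (int n) one \<le> zmul (m * m') x" "zmul (int n') one \<le> zmul (m * m') x"
        "zmul (m * m') x \<le> c" "zmul (m * m') x \<le> c'" if "x = y \<or> x = z" for x
        using * order_trans [OF max(1)] order_trans [OF max(2)] that by auto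
      have e: "zmul m (zmul m' x) = zmul (m * m') x" "zmul m' (zmul m x) = zmul (m * m') x" for x :: 'a
        by (simp_all add: zmul_zmul mult.commute)
      have "Q (\<lambda>_. zmul m (zmul m' y)) = Q (\<lambda>_. zmul m (zmul m' z))"
        by (rule 1(3) [unfolded const_def, rule_format]) (simp only: e r simp_thms)
      moreover have "R (\<lambda>_. zmul m' (zmul m y)) = R (\<lambda>_. zmul m' (zmul m z))"
        by (rule 2(3) [unfolded const_def, rule_format]) (simp only: e r simp_thms)
      ultimately have "Q (\<lambda>_. zmul (m * m') y) = Q (\<lambda>_. zmul (m * m') z)"
        "R (\<lambda>_. zmul (m * m') y) = R (\<lambda>_. zmul (m * m') z)" by (simp_all only: e)
      then show "(Q (\<lambda>_. zmul (m * m') y) \<and> R (\<lambda>_. zmul (m * m') y)) =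
        (Q (\<lambda>_. zmul (m * m') z) \<and> R (\<lambda>_. zmul (m * m') z))" by simp
    qed
    moreover have "unbounded (min c c')" using 1(2) 2(2) by (simp add: min_def)
    moreover have "1 \<le> m * m'" using mult_mono [of 1 m 1 m'] 1(1) 2(1) by simp
    ultimately show ?case by blast
  qed
  then obtain m c n where m: "1 \<le> m" and c: "unbounded c" and const: "const P m c n" by blast
  obtain y where y: "unbounded y" "zmul m y < c" using unbounded_quotient [OF nd m c] .
  have "0 \<le> y" using y(1) unfolding unbounded_def by (metis of_nat_0 zmul_0_left less_imp_le)
  moreover have "y \<le> zmul m y"
  proof (cases "y = 0")
    case False
    then have "0 < y" using \<open>0 \<le> y\<close> by simp
    then have "zmul 1 y \<le> zmul m y" using m by (simp only: zmul_le_left)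
    then show ?thesis by simp
  qed simp
  ultimately have my: "unbounded (zmul m y)" using y(1) unbounded_mono by blast
  have n: "zmul (int n) one \<le> zmul m (zmul (int n) one)"
    using mult_right_mono [OF m, of "int n"] by (simp add: zmul_zmul zmul_le_left [OF one])
  have mn: "zmul m (zmul (int n) one) = zmul (int (nat m * n)) one" using m by (simp add: zmul_zmul)
  have "P (\<lambda>_. zmul m y) = P (\<lambda>_. zmul m (zmul (int n) one))"
  proof (rule const [unfolded const_def, rule_format], intro conjI)
    show "zmul (int n) one \<le> zmul m y" using my unfolding unbounded_def by (simp add: less_imp_le)
    show "zmul m y \<le> c" using y(2) by simp
    show "zmul (int n) one \<le> zmul m (zmul (int n) one)" by (rule n)
    show "zmul m (zmul (int n) one) \<le> c"
      unfolding mn using c [unfolded unbounded_def, rule_format, of "nat m * n"] by (rule less_imp_le)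
  qed
  then have "P (\<lambda>_. zmul m y)" unfolding mn using all by blast
  then show ?thesis using my by blast
qed

end


section \<open>Definable sets with finite fibres\<close>

lemma affine_fun_Suc:
  "affine_fun (Suc k) a b (v(k := x)) = affine_fun k a b v + zmul (a k) x"
  by (simp add: affine_fun_def add.assoc)

lemma affine_fun_shift:
  "affine_fun (Suc k) a b (v(k := v k + x)) = affine_fun (Suc k) a b v + zmul (a k) x"
  using affine_fun_Suc [of k a b v "v k + x"] affine_fun_Suc [of k a b v "v k"]
  by (simp add: zmul_add_right add.assoc)

lemma semilinear_forms:
  assumes "comb (sign_atoms sg k) P"
  obtains H a b where "finite H" "\<And>h. h \<in> H \<Longrightarrow> h = affine_fun k (a h) (b h)"
    "\<And>v w. (\<And>h. h \<in> H \<Longrightarrow> sg (h v) = sg (h w)) \<Longrightarrow> P v = P w"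
proof -
  obtain F where F: "finite F" "F \<subseteq> sign_atoms sg k" "determined F P"
    using assms unfolding comb_def by blast
  have "\<forall>A\<in>F. \<exists>h. \<exists>s a b. A = (\<lambda>v. sg (h v) = s) \<and> h = affine_fun k a b"
    using F(2) unfolding sign_atoms_def aff_def by blast
  then obtain f where f: "\<And>A. A \<in> F \<Longrightarrow> \<exists>s a b. A = (\<lambda>v. sg (f A v) = s) \<and> f A = affine_fun k a b"
    by metis
  have "\<forall>h\<in>f ` F. \<exists>a b. h = affine_fun k a b" using f by blast
  then obtain a b where ab: "\<And>h. h \<in> f ` F \<Longrightarrow> h = affine_fun k (a h) (b h)" by metis
  show thesis
  proof (rule that [OF _ ab])
    show "finite (f ` F)" using F(1) by simp
    fix v w assume *: "\<And>h. h \<in> f ` F \<Longrightarrow> sg (h v) = sg (h w)"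
    show "P v = P w"
    proof (rule determinedD [OF F(3)])
      fix A assume A: "A \<in> F"
      then obtain s where "A = (\<lambda>v. sg (f A v) = s)" using f by blast
      moreover have "sg (f A v) = sg (f A w)" using * A by blast
      ultimately show "A v = A w" by metis
    qed
  qed
qed

definition abs_val :: "'a::linordered_ab_group_add \<Rightarrow> 'a" where
  "abs_val x = max x (- x)"

lemma abs_val_le_iff: "abs_val x \<le> y \<longleftrightarrow> x \<le> y \<and> - x \<le> y"
  by (simp add: abs_val_def)

lemma less_abs_val_iff: "y < abs_val x \<longleftrightarrow> y < x \<or> y < - x"
  by (simp add: abs_val_def less_max_iff_disj)

lemma abs_val_cases: "0 \<le> x \<Longrightarrow> abs_val x = x" "x \<le> 0 \<Longrightarrow> abs_val x = - x"
  unfolding abs_val_def using order_trans [of "- x" 0 x] order_trans [of x 0 "- x"] by (auto simp: max_def)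

lemma abs_val_pos: "x \<noteq> 0 \<Longrightarrow> 0 < abs_val x"
  by (cases x "0::'a" rule: linorder_cases) (auto simp: less_abs_val_iff)

lemma abs_val_nonneg: "0 \<le> abs_val x"
  by (cases "x = 0") (auto simp: abs_val_cases intro: less_imp_le abs_val_pos)

lemma sgn3_perturb:
  assumes "y < abs_val x" "- y < abs_val x"
  shows "sgn3 (x + y) = sgn3 x"
proof (cases x "0::'a" rule: linorder_cases)
  case less
  then have "y < - x" using assms(1) by (simp add: abs_val_cases)
  then have "x + y < 0" using less_diff_eq [of y 0 x] by (simp add: add.commute)
  then have "sgn3 (x + y) = - 1" "sgn3 x = - 1" using less by (simp_all only: sgn3_simps)
  then show ?thesis by (simp only:)
next
  case equal
  then show ?thesis using assms by (simp add: abs_val_cases)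
next
  case greater
  then have "- y < x" using assms(2) by (simp add: abs_val_cases)
  then have "0 < x + y" using diff_less_eq [of 0 y x] by simp
  then have "sgn3 (x + y) = 1" "sgn3 x = 1" using greater by (simp_all only: sgn3_simps)
  then show ?thesis by (simp only:)
qed

text \<open>
  A reduct of the ordered group that expands the group, with the tameness of unary sets that follows
  from stability as well as from condition (2).
\<close>

locale regular_expansion = regular_group "TYPE('a)" + group_expansion M
  for M :: "('a::linordered_ab_group_add, 'f, 'r) fo_structure" +
  assumes ordered_reduct: "\<And>P. Def M P \<Longrightarrow> \<exists>k. Comb sgn3 k P"
    and unary_tame: "\<And>P. Def M P \<Longrightarrow> comb (sign_atoms sgn3 1) P \<Longrightarrow>
      finite {x. P (\<lambda>_. x)} \<or> finite {x. \<not> P (\<lambda>_. x)}"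
begin

text \<open>
  If no transversal wall is near, then moving along the fibre by multiples of a small \<open>\<epsilon>\<close> changes no
  sign, so the fibre has more points than any given number.
\<close>

lemma room_infinite_fibre:
  assumes H: "finite H" "\<And>h. h \<in> H \<Longrightarrow> h = affine_fun (Suc k) (a h) (b h)"
    and det: "\<And>v w. (\<And>h. h \<in> H \<Longrightarrow> sgn3 (h v) = sgn3 (h w)) \<Longrightarrow> P v = P w"
    and v: "P v"
    and room: "\<And>n. \<exists>\<epsilon>::'a. 0 < \<epsilon> \<and> (\<forall>h\<in>H. a h k \<noteq> 0 \<longrightarrow> zmul (int n) \<epsilon> < abs_val (h v))"
  shows "infinite {x. P (v(k := x))}"
proof
  assume fin: "finite {x. P (v(k := x))}"
  define n where "n = card {x. P (v(k := x))}"
  define c where "c = (\<Sum>h\<in>H. nat \<bar>a h k\<bar>)"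
  obtain \<epsilon> where \<epsilon>: "0 < \<epsilon>" "\<And>h. h \<in> H \<Longrightarrow> a h k \<noteq> 0 \<Longrightarrow> zmul (int (n * c)) \<epsilon> < abs_val (h v)"
    using room [of "n * c"] by blast
  have "P (v(k := v k + zmul (int j) \<epsilon>)) = P v" if j: "j \<le> n" for j
  proof (rule det)
    fix h assume h: "h \<in> H"
    have shift: "h (v(k := v k + zmul (int j) \<epsilon>)) = h v + zmul (a h k * int j) \<epsilon>"
      using affine_fun_shift [of k "a h" "b h" v "zmul (int j) \<epsilon>"] H(2) [OF h] by (simp add: zmul_zmul)
    show "sgn3 (h (v(k := v k + zmul (int j) \<epsilon>))) = sgn3 (h v)"
    proof (cases "a h k = 0")
      case False
      have "nat \<bar>a h k\<bar> \<le> c" unfolding c_def using h H(1) by (auto intro: member_le_sum)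
      then have "\<bar>a h k\<bar> * int j \<le> int c * int n" using j by (intro mult_mono) auto
      then have "\<bar>a h k * int j\<bar> \<le> int (n * c)" by (simp add: abs_mult mult.commute)
      then have "zmul (a h k * int j) \<epsilon> \<le> zmul (int (n * c)) \<epsilon>" "zmul (- (a h k * int j)) \<epsilon> \<le> zmul (int (n * c)) \<epsilon>"
        by (simp_all only: zmul_le_left [OF \<epsilon>(1)])
      then have "zmul (a h k * int j) \<epsilon> < abs_val (h v)" "- zmul (a h k * int j) \<epsilon> < abs_val (h v)"
        using \<epsilon>(2) [OF h False] unfolding zm.scale_minus_left by (auto intro: le_less_trans)
      then show ?thesis unfolding shift by (rule sgn3_perturb)
    qed (simp add: shift)
  qed
  then have "(\<lambda>j. v k + zmul (int j) \<epsilon>) ` {..n} \<subseteq> {x. P (v(k := x))}" using v by auto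
  then have "card ((\<lambda>j. v k + zmul (int j) \<epsilon>) ` {..n}) \<le> n" unfolding n_def by (rule card_mono [OF fin])
  moreover have "inj_on (\<lambda>j. v k + zmul (int j) \<epsilon>) {..n}"
    by (rule inj_onI) (simp add: zmul_eq_left [OF \<epsilon>(1)])
  ultimately show False by (simp add: card_image)
qed

lemma discrete_zmul:
  assumes "\<not> dense" "abs_val x \<le> zmul (int n) one"
  shows "\<exists>j\<in>{- int n..int n}. x = zmul j one"
proof -
  obtain j where j: "j \<le> n" "abs_val x = zmul (int j) one"
    using discrete_multiple [OF assms(1) abs_val_nonneg assms(2)] by auto
  show ?thesis
  proof (cases "0 \<le> x")
    case True
    then have "x = zmul (int j) one" using j(2) by (simp add: abs_val_cases)
    then show ?thesis using j(1) by (intro bexI [of _ "int j"]) auto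
  next
    case False
    then have "- x = zmul (int j) one" using j(2) by (simp add: abs_val_cases)
    then have "x = zmul (- int j) one" by (metis minus_minus zm.scale_minus_left)
    then show ?thesis using j(1) by (intro bexI [of _ "- int j"]) auto
  qed
qed

text \<open>
  Otherwise the distances that points of \<open>P\<close> keep from the transversal walls include all finite
  ones, hence by overspill an infinite one, which leaves room for an infinite fibre.
\<close>

lemma bounded_distance_nonstandard:
  assumes nd: "\<not> dense" and u: "unbounded u"
    and H: "finite H" "\<And>h. h \<in> H \<Longrightarrow> h = affine_fun (Suc k) (a h) (b h)"
    and det: "\<And>v w. (\<And>h. h \<in> H \<Longrightarrow> sgn3 (h v) = sgn3 (h w)) \<Longrightarrow> P v = P w"
    and P: "comb (sign_atoms sgn3 (Suc k)) P"
    and fibres: "\<And>v. finite {x. P (v(k := x))}"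
  shows "\<exists>n. \<forall>v. P v \<longrightarrow> (\<exists>h\<in>H. a h k \<noteq> 0 \<and> abs_val (h v) \<le> zmul (int n) one)"
proof (rule ccontr)
  assume "\<not> ?thesis"
  then have far: "\<exists>v. P v \<and> (\<forall>h\<in>H. a h k \<noteq> 0 \<longrightarrow> zmul (int n) one < abs_val (h v))" for n
    by (meson not_less)
  define H' where "H' = {h \<in> H. a h k \<noteq> 0}"
  have aff: "aff (Suc (Suc k)) h" if "h \<in> H'" for h
    using H(2) [of h] that aff_mono [OF aff_affine_fun, of "Suc k" "Suc (Suc k)" "a h" "b h"]
    by (simp add: H'_def)
  have dep: "depends (Suc k) P"
    by (rule Comb_depends [of sgn3], rule comb_mono [OF P]) simp
  have deph: "depends (Suc k) h" if "h \<in> H'" for h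
    using aff_depends [OF aff_affine_fun, of "Suc k" "a h" "b h"] H(2) [of h] that by (simp add: H'_def)
  \<comment> \<open>variable \<open>Suc k\<close> holds the distance\<close>
  define T where "T v \<longleftrightarrow> (\<exists>w. (\<forall>i\<ge>Suc k. w i = v i) \<and>
      (P w \<and> (\<forall>h\<in>H'. w (Suc k) < h w \<or> w (Suc k) < - h w)))" for v
  have "Comb sgn3 (Suc (Suc k)) T"
    unfolding T_def [abs_def]
  proof (intro Comb_ex_block comb_and comb_ball comb_or)
    show "Comb sgn3 (Suc (Suc k)) P"
      by (rule Comb_mono [of _ "Suc k"], rule comb_mono [OF P]) auto
    show "finite H'" using H(1) by (simp add: H'_def)
    show "Comb sgn3 (Suc (Suc k)) (\<lambda>v. v (Suc k) < h v)" if "h \<in> H'" for h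
      using aff [OF that] by (intro Comb_less aff_var) auto
    show "Comb sgn3 (Suc (Suc k)) (\<lambda>v. v (Suc k) < - h v)" if "h \<in> H'" for h
      using aff [OF that] by (intro Comb_less aff_var aff_uminus) auto
  qed simp
  then have "Comb sgn3 1 (\<lambda>v. T (\<lambda>i. v 0))" by (rule Comb_subst) (simp add: aff_var)
  moreover have "T (\<lambda>_. zmul (int n) one)" for n
  proof -
    obtain v where v: "P v" "\<And>h. h \<in> H \<Longrightarrow> a h k \<noteq> 0 \<Longrightarrow> zmul (int n) one < abs_val (h v)"
      using far by blast
    define w where "w i = (if i < Suc k then v i else zmul (int n) one)" for i
    have "P w = P v" by (rule dependsD [OF dep]) (simp add: w_def)
    moreover have "w (Suc k) < h w \<or> w (Suc k) < - h w" if "h \<in> H'" for h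
    proof -
      have "h w = h v" by (rule dependsD [OF deph [OF that]]) (simp add: w_def)
      then show ?thesis using v(2) [of h] that by (auto simp: H'_def less_abs_val_iff w_def)
    qed
    moreover have "\<forall>i\<ge>Suc k. w i = zmul (int n) one" by (simp add: w_def)
    ultimately show ?thesis unfolding T_def using v(1) by blast
  qed
  ultimately obtain x where x: "unbounded x" "T (\<lambda>_. x)"
    using overspill [OF nd u] by blast
  then obtain w where w: "P w" "w (Suc k) = x" "\<And>h. h \<in> H' \<Longrightarrow> w (Suc k) < h w \<or> w (Suc k) < - h w"
    unfolding T_def by auto
  have "infinite {y. P (w(k := y))}"
  proof (rule room_infinite_fibre [where H = H and a = a and b = b])
    show "finite H" "P w" by fact+
    show "h = affine_fun (Suc k) (a h) (b h)" if "h \<in> H" for h using that by (rule H)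
    show "P v = P v'" if "\<And>h. h \<in> H \<Longrightarrow> sgn3 (h v) = sgn3 (h v')" for v v' using that by (rule det)
    fix n
    have "zmul (int n) one < abs_val (h w)" if "h \<in> H" "a h k \<noteq> 0" for h
    proof -
      have "x < abs_val (h w)" using w(3) [of h] w(2) that by (auto simp: H'_def less_abs_val_iff)
      then show ?thesis using x(1) unfolding unbounded_def by (meson less_trans)
    qed
    then show "\<exists>\<epsilon>. 0 < \<epsilon> \<and> (\<forall>h\<in>H. a h k \<noteq> 0 \<longrightarrow> zmul (int n) \<epsilon> < abs_val (h w))"
      using discrete_one(1) [OF nd] by blast
  qed
  then show False using fibres by blast
qed

text \<open>
  Without infinite elements a discrete group is a copy of the integers.
\<close>

lemma bounded_distance_standard:
  assumes nd: "\<not> dense" and std: "\<And>x. \<not> unbounded x"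
    and H: "finite H" "\<And>h. h \<in> H \<Longrightarrow> h = affine_fun (Suc k) (a h) (b h)"
    and det: "\<And>v w. (\<And>h. h \<in> H \<Longrightarrow> sgn3 (h v) = sgn3 (h w)) \<Longrightarrow> P v = P w"
    and P: "Def M P" "comb (sign_atoms sgn3 (Suc k)) P"
    and fibres: "\<And>v. finite {x. P (v(k := x))}"
  shows "\<exists>n. \<forall>v. P v \<longrightarrow> (\<exists>h\<in>H. a h k \<noteq> 0 \<and> abs_val (h v) \<le> zmul (int n) one)"
proof -
  have one: "0 < one" by (rule discrete_one [OF nd])
  have "\<exists>j. x = zmul j one" for x
  proof -
    obtain n where "abs_val x \<le> zmul (int n) one" using std [of "abs_val x"] by (auto simp: unbounded_def not_less)
    then show ?thesis using discrete_zmul [OF nd] by blast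
  qed
  then obtain \<iota> where \<iota>: "\<And>x. x = zmul (\<iota> x) one" by metis
  define pt where "pt f i = zmul (f i) one" for f :: "nat \<Rightarrow> int" and i :: nat
  define h' where "h' e f = \<iota> (b e) + (\<Sum>i<Suc k. a e i * f i)" for e f
  define lin where "lin e f = (\<Sum>i<Suc k. a e i * f i)" for e f
  define d where "d i = (if i = k then 1 else 0 :: int)" for i
  have h': "h (pt f) = zmul (h' h f) one" if "h \<in> H" for h f
  proof -
    have "zmul (h' h f) one = zmul (\<iota> (b h)) one + (\<Sum>i<Suc k. zmul (a h i * f i) one)"
      unfolding h'_def by (simp only: zmul_add_left zm.scale_sum_left)
    also have "\<dots> = affine_fun (Suc k) (a h) (b h) (pt f)"
      unfolding affine_fun_def pt_def by (simp only: \<iota> [symmetric] zmul_zmul)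
    finally show ?thesis using H(2) [OF that] by simp
  qed
  have sgn3_zmul: "sgn3 (zmul j one) = sgn j" for j
    using zmul_less_left [OF one, of j 0] zmul_eq_left [OF one, of j 0]
    by (auto simp: sgn3_def sgn_if)
  have inj: "inj (\<lambda>t. zmul t one)" by (rule injI) (simp add: zmul_eq_left [OF one])
  interpret tame_lines H h' lin "\<lambda>f. P (pt f)" d
  proof
    show "finite H" by (rule H)
    show "h' e (\<lambda>i. z i + t * u i) = h' e z + t * lin e u" for e z u t
      by (simp add: h'_def lin_def sum.distrib sum_distrib_left algebra_simps del: sum.lessThan_Suc)
    show "lin e (\<lambda>i. p * u i + q * w i) = p * lin e u + q * lin e w" for e p q u w
      by (simp add: lin_def sum.distrib sum_distrib_left algebra_simps del: sum.lessThan_Suc)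
    show "P (pt f) \<longleftrightarrow> P (pt g)" if "\<And>e. e \<in> H \<Longrightarrow> sgn (h' e f) = sgn (h' e g)" for f g
      using that by (intro det) (simp add: h' sgn3_zmul)
    show "finite {t. P (pt (\<lambda>i. z i + t * u i))} \<or> finite {t. \<not> P (pt (\<lambda>i. z i + t * u i))}" for z u
    proof -
      let ?Q = "\<lambda>v :: nat \<Rightarrow> 'a. P (\<lambda>i. pt z i + zmul (u i) (v 0))"
      have "Def M ?Q"
        by (rule Def_aff_subst [OF P(1), of "\<lambda>_. 1"]) (intro aff_add aff_const aff_zmul aff_var, simp)
      moreover have "comb (sign_atoms sgn3 1) ?Q"
        by (rule comb_sign_subst [OF P(2)]) (intro aff_add aff_const aff_zmul aff_var, simp)
      ultimately have "finite {x. ?Q (\<lambda>_. x)} \<or> finite {x. \<not> ?Q (\<lambda>_. x)}" by (rule unary_tame)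
      moreover have "pt (\<lambda>i. z i + t * u i) = (\<lambda>i. pt z i + zmul (u i) (zmul t one))" for t
        by (simp add: pt_def fun_eq_iff zmul_add_left zmul_zmul mult.commute)
      ultimately show ?thesis
        using finite_vimageI [OF _ inj, of "{x. ?Q (\<lambda>_. x)}"] finite_vimageI [OF _ inj, of "{x. \<not> ?Q (\<lambda>_. x)}"]
        by (auto simp: vimage_def)
    qed
    show "finite {t. P (pt (\<lambda>i. z i + t * d i))}" for z
    proof -
      have "pt (\<lambda>i. z i + t * d i) = (pt z)(k := zmul (z k + t) one)" for t
        by (auto simp: pt_def fun_eq_iff d_def)
      moreover have "inj (\<lambda>t. zmul (z k + t) one)" by (rule injI) (simp add: zmul_eq_left [OF one])
      then have "finite ((\<lambda>t. zmul (z k + t) one) -` {x. P ((pt z)(k := x))})"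
        by (rule finite_vimageI [OF fibres])
      ultimately show ?thesis by (simp add: vimage_def)
    qed
  qed
  obtain B where B: "\<And>f. P (pt f) \<Longrightarrow> \<exists>e\<in>H. lin e d \<noteq> 0 \<and> \<bar>h' e f\<bar> \<le> B"
    using bounded_distance by blast
  have lind: "lin e d = a e k" for e by (simp add: lin_def d_def)
  have "\<exists>h\<in>H. a h k \<noteq> 0 \<and> abs_val (h v) \<le> zmul (int (nat B)) one" if Pv: "P v" for v
  proof -
    define f where "f = (\<lambda>i. \<iota> (v i))"
    have v: "pt f = v" using \<iota> by (simp add: pt_def fun_eq_iff f_def)
    then obtain h where h: "h \<in> H" "a h k \<noteq> 0" "\<bar>h' h f\<bar> \<le> B"
      using B [of f] Pv unfolding lind by auto
    let ?j = "h' h f"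
    have hv: "h v = zmul ?j one" using h' [OF h(1), of f] v by simp
    have "zmul ?j one \<le> zmul (int (nat B)) one" "zmul (- ?j) one \<le> zmul (int (nat B)) one"
      using h(3) by (simp_all only: zmul_le_left [OF one])
    then have "abs_val (h v) \<le> zmul (int (nat B)) one" unfolding hv by (simp add: abs_val_le_iff zm.scale_minus_left)
    then show ?thesis using h by blast
  qed
  then show ?thesis by blast
qed

text \<open>
  In a dense group the walls themselves suffice. In a discrete group the distance from some
  transversal wall is bounded, so finitely many parallel translates of the walls suffice.
\<close>

lemma finite_fibres_hyperplanes:
  assumes P: "Def M P" "comb (sign_atoms sgn3 (Suc k)) P"
    and fibres: "\<And>v. finite {x. P (v(k := x))}"
  obtains E a b where "finite E" "\<And>h. h \<in> E \<Longrightarrow> h = affine_fun (Suc k) (a h) (b h) \<and> a h k \<noteq> 0"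
    "\<And>v. P v \<Longrightarrow> \<exists>h\<in>E. h v = 0"
proof -
  obtain H a b where H: "finite H" "\<And>h. h \<in> H \<Longrightarrow> h = affine_fun (Suc k) (a h) (b h)"
    and det: "\<And>v w. (\<And>h. h \<in> H \<Longrightarrow> sgn3 (h v) = sgn3 (h w)) \<Longrightarrow> P v = P w"
    using semilinear_forms [OF P(2)] by metis
  have "\<exists>E. finite E \<and> (\<forall>h\<in>E. \<exists>a b. h = affine_fun (Suc k) a b \<and> a k \<noteq> 0) \<and> (\<forall>v. P v \<longrightarrow> (\<exists>h\<in>E. h v = 0))"
  proof (cases dense)
    case True
    have "\<exists>h\<in>{h \<in> H. a h k \<noteq> 0}. h v = 0" if v: "P v" for v
    proof (rule ccontr)
      assume neg: "\<not> ?thesis"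
      have "infinite {x. P (v(k := x))}"
      proof (rule room_infinite_fibre [where H = H and a = a and b = b])
        show "finite H" "P v" by fact+
        show "h = affine_fun (Suc k) (a h) (b h)" if "h \<in> H" for h using that by (rule H)
        show "P w = P w'" if "\<And>h. h \<in> H \<Longrightarrow> sgn3 (h w) = sgn3 (h w')" for w w' using that by (rule det)
        fix n
        obtain g :: 'a where g: "0 < g" using nontrivial by blast
        let ?D = "insert g ((\<lambda>h. abs_val (h v)) ` {h \<in> H. a h k \<noteq> 0})"
        have D: "finite ?D" "?D \<noteq> {}" using H(1) by auto
        have "0 < Min ?D" using D g neg by (auto intro: abs_val_pos)
        then obtain \<epsilon> where "0 < \<epsilon>" "zmul (int n) \<epsilon> < Min ?D" using dense_small [OF True] by blast
        moreover have "Min ?D \<le> abs_val (h v)" if "h \<in> H" "a h k \<noteq> 0" for h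
          using that by (intro Min_le D) auto
        ultimately show "\<exists>\<epsilon>. 0 < \<epsilon> \<and> (\<forall>h\<in>H. a h k \<noteq> 0 \<longrightarrow> zmul (int n) \<epsilon> < abs_val (h v))"
          by (meson less_le_trans)
      qed
      then show False using fibres by blast
    qed
    moreover have "\<exists>a b. h = affine_fun (Suc k) a b \<and> a k \<noteq> 0" if "h \<in> {h \<in> H. a h k \<noteq> 0}" for h
      using H(2) [of h] that by blast
    moreover have "finite {h \<in> H. a h k \<noteq> 0}" using H(1) by simp
    ultimately show ?thesis by blast
  next
    case False
    have "\<exists>n. \<forall>v. P v \<longrightarrow> (\<exists>h\<in>H. a h k \<noteq> 0 \<and> abs_val (h v) \<le> zmul (int n) one)"
    proof (cases "\<exists>u. unbounded u")
      case True
      then show ?thesis using bounded_distance_nonstandard [OF False _ H det P(2) fibres] by blast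
    next
      case std: False
      then show ?thesis using bounded_distance_standard [OF False _ H det P fibres] by blast
    qed
    then obtain n where n: "\<And>v. P v \<Longrightarrow> \<exists>h\<in>H. a h k \<noteq> 0 \<and> abs_val (h v) \<le> zmul (int n) one" by blast
    define E where "E = (\<lambda>(h, j). affine_fun (Suc k) (a h) (b h - zmul j one)) `
      ({h \<in> H. a h k \<noteq> 0} \<times> {- int n..int n})"
    have "finite E" unfolding E_def using H(1) by simp
    moreover have "\<exists>a b. h = affine_fun (Suc k) a b \<and> a k \<noteq> 0" if "h \<in> E" for h
      using that unfolding E_def by auto
    moreover have "\<exists>h\<in>E. h v = 0" if Pv: "P v" for v
    proof -
      obtain h where h: "h \<in> H" "a h k \<noteq> 0" "abs_val (h v) \<le> zmul (int n) one" using n [OF Pv] by blast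
      obtain j where j: "j \<in> {- int n..int n}" "h v = zmul j one" using discrete_zmul [OF False h(3)] by blast
      have "affine_fun (Suc k) (a h) (b h) v = zmul j one" using j(2) H(2) [OF h(1)] by simp
      then have "affine_fun (Suc k) (a h) (b h - zmul j one) v = 0" by (simp add: affine_fun_def algebra_simps)
      moreover have "affine_fun (Suc k) (a h) (b h - zmul j one) \<in> E"
        unfolding E_def using h(1,2) j(1) by (intro image_eqI [of _ _ "(h, j)"]) auto
      ultimately show ?thesis by blast
    qed
    ultimately show ?thesis by blast
  qed
  then obtain E where E: "finite E" "\<forall>h\<in>E. \<exists>a b. h = affine_fun (Suc k) a b \<and> a k \<noteq> 0"
    "\<And>v. P v \<Longrightarrow> \<exists>h\<in>E. h v = 0" by blast
  then obtain a' b' where "\<And>h. h \<in> E \<Longrightarrow> h = affine_fun (Suc k) (a' h) (b' h) \<and> a' h k \<noteq> 0" by metis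
  then show thesis using that E by blast
qed


section \<open>Definable sets are linear\<close>

text \<open>
  A finite or cofinite subset \<open>S\<close> of an infinite group is cofinite iff every element is a sum of two
  elements of \<open>S\<close>, which is expressible in the group language.
\<close>

lemma cofinite_fibre_Def:
  assumes P: "Def M P" "depends (Suc k) P"
    and tame: "\<And>v. finite {x. P (v(k := x))} \<or> finite {x. \<not> P (v(k := x))}"
  obtains Q where "Def M Q" "depends k Q" "\<And>v. Q v \<longleftrightarrow> infinite {x. P (v(k := x))}"
proof -
  define Q where "Q v \<longleftrightarrow> (\<forall>g. \<exists>x. P (v(k := x)) \<and> P (v(k := g - x)))" for v
  have Q: "Q v \<longleftrightarrow> infinite {x. P (v(k := x))}" for v
  proof
    assume Q: "Q v"
    show "infinite {x. P (v(k := x))}"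
    proof
      let ?S = "{x. P (v(k := x))}"
      assume "finite ?S"
      then have "finite ((\<lambda>(x, y). x + y) ` (?S \<times> ?S))" by simp
      moreover have "UNIV \<subseteq> (\<lambda>(x, y). x + y) ` (?S \<times> ?S)"
      proof
        fix g
        obtain x where "P (v(k := x))" "P (v(k := g - x))" using Q unfolding Q_def by blast
        then show "g \<in> (\<lambda>(x, y). x + y) ` (?S \<times> ?S)" by (intro image_eqI [of _ _ "(x, g - x)"]) auto
      qed
      ultimately show False using infinite_UNIV finite_subset by blast
    qed
  next
    assume "infinite {x. P (v(k := x))}"
    then have fin: "finite {x. \<not> P (v(k := x))}" using tame by blast
    show "Q v"
      unfolding Q_def
    proof
      fix g :: 'a
      have "inj (\<lambda>x. g - x)"
      proof (rule injI)
        fix x y assume "g - x = g - y"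
        then have "(g - x) + (x + y) = (g - y) + (x + y)" by (simp only:)
        then show "x = y" by (simp add: algebra_simps)
      qed
      then have "finite ((\<lambda>x. g - x) -` {x. \<not> P (v(k := x))})" by (rule finite_vimageI [OF fin])
      then have "finite ({x. \<not> P (v(k := x))} \<union> (\<lambda>x. g - x) -` {x. \<not> P (v(k := x))})" using fin by simp
      then obtain x where "x \<notin> {x. \<not> P (v(k := x))} \<union> (\<lambda>x. g - x) -` {x. \<not> P (v(k := x))}"
        using infinite_UNIV by (metis ex_new_if_finite)
      then show "\<exists>x. P (v(k := x)) \<and> P (v(k := g - x))" by auto
    qed
  qed
  have "Def M Q"
  proof -
    \<comment> \<open>variable \<open>Suc k\<close> holds the sum \<open>g\<close>\<close>
    let ?g = "\<lambda>i. if i = k then (\<lambda>v :: nat \<Rightarrow> 'a. v (Suc k) - v k) else (\<lambda>v. v i)"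
    have "Def M (\<lambda>v. P (\<lambda>i. ?g i v))"
    proof (rule Def_aff_subst [OF P(1), of "\<lambda>i. Suc (Suc k) + Suc i"])
      fix i
      show "aff (Suc (Suc k) + Suc i) (?g i)" by (cases "i = k") (simp_all add: aff_diff aff_var)
    qed
    then have "Def M (\<lambda>v. P v \<and> P (\<lambda>i. ?g i v))" by (rule Def_and [OF P(1)])
    then have "Def M (\<lambda>v. \<forall>g. \<exists>x. (\<lambda>v. P v \<and> P (\<lambda>i. ?g i v)) ((v(Suc k := g))(k := x)))"
      using Def_all [OF Def_ex] by blast
    moreover have "P ((v(Suc k := g))(k := x)) = P (v(k := x))" for v g x
      by (rule dependsD [OF P(2)]) auto
    moreover have "P (\<lambda>i. ?g i ((v(Suc k := g))(k := x))) = P (v(k := g - x))" for v g x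
      by (rule dependsD [OF P(2)]) auto
    ultimately show ?thesis unfolding Q_def [abs_def] by simp
  qed
  moreover have "depends k Q"
  proof (rule dependsI)
    fix v w :: "nat \<Rightarrow> 'a" assume "\<And>i. i < k \<Longrightarrow> v i = w i"
    then have "P (v(k := x)) = P (w(k := x))" for x
      by (intro dependsD [OF P(2)]) (auto simp: less_Suc_eq)
    then show "Q v = Q w" by (simp add: Q_def)
  qed
  ultimately show thesis using that Q by blast
qed

text \<open>
  Cosets are split twice: once to make the fibres finite or cofinite, and once more after the
  cofinite fibres have been complemented, because the set of their base points brings new congruences.
\<close>

theorem Def_linear:
  assumes "Def M P" "depends k P"
  shows "Comb zt k P"
  using assms
proof (induction k arbitrary: P)
  case 0
  have "P = (\<lambda>_. P undefined)" using dependsD [OF 0(2)] by (intro ext) auto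
  then show ?case by (metis comb_const)
next
  case (Suc k)
  have fin_case: "Comb zt (Suc k) P" if P: "Def M P" "depends (Suc k) P" "\<And>v. finite {x. P (v(k := x))}" for P
  proof -
    have "Comb sgn3 (Suc k) P" using ordered_reduct [OF P(1)] Comb_restrict P(2) by blast
    then obtain m where m: "1 \<le> m"
      "\<And>c. comb (sign_atoms sgn3 (Suc k)) (\<lambda>v. P (\<lambda>i. c i + zmul m (v i)))" by (rule coset_split) blast
    show ?thesis
    proof (rule coset_join [OF zt_sign m(1) P(2)])
      fix c :: "nat \<Rightarrow> 'a"
      define Z where "Z v \<longleftrightarrow> P (\<lambda>i. c i + zmul m (v i))" for v
      have ZDef: "Def M Z"
        unfolding Z_def by (rule Def_aff_subst [OF P(1), of "\<lambda>i. Suc i"]) (intro aff_add aff_const aff_zmul aff_var, simp)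
      have Zsl: "comb (sign_atoms sgn3 (Suc k)) Z" unfolding Z_def by (rule m)
      have Zfin: "finite {x. Z (v(k := x))}" for v
      proof -
        have "inj (\<lambda>x. c k + zmul m x)" using m(1) by (intro injI) (simp add: zmul_eq_iff)
        then have "finite ((\<lambda>x. c k + zmul m x) -` {x. P ((\<lambda>i. c i + zmul m (v i))(k := x))})"
          by (rule finite_vimageI [OF P(3)])
        moreover have "(\<lambda>i. c i + zmul m ((v(k := x)) i)) = (\<lambda>i. c i + zmul m (v i))(k := c k + zmul m x)" for x
          by auto
        ultimately show ?thesis by (simp add: Z_def vimage_def)
      qed
      have Zdep: "depends (Suc k) Z"
        by (rule Comb_depends [of sgn3], rule comb_mono [OF Zsl]) simp
      obtain E a b where E: "finite E" "\<And>h. h \<in> E \<Longrightarrow> h = affine_fun (Suc k) (a h) (b h) \<and> a h k \<noteq> 0"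
        "\<And>v. Z v \<Longrightarrow> \<exists>h\<in>E. h v = 0"
        using finite_fibres_hyperplanes [OF ZDef Zsl Zfin] by metis
      have aff: "aff (Suc k) h" if "h \<in> E" for h
        using E(2) [OF that] aff_affine_fun [of "Suc k" "a h" "b h"] by simp
      \<comment> \<open>\<open>Z\<close> is over \<open>D h\<close> the graph of the solution \<open>x\<close> of \<open>h = 0\<close>\<close>
      define D where "D h v \<longleftrightarrow> (\<exists>x. Z (v(k := x)) \<and> h (v(k := x)) = 0)" for h :: "(nat \<Rightarrow> 'a) \<Rightarrow> 'a" and v
      have "Comb zt (Suc k) (D h)" if h: "h \<in> E" for h
      proof -
        have "Def M (D h)"
          unfolding D_def
          by (rule Def_ex [of M "\<lambda>v. Z v \<and> h v = 0"]) (intro Def_and ZDef Def_aff_eq [OF aff [OF h] aff_const])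
        moreover have "depends k (D h)"
        proof (rule dependsI)
          fix v w :: "nat \<Rightarrow> 'a" assume "\<And>i. i < k \<Longrightarrow> v i = w i"
          then have "Z (v(k := x)) = Z (w(k := x))" "h (v(k := x)) = h (w(k := x))" for x
            by (auto intro!: dependsD [OF Zdep] dependsD [OF aff_depends [OF aff [OF h]]] simp: less_Suc_eq)
          then show "D h v = D h w" by (simp add: D_def)
        qed
        ultimately show ?thesis using Suc.IH Comb_mono by (metis le_SucI order_refl)
      qed
      then have "Comb zt (Suc k) (\<lambda>v. \<exists>h\<in>E. h v = 0 \<and> D h v)"
        using aff by (intro comb_bex E comb_and Comb_eq aff_const) auto
      moreover have "Z v \<longleftrightarrow> (\<exists>h\<in>E. h v = 0 \<and> D h v)" for v
      proof
        assume v: "Z v"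
        then obtain h where "h \<in> E" "h v = 0" using E(3) by blast
        moreover have "D h v" unfolding D_def using v \<open>h v = 0\<close> by (intro exI [of _ "v k"]) simp
        ultimately show "\<exists>h\<in>E. h v = 0 \<and> D h v" by blast
      next
        assume "\<exists>h\<in>E. h v = 0 \<and> D h v"
        then obtain h x where h: "h \<in> E" "h v = 0" "Z (v(k := x))" "h (v(k := x)) = 0" unfolding D_def by blast
        have "h v = affine_fun k (a h) (b h) v + zmul (a h k) (v k)"
          "h (v(k := x)) = affine_fun k (a h) (b h) v + zmul (a h k) x"
          using affine_fun_Suc [of k "a h" "b h" v "v k"] affine_fun_Suc [of k "a h" "b h" v x] E(2) [OF h(1)]
          by simp_all
        then have "affine_fun k (a h) (b h) v + zmul (a h k) x = affine_fun k (a h) (b h) v + zmul (a h k) (v k)"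
          using h(2,4) by (simp only:)
        then have "zmul (a h k) (x - v k) = 0" by (simp add: zm.scale_right_diff_distrib)
        then have "x = v k" using E(2) [OF h(1)] by (simp add: zmul_eq_0_iff)
        then show "Z v" using h(3) by simp
      qed
      ultimately show "Comb zt (Suc k) (\<lambda>v. P (\<lambda>i. c i + zmul m (v i)))" by (simp add: Z_def)
    qed
  qed
  have "Comb sgn3 (Suc k) P" using ordered_reduct [OF Suc.prems(1)] Comb_restrict Suc.prems(2) by blast
  then obtain m where m: "1 \<le> m"
    "\<And>c. comb (sign_atoms sgn3 (Suc k)) (\<lambda>v. P (\<lambda>i. c i + zmul m (v i)))" by (rule coset_split) blast
  show ?case
  proof (rule coset_join [OF zt_sign m(1) Suc.prems(2)])
    fix c :: "nat \<Rightarrow> 'a"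
    define Y where "Y v \<longleftrightarrow> P (\<lambda>i. c i + zmul m (v i))" for v
    have YDef: "Def M Y"
      unfolding Y_def by (rule Def_aff_subst [OF Suc.prems(1), of "\<lambda>i. Suc i"]) (intro aff_add aff_const aff_zmul aff_var, simp)
    have Ysl: "comb (sign_atoms sgn3 (Suc k)) Y" unfolding Y_def by (rule m)
    have Ydep: "depends (Suc k) Y"
      by (rule Comb_depends [of sgn3], rule comb_mono [OF Ysl]) simp
    have tame: "finite {x. Y (v(k := x))} \<or> finite {x. \<not> Y (v(k := x))}" for v
    proof -
      let ?g = "\<lambda>i. if i = k then (\<lambda>w :: nat \<Rightarrow> 'a. w 0) else (\<lambda>_. v i)"
      have g: "aff 1 (?g i)" for i by (simp add: aff_var)
      have "finite {x. Y (\<lambda>i. ?g i (\<lambda>_. x))} \<or> finite {x. \<not> Y (\<lambda>i. ?g i (\<lambda>_. x))}"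
        using unary_tame [OF Def_aff_subst [OF YDef g] comb_sign_subst [OF Ysl g]] by simp
      moreover have "(\<lambda>i. ?g i (\<lambda>_. x)) = v(k := x)" for x by auto
      ultimately show ?thesis by simp
    qed
    obtain Q where Q: "Def M Q" "depends k Q" "\<And>v. Q v \<longleftrightarrow> infinite {x. Y (v(k := x))}"
      using cofinite_fibre_Def [OF YDef Ydep tame] by metis
    have Qx: "Q (v(k := x)) = Q v" for v x by (rule dependsD [OF Q(2)]) auto
    have "Comb zt (Suc k) (\<lambda>v. Y v \<longleftrightarrow> \<not> Q v)"
    proof (rule fin_case)
      show "Def M (\<lambda>v. Y v \<longleftrightarrow> \<not> Q v)" by (intro Def_iff Def_not YDef Q)
      have "depends (Suc k) Q" using Q(2) by (rule depends_mono) simp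
      then show "depends (Suc k) (\<lambda>v. Y v \<longleftrightarrow> \<not> Q v)"
        using Ydep unfolding depends_def by metis
      show "finite {x. Y (v(k := x)) \<longleftrightarrow> \<not> Q (v(k := x))}" for v
        unfolding Qx using Q(3) [of v] tame [of v] by (cases "Q v") auto
    qed
    moreover have "Comb zt (Suc k) Q" using Suc.IH [OF Q(1,2)] by (rule Comb_mono) simp
    ultimately have "Comb zt (Suc k) (\<lambda>v. (Y v \<longleftrightarrow> \<not> Q v) \<longleftrightarrow> \<not> Q v)"
      by (rule comb_iff [OF _ comb_not])
    moreover have "(\<lambda>v. (Y v \<longleftrightarrow> \<not> Q v) \<longleftrightarrow> \<not> Q v) = Y" by auto
    ultimately have "Comb zt (Suc k) Y" by (simp only:)
    then show "Comb zt (Suc k) (\<lambda>v. P (\<lambda>i. c i + zmul m (v i)))" by (simp add: Y_def [abs_def])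
  qed
qed

end


section \<open>Archimedean groups of finite rank are regular\<close>

text \<open>
  The least multiple of \<open>m g\<close> that is not below \<open>a\<close> is less than \<open>a + m g\<close>.
\<close>

lemma archimedean_regular:
  assumes arch: "archimedean_group TYPE('b::linordered_ab_group_add)" and "1 \<le> m" "0 < (g::'b)"
  shows "\<exists>y. a \<le> zmul m y \<and> zmul m y < a + zmul m g"
proof -
  define G where "G = zmul m g"
  have G: "0 < G" unfolding G_def using assms by (intro zmul_pos) auto
  obtain n where n: "a < zmul n G" using arch G unfolding archimedean_group_def by (metis less_irrefl)
  obtain n' where n': "- a < zmul n' G" using arch G unfolding archimedean_group_def by (metis less_irrefl)
  have low: "zmul (- n') G < a" using n' by (simp add: zm.scale_minus_left minus_less_iff)
  define j where "j = (LEAST j::nat. a \<le> zmul (- n' + int j) G)"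
  have "zmul (- n') G < zmul n G" using low n by simp
  then have "- n' < n" by (simp only: zmul_less_left [OF G])
  then have "- n' + int (nat (n + n')) = n" by simp
  then have "\<exists>j::nat. a \<le> zmul (- n' + int j) G" using n by (metis less_imp_le)
  then have j: "a \<le> zmul (- n' + int j) G" unfolding j_def by (rule LeastI_ex)
  have "j \<noteq> 0" using j low by (intro notI) simp
  then have "\<not> a \<le> zmul (- n' + int (j - 1)) G" unfolding j_def by (intro not_less_Least) simp
  moreover have "zmul (- n' + int j) G = zmul (- n' + int (j - 1)) G + G"
    using \<open>j \<noteq> 0\<close> zmul_Suc [of "- n' + int (j - 1)" G] by (simp add: of_nat_diff add.commute)
  ultimately have "zmul (- n' + int j) G < a + G" by (simp add: not_le)
  moreover have "zmul (- n' + int j) G = zmul m (zmul (- n' + int j) g)"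
    by (simp add: G_def zmul_zmul mult.commute)
  ultimately show ?thesis using j unfolding G_def by metis
qed

lemma sum_hull_frac: "finite I \<Longrightarrow> (\<Sum>i\<in>I. hull_frac (f i) 1) = hull_frac (\<Sum>i\<in>I. f i) 1"
  by (induction I rule: finite_induct) (simp_all add: hull_frac_0 [symmetric] hull_frac_add)

lemma hull_scale_of_int: "hull_scale (of_int n) (hull_frac a 1) = hull_frac (zmul n a) 1"
  using hull_scale_Fract [of 1 1 n a] by (simp add: Fract_of_int_eq)

lemma rat_common_denominator:
  fixes q :: "nat \<Rightarrow> rat"
  obtains d :: int and c :: "nat \<Rightarrow> int" where "d \<noteq> 0" "\<And>i. i < n \<Longrightarrow> of_int d * q i = of_int (c i)"
proof -
  have "\<exists>d::int. d \<noteq> 0 \<and> (\<forall>i<n. \<exists>c::int. of_int d * q i = of_int c)"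
  proof (induction n)
    case (Suc n)
    then obtain d :: int where d: "d \<noteq> 0" "\<forall>i<n. \<exists>c::int. of_int d * q i = of_int c" by blast
    obtain r s where q: "q n = Fract r s" "s \<noteq> 0" by (cases "q n") auto
    have "of_int (s * d) * q i = of_int s * (of_int d * q i)" for i by simp
    then have "\<exists>c::int. of_int (s * d) * q i = of_int c" if "i < n" for i
      using d(2) that by (metis of_int_mult)
    moreover have "of_int (s * d) * q n = of_int (d * r)"
      using q(2) by (simp add: q Fract_of_int_quotient)
    ultimately have "\<exists>c::int. of_int (s * d) * q i = of_int c" if "i < Suc n" for i
      using that unfolding less_Suc_eq by blast
    then show ?case using d(1) q(2) by (intro exI [of _ "s * d"]) simp
  qed (intro exI [of _ 1], simp)
  then show thesis using that by metis
qed

text \<open>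
  Linear dependence over the rationals in the divisible hull, with denominators cleared.
\<close>

lemma finite_rank_relation:
  assumes "finite_rank TYPE('b::linordered_ab_group_add)"
  obtains R where "\<And>x :: nat \<Rightarrow> 'b. \<exists>c. (\<exists>i<R. c i \<noteq> (0::int)) \<and> (\<Sum>i<R. zmul (c i) (x i)) = 0"
proof -
  obtain B where "finite_dimensional_vector_space (hull_scale :: rat \<Rightarrow> 'b divisible_hull \<Rightarrow> _) B"
    using assms unfolding finite_rank_def by blast
  then interpret V: finite_dimensional_vector_space "hull_scale :: rat \<Rightarrow> 'b divisible_hull \<Rightarrow> _" B .
  have "\<exists>c. (\<exists>i<Suc (card B). c i \<noteq> (0::int)) \<and> (\<Sum>i<Suc (card B). zmul (c i) (x i)) = 0" for x :: "nat \<Rightarrow> 'b"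
  proof -
    let ?R = "Suc (card B)"
    define w where "w i = hull_frac (x i) 1" for i
    have "\<exists>q :: nat \<Rightarrow> rat. (\<exists>i<?R. q i \<noteq> 0) \<and> (\<Sum>i<?R. hull_scale (q i) (w i)) = 0"
    proof (cases "inj_on w {..<?R}")
      case True
      then have "card (w ` {..<?R}) = ?R" by (simp add: card_image)
      then have "\<not> V.independent (w ` {..<?R})"
        using V.independent_card_le_dim [of "w ` {..<?R}" UNIV] by auto
      then obtain u where u: "\<exists>v\<in>w ` {..<?R}. u v \<noteq> 0" "(\<Sum>v\<in>w ` {..<?R}. hull_scale (u v) v) = 0"
        using V.dependent_finite [of "w ` {..<?R}"] by auto
      have "(\<Sum>i<?R. hull_scale (u (w i)) (w i)) = 0"
        using u(2) by (simp only: sum.reindex [OF True] comp_def)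
      then show ?thesis using u(1) by (intro exI [of _ "\<lambda>i. u (w i)"]) auto
    next
      case False
      then obtain i j where ij: "i < ?R" "j < ?R" "i \<noteq> j" "w i = w j" by (auto simp: inj_on_def)
      define q :: "nat \<Rightarrow> rat" where "q l = (if l = i then 1 else if l = j then - 1 else 0)" for l
      have "(\<Sum>l<?R. hull_scale (q l) (w l)) = (\<Sum>l\<in>{i, j}. hull_scale (q l) (w l))"
        by (rule sum.mono_neutral_right) (use ij in \<open>auto simp: q_def\<close>)
      also have "\<dots> = 0" using ij by (simp add: q_def)
      finally show ?thesis using ij(1) by (intro exI [of _ q]) (auto simp: q_def)
    qed
    then obtain q where q: "\<exists>i<?R. q i \<noteq> 0" "(\<Sum>i<?R. hull_scale (q i) (w i)) = 0" by blast
    obtain d :: int and c :: "nat \<Rightarrow> int" where dc: "d \<noteq> 0" "\<And>i. i < ?R \<Longrightarrow> of_int d * q i = of_int (c i)"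
      using rat_common_denominator [of ?R q] by blast
    have "hull_frac (\<Sum>i<?R. zmul (c i) (x i)) 1 = (\<Sum>i<?R. hull_scale (of_int (c i)) (w i))"
      unfolding w_def by (simp only: hull_scale_of_int sum_hull_frac [OF finite_lessThan])
    also have "\<dots> = (\<Sum>i<?R. hull_scale (of_int d) (hull_scale (q i) (w i)))"
      by (rule sum.cong) (simp_all add: dc(2) [symmetric])
    also have "\<dots> = 0" by (simp only: V.scale_sum_right [symmetric] q(2) V.scale_zero_right)
    finally have "hull_frac (\<Sum>i<?R. zmul (c i) (x i)) 1 = hull_frac 0 1" by (simp only: hull_frac_0)
    then have "\<exists>k. k \<noteq> 0 \<and> zmul (k * 1) (\<Sum>i<?R. zmul (c i) (x i)) = zmul (k * 1) (0::'b)"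
      by (simp only: hull_frac_eq_iff one_neq_zero not_False_eq_True)
    then have "(\<Sum>i<?R. zmul (c i) (x i)) = 0" by (auto simp only: zmul_eq_0_iff zmul_0_right mult_1_right)
    moreover obtain i where "i < ?R" "q i \<noteq> 0" using q(1) by blast
    then have "c i \<noteq> 0" using dc(1) dc(2) [of i] by auto
    ultimately show ?thesis using \<open>i < ?R\<close> by blast
  qed
  then show thesis by (rule that)
qed

text \<open>
  For a prime \<open>p\<close>: the classes of \<open>x 0, ..., x (d - 1)\<close> in \<open>G/pG\<close> are linearly independent over the field with \<open>p\<close> elements.
\<close>

definition indep_mod :: "int \<Rightarrow> nat \<Rightarrow> (nat \<Rightarrow> 'b::linordered_ab_group_add) \<Rightarrow> bool" where
  "indep_mod p d x \<longleftrightarrow> (\<forall>c. (\<exists>y. (\<Sum>i<d. zmul (c i) (x i)) = zmul p y) \<longrightarrow> (\<forall>i<d. p dvd c i))"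

text \<open>
  Infinite descent: all coefficients of an integral relation are divisible by \<open>p\<close>, and the relation
  can be divided by \<open>p\<close> because the group is torsion-free.
\<close>

lemma indep_mod_relation:
  assumes x: "indep_mod p d x" and p: "1 < p" and rel: "(\<Sum>i<d. zmul (c i) (x i)) = 0"
  shows "\<forall>i<d. c i = 0"
  using rel
proof (induction "nat (\<Sum>i<d. \<bar>c i\<bar>)" arbitrary: c rule: less_induct)
  case less
  have "\<forall>i<d. p dvd c i"
    using x less.prems unfolding indep_mod_def by (metis zmul_0_right)
  then have c: "c i = p * (c i div p)" if "i < d" for i using that by simp
  have "(\<Sum>i<d. zmul (c i) (x i)) = (\<Sum>i<d. zmul p (zmul (c i div p) (x i)))"
    by (rule sum.cong) (use c in \<open>auto simp: zmul_zmul\<close>)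
  then have "zmul p (\<Sum>i<d. zmul (c i div p) (x i)) = 0"
    using less.prems by (simp only: zm.scale_sum_right)
  then have rel: "(\<Sum>i<d. zmul (c i div p) (x i)) = 0" using p by (simp add: zmul_eq_0_iff)
  show ?case
  proof (rule ccontr)
    assume "\<not> ?case"
    then obtain i where i: "i < d" "c i \<noteq> 0" by blast
    have le: "\<bar>c j div p\<bar> \<le> \<bar>c j\<bar>" if "j < d" for j
    proof -
      have "\<bar>c j\<bar> = p * \<bar>c j div p\<bar>" using c [OF that] p by (metis abs_mult abs_of_pos less_trans zero_less_one)
      moreover have "1 * \<bar>c j div p\<bar> \<le> p * \<bar>c j div p\<bar>" using p by (intro mult_right_mono) auto
      ultimately show ?thesis by simp
    qed
    have "c i div p \<noteq> 0" using c [OF i(1)] i(2) by auto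
    have "\<bar>c i div p\<bar> < \<bar>c i\<bar>"
    proof -
      have "\<bar>c i\<bar> = p * \<bar>c i div p\<bar>" using c [OF i(1)] p by (metis abs_mult abs_of_pos less_trans zero_less_one)
      moreover have "1 * \<bar>c i div p\<bar> < p * \<bar>c i div p\<bar>"
        using p \<open>c i div p \<noteq> 0\<close> by (intro mult_strict_right_mono) auto
      ultimately show ?thesis by simp
    qed
    then have "(\<Sum>i<d. \<bar>c i div p\<bar>) < (\<Sum>i<d. \<bar>c i\<bar>)"
      using i(1) le by (intro sum_strict_mono_ex1) auto
    moreover have "0 \<le> (\<Sum>i<d. \<bar>c i div p\<bar>)" by (rule sum_nonneg) simp
    ultimately have "nat (\<Sum>i<d. \<bar>c i div p\<bar>) < nat (\<Sum>i<d. \<bar>c i\<bar>)" by linarith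
    then have "\<forall>i<d. c i div p = 0" using rel by (rule less.hyps)
    then show False using i \<open>c i div p \<noteq> 0\<close> by blast
  qed
qed

lemma indep_mod_bound:
  assumes R: "\<And>x :: nat \<Rightarrow> 'b. \<exists>c. (\<exists>i<R. c i \<noteq> (0::int)) \<and> (\<Sum>i<R. zmul (c i) (x i)) = 0"
    and x: "indep_mod p d (x :: nat \<Rightarrow> 'b::linordered_ab_group_add)" and p: "1 < p"
  shows "d < R"
proof (rule ccontr)
  assume "\<not> d < R"
  then have Rd: "R \<le> d" by simp
  obtain c where c: "\<exists>i<R. c i \<noteq> 0" "(\<Sum>i<R. zmul (c i) (x i)) = 0" using R by blast
  define c' where "c' i = (if i < R then c i else 0)" for i
  have "(\<Sum>i<d. zmul (c' i) (x i)) = (\<Sum>i<R. zmul (c' i) (x i))"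
    by (rule sum.mono_neutral_right) (use Rd in \<open>auto simp: c'_def\<close>)
  also have "\<dots> = 0" using c(2) by (simp add: c'_def)
  finally have "\<forall>i<d. c' i = 0" by (rule indep_mod_relation [OF x p])
  then show False using c(1) Rd by (metis c'_def less_le_trans)
qed

text \<open>
  Independence modulo \<open>p\<close> implies independence over the integers, so the length of an independent
  family is bounded. A family of maximal length generates \<open>G/pG\<close>, with coefficients in \<open>{0..<p}\<close>.
\<close>

lemma finite_index_prime:
  assumes R: "\<And>x :: nat \<Rightarrow> 'b. \<exists>c. (\<exists>i<R. c i \<noteq> (0::int)) \<and> (\<Sum>i<R. zmul (c i) (x i)) = 0"
    and p: "prime (p::int)"
  shows "\<exists>C :: 'b::linordered_ab_group_add set. finite C \<and> (\<forall>x. \<exists>c\<in>C. \<exists>y. x = c + zmul p y)"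
proof -
  have p1: "1 < p" using p by (rule prime_gt_1_int)
  define d where "d = (GREATEST d. \<exists>x :: nat \<Rightarrow> 'b. indep_mod p d x)"
  have bound: "e \<le> R" if "\<exists>x :: nat \<Rightarrow> 'b. indep_mod p e x" for e
    using that indep_mod_bound [OF R _ p1] by (auto intro: less_imp_le)
  let ?Q = "\<lambda>e. \<exists>x :: nat \<Rightarrow> 'b. indep_mod p e x"
  have "\<exists>e. ?Q e"
    by (rule exI [of _ 0], rule exI [of _ "\<lambda>_. 0"]) (simp add: indep_mod_def)
  from GreatestI_ex_nat [of ?Q R, OF this bound]
  obtain x where x: "indep_mod p d (x :: nat \<Rightarrow> 'b)" unfolding d_def by blast
  have max: "e \<le> d" if "indep_mod p e (x' :: nat \<Rightarrow> 'b)" for e x'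
    unfolding d_def by (rule Greatest_le_nat [of ?Q e R, OF exI [of "indep_mod p e", OF that] bound])
  define E where "E = {e :: nat \<Rightarrow> int. \<forall>i. (i \<in> {..<d} \<longrightarrow> e i \<in> {0..<p}) \<and> (i \<notin> {..<d} \<longrightarrow> e i = 0)}"
  define C where "C = (\<lambda>e. \<Sum>i<d. zmul (e i) (x i)) ` E"
  have "finite E" unfolding E_def by (rule finite_set_of_finite_funs) auto
  then have "finite C" by (simp add: C_def)
  moreover have "\<exists>c\<in>C. \<exists>z. y = c + zmul p z" for y
  proof -
    have "\<not> indep_mod p (Suc d) (x(d := y))" using max [of "Suc d"] by auto
    then obtain c z i where c: "(\<Sum>i<Suc d. zmul (c i) ((x(d := y)) i)) = zmul p z" "i < Suc d" "\<not> p dvd c i"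
      unfolding indep_mod_def by blast
    have cz: "(\<Sum>i<d. zmul (c i) (x i)) + zmul (c d) y = zmul p z" using c(1) by simp
    have "\<not> p dvd c d"
    proof
      assume dvd: "p dvd c d"
      then obtain t where t: "c d = p * t" by blast
      have "(\<Sum>i<d. zmul (c i) (x i)) = zmul p z - zmul (c d) y" using cz by (simp add: eq_diff_eq)
      also have "\<dots> = zmul p (z - zmul t y)" by (simp add: t zm.scale_right_diff_distrib zmul_zmul)
      finally have "\<forall>i<d. p dvd c i" using x unfolding indep_mod_def by blast
      then show False using c(2,3) dvd by (auto simp: less_Suc_eq)
    qed
    then have "coprime p (c d)" using p by (rule prime_imp_coprime [rotated])
    \<comment> \<open>the coefficient of \<open>y\<close> is invertible modulo \<open>p\<close>\<close>
    then obtain u v where uv: "u * c d + v * p = 1"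
      using bezout_int [of "c d" p] by (metis coprime_iff_gcd_eq_1 gcd.commute)
    define e where "e i = (if i < d then (- u * c i) mod p else 0)" for i
    define f where "f i = (- u * c i) div p" for i
    have ef: "- u * c i = e i + p * f i" if "i < d" for i
      using that by (simp add: e_def f_def)
    have "y = zmul (u * c d + v * p) y" by (simp add: uv)
    also have "\<dots> = zmul u (zmul (c d) y) + zmul p (zmul v y)"
      by (simp add: zmul_add_left zmul_zmul mult.commute)
    also have "zmul (c d) y = zmul p z - (\<Sum>i<d. zmul (c i) (x i))" using cz by (simp add: eq_diff_eq add.commute)
    also have "zmul u (zmul p z - (\<Sum>i<d. zmul (c i) (x i))) =
        zmul p (zmul u z) + (\<Sum>i<d. zmul (- u * c i) (x i))"
      by (simp add: zm.scale_right_diff_distrib zm.scale_sum_right zmul_zmul mult.commute zm.scale_minus_left sum_negf)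
    also have "(\<Sum>i<d. zmul (- u * c i) (x i)) = (\<Sum>i<d. zmul (e i) (x i) + zmul p (zmul (f i) (x i)))"
      by (rule sum.cong) (simp_all only: lessThan_iff ef zmul_add_left zmul_zmul)
    also have "\<dots> = (\<Sum>i<d. zmul (e i) (x i)) + zmul p (\<Sum>i<d. zmul (f i) (x i))"
      by (simp only: sum.distrib zm.scale_sum_right)
    finally have "y = (\<Sum>i<d. zmul (e i) (x i)) +
        zmul p (zmul u z + (\<Sum>i<d. zmul (f i) (x i)) + zmul v y)"
      by (simp add: zmul_add_right algebra_simps)
    moreover have "e \<in> E" using p1 by (auto simp: E_def e_def)
    ultimately show ?thesis unfolding C_def by blast
  qed
  ultimately show ?thesis by blast
qed

text \<open>
  Induction on \<open>n\<close>: for \<open>n = p m\<close> the index of \<open>nG\<close> is at most that of \<open>pG\<close> times that of \<open>mG\<close>.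
\<close>

lemma finite_rank_finite_index:
  assumes rank: "finite_rank TYPE('b::linordered_ab_group_add)" and n: "1 \<le> n"
  shows "\<exists>C :: 'b set. finite C \<and> (\<forall>x. \<exists>c\<in>C. \<exists>y. x = c + zmul n y)"
proof -
  obtain R where R: "\<And>x :: nat \<Rightarrow> 'b. \<exists>c. (\<exists>i<R. c i \<noteq> (0::int)) \<and> (\<Sum>i<R. zmul (c i) (x i)) = 0"
    using finite_rank_relation [OF rank] by metis
  have "\<exists>C :: 'b set. finite C \<and> (\<forall>x. \<exists>c\<in>C. \<exists>y. x = c + zmul (int k) y)" if "1 \<le> k" for k
    using that
  proof (induction k rule: less_induct)
    case (less k)
    show ?case
    proof (cases "k = 1")
      case True
      then show ?thesis by (intro exI [of _ "{0}"]) auto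
    next
      case False
      then obtain p where p: "prime p" "p dvd k" using prime_factor_nat by blast
      then obtain m where m: "k = p * m" by blast
      have "0 < m" using m less.prems by (cases m) auto
      moreover have "1 * m < p * m"
        using prime_gt_1_nat [OF p(1)] \<open>0 < m\<close> by (rule mult_strict_right_mono)
      ultimately have m1: "1 \<le> m" "m < k" using m by simp_all
      obtain C where C: "finite C" "\<And>x :: 'b. \<exists>c\<in>C. \<exists>y. x = c + zmul (int p) y"
        using finite_index_prime [OF R, of "int p"] p(1) by auto
      obtain D where D: "finite D" "\<And>x :: 'b. \<exists>c\<in>D. \<exists>y. x = c + zmul (int m) y"
        using less.IH [OF m1(2,1)] by blast
      have "\<exists>c\<in>(\<lambda>(c, c'). c + zmul (int p) c') ` (C \<times> D). \<exists>y. x = c + zmul (int k) y" for x :: 'b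
      proof -
        obtain c y where c: "c \<in> C" "x = c + zmul (int p) y" using C(2) by blast
        obtain c' y' where c': "c' \<in> D" "y = c' + zmul (int m) y'" using D(2) by blast
        have "x = (c + zmul (int p) c') + zmul (int k) y'"
          by (simp add: c c' m zmul_add_right zmul_zmul add.assoc)
        then show ?thesis using c(1) c'(1) by auto
      qed
      moreover have "finite ((\<lambda>(c, c'). c + zmul (int p) c') ` (C \<times> D))" using C(1) D(1) by simp
      ultimately show ?thesis by blast
    qed
  qed
  from this [of "nat n"] n show ?thesis by simp
qed


section \<open>Transfer along elementary equivalence\<close>

text \<open>
  Multiples are counted from one, since zero is not a term of the language.
\<close>

fun multiple_term :: "nat \<Rightarrow> nat \<Rightarrow> group_symbol fo_term" where
  "multiple_term 0 i = FVar i"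
| "multiple_term (Suc n) i = FApp PlusSym [FVar i, multiple_term n i]"

definition plus_term :: "group_symbol fo_term \<Rightarrow> group_symbol fo_term \<Rightarrow> group_symbol fo_term" where
  "plus_term s t = FApp PlusSym [s, t]"

definition less_fm :: "group_symbol fo_term \<Rightarrow> group_symbol fo_term \<Rightarrow> (group_symbol, order_symbol) fo_formula" where
  "less_fm s t = FRel LessSym [s, t]"

abbreviation ordered_structure :: "('a::linordered_ab_group_add, group_symbol, order_symbol) fo_structure" where
  "ordered_structure \<equiv> ordered_group_structure"

lemma ordered_structure_simps [simp]:
  "term_val ordered_structure v (plus_term s t) = term_val ordered_structure v s + term_val ordered_structure v t"
  "wf_term (ordered_structure :: ('a::linordered_ab_group_add, group_symbol, order_symbol) fo_structure) (plus_term s t) \<longleftrightarrow>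
    wf_term (ordered_structure :: ('a::linordered_ab_group_add, group_symbol, order_symbol) fo_structure) s \<and>
    wf_term (ordered_structure :: ('a::linordered_ab_group_add, group_symbol, order_symbol) fo_structure) t"
  "term_vars (plus_term s t) = term_vars s \<union> term_vars t"
  "satisfies ordered_structure v (less_fm s t) \<longleftrightarrow> term_val ordered_structure v s < term_val ordered_structure v t"
  "wf_formula (ordered_structure :: ('a::linordered_ab_group_add, group_symbol, order_symbol) fo_structure) (less_fm s t) \<longleftrightarrow>
    wf_term (ordered_structure :: ('a::linordered_ab_group_add, group_symbol, order_symbol) fo_structure) s \<and>
    wf_term (ordered_structure :: ('a::linordered_ab_group_add, group_symbol, order_symbol) fo_structure) t"
  "free_vars (less_fm s t) = term_vars s \<union> term_vars t"
  by (simp_all add: plus_term_def less_fm_def ordered_group_structure_def)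

lemma zmul_int_Suc: "zmul (int (Suc n)) x = x + zmul (int n) x"
  using zmul_Suc [of "int n" x] by (simp add: add.commute)

lemma multiple_term_simps [simp]:
  "term_val ordered_structure v (multiple_term n i) = zmul (int (Suc n)) (v i)"
  "wf_term ordered_structure (multiple_term n i)"
  "term_vars (multiple_term n i) = {i}"
proof -
  show "term_val ordered_structure v (multiple_term n i) = zmul (int (Suc n)) (v i)"
    by (induction n) (simp_all add: ordered_group_structure_def zmul_int_Suc del: of_nat_Suc)
  show "wf_term ordered_structure (multiple_term n i)"
    by (induction n) (simp_all add: ordered_group_structure_def)
  show "term_vars (multiple_term n i) = {i}"
    by (induction n) simp_all
qed

lemma elementary_transfer:
  assumes "elementarily_equivalent
      (ordered_structure :: ('a::linordered_ab_group_add, group_symbol, order_symbol) fo_structure)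
      (ordered_structure :: ('b::linordered_ab_group_add, group_symbol, order_symbol) fo_structure)"
    and "wf_formula (ordered_structure :: ('a, group_symbol, order_symbol) fo_structure) p" "free_vars p = {}"
    and "\<And>v. satisfies (ordered_structure :: ('b, group_symbol, order_symbol) fo_structure) v p"
  shows "satisfies (ordered_structure :: ('a, group_symbol, order_symbol) fo_structure) v p"
  using assms unfolding elementarily_equivalent_def by blast

text \<open>
  Positivity of \<open>g\<close> is written as \<open>g < g + g\<close>, since zero is not in the language.
\<close>

definition regular_sentence :: "nat \<Rightarrow> (group_symbol, order_symbol) fo_formula" where
  "regular_sentence n =
    FNot (FEx 0 (FEx 1 (FAnd (less_fm (FVar 1) (plus_term (FVar 1) (FVar 1)))
      (FNot (FEx 2 (FAnd (FNot (less_fm (multiple_term n 2) (FVar 0)))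
        (less_fm (multiple_term n 2) (plus_term (FVar 0) (multiple_term n 1)))))))))"

lemma regular_sentence:
  "satisfies (ordered_structure :: ('a::linordered_ab_group_add, _, _) fo_structure) v (regular_sentence n) \<longleftrightarrow>
    (\<forall>a g::'a. 0 < g \<longrightarrow> (\<exists>y. a \<le> zmul (int (Suc n)) y \<and> zmul (int (Suc n)) y < a + zmul (int (Suc n)) g))"
  by (simp add: regular_sentence_def) (metis not_less)

lemma regular_transfer:
  assumes ee: "elementarily_equivalent
      (ordered_structure :: ('a::linordered_ab_group_add, group_symbol, order_symbol) fo_structure)
      (ordered_structure :: ('b::linordered_ab_group_add, group_symbol, order_symbol) fo_structure)"
    and arch: "archimedean_group TYPE('b)" and m: "1 \<le> m" and g: "0 < (g::'a)"
  shows "\<exists>y. a \<le> zmul m y \<and> zmul m y < a + zmul m g"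
proof -
  obtain n where n: "m = int (Suc n)" using m by (metis zero_less_imp_eq_int Suc_pred less_le_trans zero_less_one)
  have "satisfies (ordered_structure :: ('a, group_symbol, order_symbol) fo_structure) undefined (regular_sentence n)"
  proof (rule elementary_transfer [OF ee])
    show "wf_formula (ordered_structure :: ('a, _, _) fo_structure) (regular_sentence n)"
      by (simp add: regular_sentence_def)
    show "free_vars (regular_sentence n) = {}" by (auto simp: regular_sentence_def)
    show "satisfies (ordered_structure :: ('b, _, _) fo_structure) v (regular_sentence n)" for v
      unfolding regular_sentence using archimedean_regular [OF arch] by simp
  qed
  then show ?thesis unfolding regular_sentence n using g by blast
qed

fun ex_block :: "nat \<Rightarrow> ('f, 'r) fo_formula \<Rightarrow> ('f, 'r) fo_formula" where
  "ex_block 0 p = p"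
| "ex_block (Suc k) p = FEx k (ex_block k p)"

lemma wf_ex_block [simp]: "wf_formula M (ex_block k p) = wf_formula M p"
  by (induction k) auto

lemma free_vars_ex_block: "free_vars (ex_block k p) = free_vars p - {..<k}"
proof (induction k)
  case (Suc k)
  then show ?case by (simp only: ex_block.simps free_vars.simps lessThan_Suc) blast
qed simp

lemma satisfies_ex_block:
  "satisfies M v (ex_block k p) \<longleftrightarrow> (\<exists>w. (\<forall>i\<ge>k. w i = v i) \<and> satisfies M w p)"
proof (induction k arbitrary: v)
  case 0
  have "(\<forall>i\<ge>0. w i = v i) \<longleftrightarrow> w = v" for w by (simp add: fun_eq_iff)
  then show ?case by simp
next
  case (Suc k)
  show ?case
  proof
    assume "satisfies M v (ex_block (Suc k) p)"
    then obtain x w where w: "\<forall>i\<ge>k. w i = (v(k := x)) i" "satisfies M w p" using Suc by auto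
    have "\<forall>i\<ge>Suc k. w i = v i" using w(1) by auto
    then show "\<exists>w. (\<forall>i\<ge>Suc k. w i = v i) \<and> satisfies M w p" using w(2) by blast
  next
    assume "\<exists>w. (\<forall>i\<ge>Suc k. w i = v i) \<and> satisfies M w p"
    then obtain w where w: "\<forall>i\<ge>Suc k. w i = v i" "satisfies M w p" by blast
    have "\<forall>i\<ge>k. w i = (v(k := w k)) i"
    proof (intro allI impI)
      fix i assume "i \<ge> k"
      then show "w i = (v(k := w k)) i" using w(1) by (cases "i = k") auto
    qed
    then have "satisfies M (v(k := w k)) (ex_block k p)" unfolding Suc using w(2) by blast
    then show "satisfies M v (ex_block (Suc k) p)" by auto
  qed
qed

fun conj_list :: "('f, 'r) fo_formula list \<Rightarrow> ('f, 'r) fo_formula" where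
  "conj_list [] = FEq (FVar 0) (FVar 0)"
| "conj_list (p # ps) = FAnd p (conj_list ps)"

lemma conj_list_simps [simp]:
  "wf_formula M (conj_list ps) \<longleftrightarrow> (\<forall>p\<in>set ps. wf_formula M p)"
  "satisfies M v (conj_list ps) \<longleftrightarrow> (\<forall>p\<in>set ps. satisfies M v p)"
  "free_vars (conj_list ps) = insert 0 (\<Union>p\<in>set ps. free_vars p)"
  by (induction ps) auto

definition cong_fm :: "nat \<Rightarrow> nat \<Rightarrow> nat \<times> nat \<Rightarrow> (group_symbol, order_symbol) fo_formula" where
  "cong_fm n k = (\<lambda>(i, j). FEx k (FEq (FVar i) (plus_term (FVar j) (multiple_term n k))))"

text \<open>
  Among any \<open>k\<close> elements two are congruent modulo \<open>Suc n\<close>: a parameter-free way to say that the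
  index is less than \<open>k\<close>.
\<close>

definition index_sentence :: "nat \<Rightarrow> nat \<Rightarrow> (group_symbol, order_symbol) fo_formula" where
  "index_sentence n k = FNot (ex_block k (conj_list
    (map (\<lambda>ij. FNot (cong_fm n k ij)) (filter (\<lambda>(i, j). i \<noteq> j) (List.product [0..<k] [0..<k])))))"

lemma index_sentence:
  "(\<forall>v. satisfies (ordered_structure :: ('a::linordered_ab_group_add, _, _) fo_structure) v (index_sentence n k)) \<longleftrightarrow>
    (\<forall>x :: nat \<Rightarrow> 'a. \<exists>i<k. \<exists>j<k. i \<noteq> j \<and> (\<exists>y. x i = x j + zmul (int (Suc n)) y))"
proof -
  have cong: "satisfies (ordered_structure :: ('a, _, _) fo_structure) w (cong_fm n k (i, j)) \<longleftrightarrow>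
      (\<exists>y. w i = w j + zmul (int (Suc n)) y)" if "i < k" "j < k" for w i j
    using that by (simp add: cong_fm_def)
  have "satisfies (ordered_structure :: ('a, _, _) fo_structure) v (index_sentence n k) \<longleftrightarrow>
      (\<forall>w. (\<forall>i\<ge>k. w i = v i) \<longrightarrow> (\<exists>i<k. \<exists>j<k. i \<noteq> j \<and> (\<exists>y. w i = w j + zmul (int (Suc n)) y)))" for v
    unfolding index_sentence_def using cong by (auto simp: satisfies_ex_block)
  then show ?thesis by blast
qed

text \<open>
  One direction is the pigeonhole principle. For the other, if no finite set of representatives
  existed, pairwise incongruent sequences could be prolonged forever.
\<close>

lemma finite_index_iff:
  fixes n :: int
  shows "(\<exists>C :: 'a::linordered_ab_group_add set. finite C \<and> (\<forall>x. \<exists>c\<in>C. \<exists>y. x = c + zmul n y)) \<longleftrightarrow>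
    (\<exists>k>0. \<forall>x :: nat \<Rightarrow> 'a. \<exists>i<k. \<exists>j<k. i \<noteq> j \<and> (\<exists>y. x i = x j + zmul n y))"
proof
  assume "\<exists>C :: 'a set. finite C \<and> (\<forall>x. \<exists>c\<in>C. \<exists>y. x = c + zmul n y)"
  then obtain C where C: "finite C" "\<forall>x :: 'a. \<exists>c\<in>C. \<exists>y. x = c + zmul n y" by (elim exE conjE)
  have "\<forall>x. \<exists>c. c \<in> C \<and> (\<exists>y. x - c = zmul n y)"
  proof
    fix x
    obtain c y where "c \<in> C" "x = c + zmul n y" using spec [OF C(2), of x] by (elim bexE exE)
    then show "\<exists>c. c \<in> C \<and> (\<exists>y. x - c = zmul n y)" by (intro exI [of _ c] conjI exI [of _ y]) simp_all
  qed
  from choice [OF this] obtain c where c: "\<forall>x. c x \<in> C \<and> (\<exists>y. x - c x = zmul n y)" by (elim exE)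
  have "\<exists>i<Suc (card C). \<exists>j<Suc (card C). i \<noteq> j \<and> (\<exists>z. x i = x j + zmul n z)" for x :: "nat \<Rightarrow> 'a"
  proof -
    have "\<not> inj_on (\<lambda>i. c (x i)) {..<Suc (card C)}"
    proof (rule pigeonhole)
      have "card ((\<lambda>i. c (x i)) ` {..<Suc (card C)}) \<le> card C"
        using c by (intro card_mono C) auto
      then show "card ((\<lambda>i. c (x i)) ` {..<Suc (card C)}) < card {..<Suc (card C)}" by simp
    qed
    then obtain i j where ij: "i < Suc (card C)" "j < Suc (card C)" "i \<noteq> j" "c (x i) = c (x j)"
      by (auto simp: inj_on_def)
    obtain y z where y: "x i - c (x i) = zmul n y" and z: "x j - c (x j) = zmul n z" using c by blast
    have "x i = x j + ((x i - c (x i)) - (x j - c (x j)))" by (simp add: ij(4))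
    then have "x i = x j + zmul n (y - z)" unfolding y z by (simp only: zm.scale_right_diff_distrib)
    then show ?thesis using ij by blast
  qed
  then show "\<exists>k>0. \<forall>x :: nat \<Rightarrow> 'a. \<exists>i<k. \<exists>j<k. i \<noteq> j \<and> (\<exists>y. x i = x j + zmul n y)" by blast
next
  assume "\<exists>k>0. \<forall>x :: nat \<Rightarrow> 'a. \<exists>i<k. \<exists>j<k. i \<noteq> j \<and> (\<exists>y. x i = x j + zmul n y)"
  then obtain k where k: "\<And>x :: nat \<Rightarrow> 'a. \<exists>i<k. \<exists>j<k. i \<noteq> j \<and> (\<exists>y. x i = x j + zmul n y)" by blast
  show "\<exists>C :: 'a set. finite C \<and> (\<forall>x. \<exists>c\<in>C. \<exists>y. x = c + zmul n y)"
  proof (rule ccontr)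
    assume neg: "\<not> ?thesis"
    have "\<exists>x :: nat \<Rightarrow> 'a. \<forall>i<l. \<forall>j<l. i \<noteq> j \<longrightarrow> \<not> (\<exists>y. x i = x j + zmul n y)" for l
    proof (induction l)
      case (Suc l)
      then obtain x :: "nat \<Rightarrow> 'a" where x: "\<forall>i<l. \<forall>j<l. i \<noteq> j \<longrightarrow> \<not> (\<exists>y. x i = x j + zmul n y)" by blast
      obtain z where z: "\<forall>c\<in>x ` {..<l}. \<forall>y. z \<noteq> c + zmul n y"
        using neg by (meson finite_imageI finite_lessThan)
      have "x i \<noteq> z + zmul n y" if "i < l" for i y
      proof
        assume "x i = z + zmul n y"
        then have "z = x i + zmul n (- y)" by (simp add: zmul_minus_right)
        then show False using z that by blast
      qed
      then have "\<forall>i<Suc l. \<forall>j<Suc l. i \<noteq> j \<longrightarrow> \<not> (\<exists>y. (x(l := z)) i = (x(l := z)) j + zmul n y)"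
        using x z by (auto simp: less_Suc_eq)
      then show ?case by blast
    qed simp
    then show False using k by (metis (full_types))
  qed
qed

lemma finite_index_transfer:
  assumes ee: "elementarily_equivalent
      (ordered_structure :: ('a::linordered_ab_group_add, group_symbol, order_symbol) fo_structure)
      (ordered_structure :: ('b::linordered_ab_group_add, group_symbol, order_symbol) fo_structure)"
    and rank: "finite_rank TYPE('b)" and m: "1 \<le> m"
  shows "\<exists>C :: 'a set. finite C \<and> (\<forall>x. \<exists>c\<in>C. \<exists>y. x = c + zmul m y)"
proof -
  obtain n where n: "m = int (Suc n)" using m by (metis zero_less_imp_eq_int Suc_pred less_le_trans zero_less_one)
  obtain k where k: "0 < k" "\<forall>x :: nat \<Rightarrow> 'b. \<exists>i<k. \<exists>j<k. i \<noteq> j \<and> (\<exists>y. x i = x j + zmul (int (Suc n)) y)"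
    using finite_rank_finite_index [OF rank m] unfolding finite_index_iff n by blast
  have "satisfies (ordered_structure :: ('a, group_symbol, order_symbol) fo_structure) v (index_sentence n k)" for v
  proof (rule elementary_transfer [OF ee])
    show "wf_formula (ordered_structure :: ('a, _, _) fo_structure) (index_sentence n k)"
      by (auto simp: index_sentence_def cong_fm_def)
    show "free_vars (index_sentence n k) = {}"
      using k(1) by (auto simp: index_sentence_def cong_fm_def free_vars_ex_block)
    show "satisfies (ordered_structure :: ('b, _, _) fo_structure) v (index_sentence n k)" for v
      using k(2) index_sentence [of n k, where 'a = 'b] by blast
  qed
  then have "\<forall>x :: nat \<Rightarrow> 'a. \<exists>i<k. \<exists>j<k. i \<noteq> j \<and> (\<exists>y. x i = x j + zmul (int (Suc n)) y)"
    using index_sentence [of n k, where 'a = 'a] by blast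
  then show ?thesis unfolding finite_index_iff n using k(1) by blast
qed


section \<open>Stability\<close>

context regular_group
begin

text \<open>
  Along the progression \<open>a + i g\<close> membership of \<open>(a + i g) + (- j) g\<close> says \<open>i \<le> j\<close>.
\<close>

lemma order_bounded_imp_tame:
  fixes P :: "(nat \<Rightarrow> 'a) \<Rightarrow> bool"
  assumes P: "comb (sign_atoms sgn3 1) P"
    and order: "\<And>x y :: nat \<Rightarrow> 'a. \<not> (\<forall>i<k. \<forall>j<k. P (\<lambda>_. x i + y j) \<longleftrightarrow> i \<le> j)"
  shows "finite {x. P (\<lambda>_. x)} \<or> finite {x. \<not> P (\<lambda>_. x)}"
proof (rule ccontr)
  assume "\<not> ?thesis"
  then obtain a g where ag: "\<And>i. \<bar>i\<bar> \<le> int k \<Longrightarrow> P (\<lambda>_. a + zmul i g) \<longleftrightarrow> i \<le> 0"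
    using semilinear_order_pattern [OF P, of k] by blast
  have "P (\<lambda>_. (a + zmul (int i) g) + zmul (- int j) g) \<longleftrightarrow> i \<le> j" if "i < k" "j < k" for i j
  proof -
    have eq: "(a + zmul (int i) g) + zmul (- int j) g = a + zmul (int i - int j) g"
      by (simp add: zm.scale_left_diff_distrib zm.scale_minus_left)
    show ?thesis unfolding eq using ag [of "int i - int j"] that by simp
  qed
  then show False
    using order [of "\<lambda>i. a + zmul (int i) g" "\<lambda>j. zmul (- int j) g"] by blast
qed

end

context group_expansion
begin

text \<open>
  The relation \<open>x + y \<in> P\<close> is definable, and the parameters of a defining formula are put into the
  second tuple.
\<close>

lemma stable_unary_tame:
  assumes "regular_group TYPE('a)" and stable: "stable M"
    and P: "Def M P" "comb (sign_atoms sgn3 1) P"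
  shows "finite {x. P (\<lambda>_. x)} \<or> finite {x. \<not> P (\<lambda>_. x)}"
proof -
  interpret regular_group "TYPE('a)" by fact
  define R where "R v \<longleftrightarrow> P (\<lambda>_. v 0 + v 1)" for v :: "nat \<Rightarrow> 'a"
  have "Def M R"
    unfolding R_def by (rule Def_aff_subst [OF P(1), of "\<lambda>_. 2"]) (simp add: aff_add aff_var)
  moreover have "depends 2 R" by (simp add: R_def depends_def)
  ultimately have "definable M 2 {xs. length xs = 2 \<and> R (\<lambda>i. xs ! i)}" unfolding definable_iff by blast
  then obtain p cs where p: "wf_formula M p" "free_vars p \<subseteq> {..<2 + length cs}"
    and R: "{xs. length xs = 2 \<and> R (\<lambda>i. xs ! i)} = {xs. length xs = 2 \<and> satisfies M (\<lambda>i. (xs @ cs) ! i) p}"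
    unfolding definable_over_def by blast
  have "free_vars p \<subseteq> {..<1 + Suc (length cs)}" using p(2) by simp
  then obtain k where k: "\<not> has_order_of_length M p 1 (Suc (length cs)) k"
    using stable p(1) unfolding stable_def by blast
  have sat: "satisfies M (\<lambda>l. ([x] @ (y # cs)) ! l) p \<longleftrightarrow> P (\<lambda>_. x + y)" for x y
  proof -
    have "[x, y] \<in> {xs. length xs = 2 \<and> R (\<lambda>i. xs ! i)} \<longleftrightarrow>
        [x, y] \<in> {xs. length xs = 2 \<and> satisfies M (\<lambda>i. (xs @ cs) ! i) p}" unfolding R ..
    then show ?thesis by (simp add: R_def)
  qed
  show ?thesis
  proof (rule order_bounded_imp_tame [OF P(2)])
    fix x y :: "nat \<Rightarrow> 'a"
    show "\<not> (\<forall>i<k. \<forall>j<k. P (\<lambda>_. x i + y j) \<longleftrightarrow> i \<le> j)"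
    proof
      assume "\<forall>i<k. \<forall>j<k. P (\<lambda>_. x i + y j) \<longleftrightarrow> i \<le> j"
      then have "has_order_of_length M p 1 (Suc (length cs)) k"
        unfolding has_order_of_length_def
        by (intro exI [of _ "\<lambda>i. [x i]"] exI [of _ "\<lambda>j. y j # cs"]) (simp only: sat, simp)
      then show False using k by blast
    qed
  qed
qed

end

lemma unary_definable_iff:
  fixes N :: "('a, 'g, 's) fo_structure"
  shows "unary_definable N D \<longleftrightarrow> (\<exists>P. Def N P \<and> depends 1 P \<and> D = {x. P (\<lambda>_. x)})"
proof -
  have "{[x] |x. x \<in> D} = {xs. length xs = 1 \<and> P (\<lambda>i. xs ! i)} \<longleftrightarrow> D = {x. P (\<lambda>_. x)}"
    if "depends 1 P" for P
  proof -
    have "P (\<lambda>i. [x] ! i) = P (\<lambda>_. x)" for x by (rule dependsD [OF that]) simp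
    then have "{xs. length xs = 1 \<and> P (\<lambda>i. xs ! i)} = {[x] |x. x \<in> {x. P (\<lambda>_. x)}}"
      by (auto simp: length_Suc_conv)
    then show ?thesis by auto
  qed
  then show ?thesis unfolding unary_definable_def definable_iff by blast
qed

lemma group_expansion_group:
  "group_expansion (group_structure :: ('a::linordered_ab_group_add, group_symbol, order_symbol) fo_structure)"
proof
  let ?p = "FEq (FApp PlusSym [FVar 0, FVar 1]) (FVar 2) :: (group_symbol, order_symbol) fo_formula"
  have "wf_formula (group_structure :: ('a, group_symbol, order_symbol) fo_structure) ?p"
    by (simp add: group_structure_def)
  from Def_satisfies [OF this]
  show "Def (group_structure :: ('a, group_symbol, order_symbol) fo_structure) (\<lambda>v. v 0 + v 1 = v 2)"
    by (simp add: group_structure_def)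
qed

text \<open>
  All that has to be known about \<open>M\<close> once its definable sets are linear: they are then definable
  in the group, and the bound on orders gives stability.
\<close>

lemma (in group_expansion) linear_consequences:
  assumes linear: "\<And>k P. Def M P \<Longrightarrow> depends k P \<Longrightarrow> Comb zt k P"
  shows "stable M"
    and "unary_definable M D \<Longrightarrow>
      unary_definable (group_structure :: ('a, group_symbol, order_symbol) fo_structure) D"
    and "reduct M (group_structure :: ('a, group_symbol, order_symbol) fo_structure)"
proof -
  have group: "Def (group_structure :: ('a, group_symbol, order_symbol) fo_structure) P" if P: "Def M P" for P
  proof -
    obtain k where "depends k P" using Def_depends [OF P] .
    then show ?thesis by (rule group_expansion.Def_Comb_zt [OF group_expansion_group linear [OF P]])
  qed
  show "stable M"
    unfolding stable_def
  proof (intro allI impI, elim conjE)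
    fix p m n
    assume p: "wf_formula M p" "free_vars p \<subseteq> {..<m + n}"
    have "depends (m + n) (\<lambda>v. satisfies M v p)"
      by (rule dependsI, rule satisfies_cong) (use p(2) in auto)
    then have "Comb zt (m + n) (\<lambda>v. satisfies M v p)" by (rule linear [OF Def_satisfies [OF p(1)]])
    from linear_order_bound [OF this, of m]
    obtain l :: nat where l: "\<not> (\<exists>x y. \<forall>i<l. \<forall>j<l.
        satisfies M (\<lambda>t. if t < m then x i t else y j (t - m)) p \<longleftrightarrow> i \<le> j)"
      by (elim exE)
    have "\<not> has_order_of_length M p m n l"
    proof
      assume "has_order_of_length M p m n l"
      then obtain a b where ab: "\<forall>i<l. length (a i) = m \<and> length (b i) = n"
        "\<forall>i<l. \<forall>j<l. satisfies M (\<lambda>t. (a i @ b j) ! t) p \<longleftrightarrow> i \<le> j"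
        unfolding has_order_of_length_def by blast
      have "(\<lambda>t. (a i @ b j) ! t) = (\<lambda>t. if t < m then a i ! t else b j ! (t - m))" if "i < l" for i j
        using ab(1) that by (simp add: nth_append fun_eq_iff)
      then have "\<forall>i<l. \<forall>j<l. satisfies M (\<lambda>t. if t < m then a i ! t else b j ! (t - m)) p \<longleftrightarrow> i \<le> j"
        using ab(2) by simp
      then have "\<exists>x y. \<forall>i<l. \<forall>j<l. satisfies M (\<lambda>t. if t < m then x i t else y j (t - m)) p \<longleftrightarrow> i \<le> j"
        by (intro exI [of _ "\<lambda>i t. a i ! t"] exI [of _ "\<lambda>j t. b j ! t"])
      with l show False ..
    qed
    then show "\<exists>k. \<not> has_order_of_length M p m n k" by blast
  qed
  show "unary_definable (group_structure :: ('a, group_symbol, order_symbol) fo_structure) D"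
    if "unary_definable M D"
    using that group unfolding unary_definable_iff by blast
  show "reduct M (group_structure :: ('a, group_symbol, order_symbol) fo_structure)"
    by (rule reductI) (rule group [OF Def_satisfies])
qed

text \<open>
  The same relation \<open>x + y \<in> P\<close>, now with the bound for linear relations in place of stability.
\<close>

lemma (in regular_group) unary_linear_tame:
  assumes P: "Def (group_structure :: ('a, group_symbol, order_symbol) fo_structure) P"
    "comb (sign_atoms sgn3 1) P"
  shows "finite {x. P (\<lambda>_. x)} \<or> finite {x. \<not> P (\<lambda>_. x)}"
proof -
  obtain k where "Comb zt k P" using Def_group_Comb [OF P(1)] by blast
  then have Comb: "Comb zt 2 (\<lambda>v. P (\<lambda>i. v 0 + v 1))" by (rule Comb_subst) (simp add: aff_add aff_var)
  define Q where "Q v \<longleftrightarrow> P (\<lambda>_. v 0 + v 1)" for v :: "nat \<Rightarrow> 'a"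
  have "Comb zt 2 Q" using Comb unfolding Q_def .
  from linear_order_bound [OF this, of 1]
  obtain l :: nat where l: "\<not> (\<exists>x y. \<forall>i<l. \<forall>j<l. Q (\<lambda>n. if n < 1 then x i n else y j (n - 1)) \<longleftrightarrow> i \<le> j)"
    by (elim exE)
  show ?thesis
  proof (rule order_bounded_imp_tame [OF P(2)])
    fix x y :: "nat \<Rightarrow> 'a"
    show "\<not> (\<forall>i<l. \<forall>j<l. P (\<lambda>_. x i + y j) \<longleftrightarrow> i \<le> j)"
    proof
      assume "\<forall>i<l. \<forall>j<l. P (\<lambda>_. x i + y j) \<longleftrightarrow> i \<le> j"
      then have "\<exists>x y. \<forall>i<l. \<forall>j<l. Q (\<lambda>n. if n < 1 then x i n else y j (n - 1)) \<longleftrightarrow> i \<le> j"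
        by (intro exI [of _ "\<lambda>i _. x i"] exI [of _ "\<lambda>j _. y j"]) (simp add: Q_def)
      with l show False ..
    qed
  qed
qed

section \<open>Reducts of ordered groups that expand the group\<close>

lemma group_expansion_of_reduct:
  fixes M :: "('a::linordered_ab_group_add, 'f, 'r) fo_structure"
  assumes "expansion M (group_structure :: ('a, group_symbol, order_symbol) fo_structure)"
  shows "group_expansion M"
  by unfold_locales (rule reduct_Def [OF assms group_expansion.Def_add [OF group_expansion_group]])

theorem corollary5p6:
  fixes M :: "('a::linordered_ab_group_add, 'f, 'r) fo_structure"
  assumes "archimedean_group TYPE('b::linordered_ab_group_add)"
    and "finite_rank TYPE('b)"
    and "elementarily_equivalent
           (ordered_group_structure :: ('a, group_symbol, order_symbol) fo_structure)
           (ordered_group_structure :: ('b, group_symbol, order_symbol) fo_structure)"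
    and "reduct M (ordered_group_structure :: ('a, group_symbol, order_symbol) fo_structure)"
    and "expansion M (group_structure :: ('a, group_symbol, order_symbol) fo_structure)"
  shows "(stable M \<longleftrightarrow>
           (\<forall>D::'a set. unary_definable M D \<longrightarrow> unary_definable group_structure D)) \<and>
         ((stable M \<or>
           (\<forall>D::'a set. unary_definable M D \<longrightarrow> unary_definable group_structure D))
           \<longrightarrow> interdefinable M group_structure)"
proof -
  interpret group_expansion M by (rule group_expansion_of_reduct [OF assms(5)])
  have linear: "Comb zt k P"
    if cond: "stable M \<or> (\<forall>D::'a set. unary_definable M D \<longrightarrow> unary_definable group_structure D)"
      and P: "Def M P" "depends k P" for k P
  proof (cases "\<exists>g::'a. 0 < g")
    case True
    interpret regular_group "TYPE('a)"
      by unfold_locales (use regular_transfer [OF assms(3,1)] finite_index_transfer [OF assms(3,2)] True in auto)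
    have tame: "finite {x. Q (\<lambda>_. x)} \<or> finite {x. \<not> Q (\<lambda>_. x)}"
      if Q: "Def M Q" "comb (sign_atoms sgn3 1) Q" for Q
    proof (cases "stable M")
      case True
      then show ?thesis using stable_unary_tame [OF regular_group_axioms True Q] by blast
    next
      case False
      have dep: "depends 1 Q" by (rule Comb_depends [of sgn3], rule comb_mono [OF Q(2)]) simp
      have "unary_definable M {x. Q (\<lambda>_. x)}" unfolding unary_definable_iff using Q(1) dep by blast
      then have "unary_definable (group_structure :: ('a, group_symbol, order_symbol) fo_structure) {x. Q (\<lambda>_. x)}"
        using cond False by blast
      then obtain Q' where Q': "Def (group_structure :: ('a, group_symbol, order_symbol) fo_structure) Q'"
        "depends 1 Q'" "{x. Q (\<lambda>_. x)} = {x. Q' (\<lambda>_. x)}" unfolding unary_definable_iff by blast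
      have "Q = Q'"
      proof
        fix v
        have "Q v = Q (\<lambda>_. v 0)" by (rule dependsD [OF dep]) simp
        also have "\<dots> = Q' (\<lambda>_. v 0)" using Q'(3) by blast
        also have "\<dots> = Q' v" by (rule dependsD [OF Q'(2)]) simp
        finally show "Q v = Q' v" .
      qed
      then show ?thesis using unary_linear_tame Q'(1) Q(2) by blast
    qed
    interpret regular_expansion M
    proof
      show "\<exists>k. Comb sgn3 k P" if "Def M P" for P
        by (rule Def_ordered_Comb [OF reduct_Def [OF assms(4) that]])
    qed (rule tame)
    show ?thesis using P by (rule Def_linear)
  next
    case False
    \<comment> \<open>in the trivial group there is only one assignment\<close>
    have "x = 0" for x :: 'a using False by (metis linorder_neqE neg_0_less_iff_less)
    then have "v = w" for v w :: "nat \<Rightarrow> 'a" by (metis ext)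
    then have "P = (\<lambda>_. P undefined)" by metis
    then show ?thesis by (metis comb_const)
  qed
  let ?unary = "\<forall>D::'a set. unary_definable M D \<longrightarrow>
    unary_definable (group_structure :: ('a, group_symbol, order_symbol) fo_structure) D"
  have "stable M \<and> ?unary \<and> interdefinable M (group_structure :: ('a, group_symbol, order_symbol) fo_structure)"
    if "stable M \<or> ?unary"
    using linear_consequences [OF linear [OF that]] assms(5) unfolding interdefinable_def by blast
  then show ?thesis by blast
qed

end
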